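(* Let $a,b$ be nonnegative integers. Let $r,s$ be integers relatively prime to $2$, with $r>0$. Then \[a_0^{(6)}(2^ar,2^bs)\equiv 0 \pmod{2^{a-b+2}}\ \text{ if } a>b,\qquad a_0^{(6)}(2^ar,2^bs)\equiv 0 \pmod{2^{2}}\ \text{ if } b>a.\] Now let $r,s$ be integers relatively prime to $3$, with $r>0$. Then \[a_0^{(6)}(3^ar,3^bs)\equiv 0 \pmod{3^{a-b+1}}\ \text{ if } a>b,\qquad a_0^{(6)}(3^ar,3^bs)\equiv 0 \pmod{3}\ \text{ if } b>a.\]
   Context: $M_0^\sharp(6)$ is the space of weakly holomorphic modular functions (weight $0$) for $\Gamma_0(6)$ that are holomorphic on the upper half plane and at all cusps other than $\infty$. Write $q=e^{2\pi i z}$. For each integer $m\ge 0$, $f_{0,m}^{(6)}$ is the unique element of $M_0^\sharp(6)$ with Fourier expansion $q^{-m}+\sum_{n\ge 1}a_0^{(6)}(m,n)q^n$ (no other nonpositive powers of $q$ and zero constant term unless $m=0$, where $f_{0,0}^{(6)}=1$). For any integer $n$, $a_0^{(6)}(m,n)$ denotes the coefficient of $q^n$ in $f_{0,m}^{(6)}$; these are integers. *)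

theory Defs
  imports "HOL-Analysis.Analysis"
begin

definition SL2Z :: "(int^2^2) set" where
  "SL2Z = {A. det A = 1}"

definition Gamma0 :: "nat \<Rightarrow> (int^2^2) set" where
  "Gamma0 N = {A \<in> SL2Z. int N dvd A $ 2 $ 1}"

definition upper_half_plane :: "complex set" where
  "upper_half_plane = {z. Im z > 0}"

definition moebius :: "int^2^2 \<Rightarrow> complex \<Rightarrow> complex" where
  "moebius A z = (of_int (A $ 1 $ 1) * z + of_int (A $ 1 $ 2)) /
                 (of_int (A $ 2 $ 1) * z + of_int (A $ 2 $ 2))"

text \<open>
  Expansion in powers of \<open>exp (2 \<pi> i z / h)\<close> with only finitely many negative exponents.
  A function that is holomorphic on the upper half plane, has period \<open>h\<close> and is meromorphic
  at the cusp has such an expansion, convergent on the whole upper half plane.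
\<close>

definition has_q_expansion :: "nat \<Rightarrow> (complex \<Rightarrow> complex) \<Rightarrow> (int \<Rightarrow> complex) \<Rightarrow> bool" where
  "has_q_expansion h f c \<longleftrightarrow>
     finite {n. n < 0 \<and> c n \<noteq> 0} \<and>
     (\<forall>z\<in>upper_half_plane.
        ((\<lambda>n. c n * exp (2 * of_real pi * \<i> * of_int n * z / of_nat h)) has_sum f z) UNIV)"

definition fourier_coeff :: "(complex \<Rightarrow> complex) \<Rightarrow> int \<Rightarrow> complex" where
  "fourier_coeff f = (THE c. has_q_expansion 1 f c)"

text \<open>
  A cusp is represented by a matrix \<open>A\<close> in \<open>SL2Z\<close>, standing for the point
  \<open>A \<infinity> = A\<^sub>1\<^sub>1 / A\<^sub>2\<^sub>1\<close> of the rational projective line. Since \<open>\<Gamma>(N)\<close> is normal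
  in \<open>SL2Z\<close> and contains the translation by \<open>N\<close>, the function \<open>f \<circ> moebius A\<close> has
  period \<open>N\<close> whenever \<open>f\<close> is invariant under \<open>\<Gamma>\<^sub>0(N)\<close>; so the behaviour of \<open>f\<close> at the
  cusp \<open>A \<infinity>\<close> is read off from an expansion with \<open>h = N\<close>, although the width of the cusp
  may be a proper divisor of \<open>N\<close>.
\<close>

definition meromorphic_at_cusp :: "nat \<Rightarrow> (complex \<Rightarrow> complex) \<Rightarrow> int^2^2 \<Rightarrow> bool" where
  "meromorphic_at_cusp N f A \<longleftrightarrow> (\<exists>c. has_q_expansion N (f \<circ> moebius A) c)"

definition holomorphic_at_cusp :: "nat \<Rightarrow> (complex \<Rightarrow> complex) \<Rightarrow> int^2^2 \<Rightarrow> bool" where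
  "holomorphic_at_cusp N f A \<longleftrightarrow>
     (\<exists>c. has_q_expansion N (f \<circ> moebius A) c \<and> (\<forall>n<0. c n = 0))"

text \<open>The cusp \<open>A \<infinity>\<close> equals \<open>G \<infinity>\<close> for some \<open>G\<close> in \<open>\<Gamma>\<^sub>0(N)\<close>, i.e. both are the same
  cusp of \<open>\<Gamma>\<^sub>0(N)\<close> as \<open>\<infinity>\<close>; cross-multiplication covers the case \<open>A\<^sub>2\<^sub>1 = 0\<close>.\<close>

definition equiv_infinity :: "nat \<Rightarrow> int^2^2 \<Rightarrow> bool" where
  "equiv_infinity N A \<longleftrightarrow> (\<exists>G\<in>Gamma0 N. A $ 1 $ 1 * G $ 2 $ 1 = G $ 1 $ 1 * A $ 2 $ 1)"

lemma equiv_infinity_iff: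
  assumes "A \<in> SL2Z"
  shows "equiv_infinity N A \<longleftrightarrow> A \<in> Gamma0 N"
proof
  assume "equiv_infinity N A"
  then obtain G :: "int^2^2" where G: "det G = 1" "int N dvd G $ 2 $ 1"
    and eq: "A $ 1 $ 1 * G $ 2 $ 1 = G $ 1 $ 1 * A $ 2 $ 1"
    by (auto simp: equiv_infinity_def Gamma0_def SL2Z_def)
  have "A $ 2 $ 1 = A $ 2 $ 1 * (G $ 1 $ 1 * G $ 2 $ 2 - G $ 1 $ 2 * G $ 2 $ 1)"
    using G(1) by (simp add: det_2)
  also have "\<dots> = G $ 2 $ 1 * (A $ 1 $ 1 * G $ 2 $ 2 - A $ 2 $ 1 * G $ 1 $ 2)"
    using eq by algebra
  finally have "G $ 2 $ 1 dvd A $ 2 $ 1" by (rule dvdI)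
  with G(2) assms show "A \<in> Gamma0 N"
    by (auto simp: Gamma0_def intro: dvd_trans)
qed (auto simp: equiv_infinity_def)

text \<open>
  Weakly holomorphic modular functions for \<open>\<Gamma>\<^sub>0(N)\<close> that are holomorphic at all cusps other
  than \<open>\<infinity>\<close>. Functions on the upper half plane are extended by \<open>0\<close>, so that
  equality of elements is equality on the upper half plane.
\<close>

definition M0_sharp :: "nat \<Rightarrow> (complex \<Rightarrow> complex) set" where
  "M0_sharp N = {f.
     f holomorphic_on upper_half_plane \<and>
     (\<forall>z. z \<notin> upper_half_plane \<longrightarrow> f z = 0) \<and>
     (\<forall>A\<in>Gamma0 N. \<forall>z\<in>upper_half_plane. f (moebius A z) = f z) \<and>
     (\<forall>A\<in>SL2Z. meromorphic_at_cusp N f A) \<and>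
     (\<forall>A\<in>SL2Z. \<not> equiv_infinity N A \<longrightarrow> holomorphic_at_cusp N f A)}"

text \<open>
  The element of \<open>M0_sharp N\<close> of the form \<open>q\<^sup>-\<^sup>m + O(q)\<close>. It exists and is unique
  for every \<open>m\<close> if \<open>\<Gamma>\<^sub>0(N)\<close> has genus zero, in particular for \<open>N = 6\<close>.
  For \<open>m = 0\<close> it is the constant \<open>1\<close> (on the upper half plane).
\<close>

definition f0 :: "nat \<Rightarrow> nat \<Rightarrow> complex \<Rightarrow> complex" where
  "f0 N m = (THE f. f \<in> M0_sharp N \<and>
     (\<exists>c. has_q_expansion 1 f c \<and> c (- int m) = 1 \<and> (\<forall>n\<le>0. n \<noteq> - int m \<longrightarrow> c n = 0)))"

definition a0 :: "nat \<Rightarrow> nat \<Rightarrow> int \<Rightarrow> complex" where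
  "a0 N m n = fourier_coeff (f0 N m) n"

end

theory Submission
  imports Defs "HOL-Complex_Analysis.Complex_Analysis" "HOL-Number_Theory.Cong"
begin

text \<open>
  The Hauptmodul is \<open>\<psi>(\<tau>) = X(\<tau>) / X(3\<tau>) = q\<^sup>-\<^sup>1 Y(q) / Y(q\<^sup>3)\<close>, where \<open>X(\<tau>)\<close> is the difference of
  the Weierstrass function at the half periods \<open>\<tau>/2\<close> and \<open>(\<tau> + 1)/2\<close>, up to a constant
  \<open>q\<^sup>1\<^sup>/\<^sup>2 Y(q)\<close> with \<open>Y(q) = \<Sum> \<sigma>(2n + 1) q\<^sup>n\<close>. That \<open>X\<close> has weight two and no zeros follows from
  Liouville's theorem for elliptic functions. Hence \<open>f0 6 m\<close> is the Faber polynomial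
  \<open>F\<^sub>m\<close> of \<open>\<psi>\<close>, and the rest is about Laurent series with integer coefficients.

  Elementary properties of \<open>\<sigma>\<close> show that \<open>\<psi>\<close> has only exponents \<open>-1\<close> mod 2 when taken
  modulo 4, only exponents \<open>-1\<close> mod 4 modulo 2, and \<open>\<psi> - 1\<close> has only exponents \<open>-1\<close> mod 3 modulo 3.
  These supports pass to \<open>F\<^sub>m\<close> and to \<open>F\<^sub>2\<^sub>m\<close>, which settles \<open>b > a\<close> for \<open>a = 0\<close>
  (and \<open>a = 1\<close> for the prime 2). The Frobenius congruences \<open>F\<^sub>p\<^sub>m(q) \<equiv> F\<^sub>m(q\<^sup>p)\<close> mod \<open>p\<close> and
  \<open>F\<^sub>4\<^sub>m(q) \<equiv> F\<^sub>2\<^sub>m(q\<^sup>2)\<close> mod 4 reduce every \<open>a\<close> to these cases. The case \<open>a > b\<close> follows from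
  \<open>b > a\<close> by the duality \<open>n a(m, n) = m a(n, m)\<close>, which says that the derivative of a polynomial in
  \<open>\<psi>\<close> has residue \<open>0\<close>.
\<close>

unbundle no vec_syntax
unbundle fps_syntax

section \<open>Laurent series with integer coefficients\<close>

text \<open>Why \<open>psi\<close> has its only pole at infinity: a matrix with even lower left
  entry multiplies X by the weight two factor and a sign that depends only on the parity of the
  upper right entry. Passing from \<tau> to 3\<tau> keeps that parity and the factor, so both cancel
  in the quotient. X has no zeros, so \<open>psi\<close> is holomorphic, and it stays bounded at the
  three cusps other than infinity. Dividing by Y(q^3) stays over the integers because its constant
  term is 1. The obstacle is the modulus 4. Frobenius relates F_2m(q) to F_m(q^2) modulo 2 only;
  squaring turns a congruence modulo 2 into one modulo 4, but this reaches only the step from 2m to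
  4m. Hence a = 0 and a = 1 are both base cases. For a = 1 the building block is the square of
  \<open>Psi\<close>: support modulo 2 in the class -1 mod 4 becomes, after squaring, support modulo
  4 in the class -2 mod 4. Duality trades p^b on one side for p^a on the other, so for a > b it adds
  the factor p^(a-b) to the divisibility known for b > a.\<close>

text \<open>Any lower bounds may replace the exact subdegrees, so the convolution can be evaluated
  between the exponents that a computation suggests.\<close>

lemma fls_mult_nth_bounded:
  fixes F G :: "'a :: comm_ring_1 fls"
  assumes "\<And>n. n < N \<Longrightarrow> F $$ n = 0" and "\<And>n. n < N' \<Longrightarrow> G $$ n = 0"
  shows "(F * G) $$ n = (\<Sum>i\<in>{N..n-N'}. F $$ i * G $$ (n - i))"
proof -
  let ?A = "{fls_subdegree F..n - fls_subdegree G}"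
  have "(F * G) $$ n = (\<Sum>i\<in>?A. F $$ i * G $$ (n - i))"
    by (rule fls_times_nth(2))
  also have "\<dots> = (\<Sum>i\<in>?A \<inter> {N..n-N'}. F $$ i * G $$ (n - i))"
  proof (intro sum.mono_neutral_right ballI)
    fix i assume i: "i \<in> ?A - ?A \<inter> {N..n-N'}"
    then have "i < N \<or> n - i < N'" by auto
    then show "F $$ i * G $$ (n - i) = 0" using assms by auto
  qed auto
  also have "\<dots> = (\<Sum>i\<in>{N..n-N'}. F $$ i * G $$ (n - i))"
  proof (intro sum.mono_neutral_left ballI)
    fix i assume i: "i \<in> {N..n-N'} - ?A \<inter> {N..n-N'}"
    then have "i < fls_subdegree F \<or> n - i < fls_subdegree G" by auto
    then show "F $$ i * G $$ (n - i) = 0" by auto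
  qed auto
  finally show ?thesis .
qed

text \<open>Congruences between Laurent series are written as divisibility in the ring, so that ring
  identities apply to them, and are read off coefficientwise only at the end.\<close>

lemma fls_const_dvd_iff:
  fixes F :: "int fls"
  shows "fls_const M dvd F \<longleftrightarrow> (\<forall>n. M dvd F $$ n)"
proof
  assume "fls_const M dvd F"
  then show "\<forall>n. M dvd F $$ n" by (auto elim!: dvdE)
next
  assume *: "\<forall>n. M dvd F $$ n"
  have "\<forall>k<fls_subdegree F. F $$ k div M = 0" by simp
  then have nth: "Abs_fls (\<lambda>k. F $$ k div M) $$ n = F $$ n div M" for n
    by (rule nth_Abs_fls_lower_bound)
  have "F = fls_const M * Abs_fls (\<lambda>k. F $$ k div M)"
    using * by (intro fls_eqI) (simp add: nth)
  then show "fls_const M dvd F" by (rule dvdI)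
qed

text \<open>After reduction of the coefficients modulo \<open>M\<close>, the series is homogeneous
  of degree \<open>r\<close> in the grading by exponents modulo \<open>P\<close>; degrees add under
  multiplication. The two moduli are independent: (4, 2), (2, 4), (4, 4) and (3, 3) all
  occur.\<close>

definition supported_mod :: "int \<Rightarrow> int \<Rightarrow> int \<Rightarrow> int fls \<Rightarrow> bool" where
  "supported_mod M P r F \<longleftrightarrow> (\<forall>n. M dvd F $$ n \<or> P dvd n - r)"

lemma supported_mod_cong: "supported_mod M P r F \<Longrightarrow> P dvd r - r' \<Longrightarrow> supported_mod M P r' F"
  unfolding supported_mod_def by (metis diff_add_cancel dvd_add group_cancel.sub1 add_diff_eq)

lemma supported_mod_const: "supported_mod M P 0 (fls_const c)"
  by (auto simp: supported_mod_def)

lemma supported_mod_diff: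
  "supported_mod M P r F \<Longrightarrow> supported_mod M P r G \<Longrightarrow> supported_mod M P r (F - G)"
  by (auto simp: supported_mod_def) (metis dvd_diff)

lemma supported_mod_sum:
  "(\<And>i. i \<in> A \<Longrightarrow> supported_mod M P r (F i)) \<Longrightarrow> supported_mod M P r (\<Sum>i\<in>A. F i)"
  by (auto simp: supported_mod_def fls_nth_sum) (metis dvd_sum)

lemma supported_mod_mult:
  assumes "supported_mod M P r F" and "supported_mod M P s G"
  shows "supported_mod M P (r + s) (F * G)"
  unfolding supported_mod_def
proof (intro allI)
  fix n
  show "M dvd (F * G) $$ n \<or> P dvd n - (r + s)"
  proof (cases "P dvd n - (r + s)")
    case False
    have "M dvd F $$ i * G $$ (n - i)" for i
    proof (cases "P dvd i - r")
      case True
      have "\<not> P dvd n - i - s"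
      proof
        assume "P dvd n - i - s"
        with True have "P dvd (i - r) + (n - i - s)" by (rule dvd_add)
        with False show False by (simp add: algebra_simps)
      qed
      with assms(2) show ?thesis unfolding supported_mod_def by (meson dvd_mult)
    next
      case False
      with assms(1) show ?thesis unfolding supported_mod_def by (meson dvd_mult2)
    qed
    then show ?thesis unfolding fls_times_nth(2) by (intro disjI1 dvd_sum)
  qed simp
qed

section \<open>Frobenius congruences for integer power series and Laurent series\<close>

lemma dvd_freshman_dream:
  fixes x y :: "'a :: comm_ring_1"
  assumes "prime (p::nat)"
  shows "of_nat p dvd (x + y) ^ p - (x ^ p + y ^ p)"
proof -
  have p: "p > 0" using assms by (rule prime_gt_0_nat)
  have "(x + y) ^ p = (\<Sum>k\<in>{..p}. of_nat (p choose k) * x ^ k * y ^ (p - k))"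
    by (rule binomial_ring)
  also have "{..p} = insert 0 (insert p {1..<p})" using p by auto
  also have "(\<Sum>k\<in>\<dots>. of_nat (p choose k) * x ^ k * y ^ (p - k)) =
      y ^ p + (x ^ p + (\<Sum>k\<in>{1..<p}. of_nat (p choose k) * x ^ k * y ^ (p - k)))"
    using p by (subst sum.insert) auto
  finally have "(x + y) ^ p - (x ^ p + y ^ p) = (\<Sum>k\<in>{1..<p}. of_nat (p choose k) * x ^ k * y ^ (p - k))"
    by simp
  also have "of_nat p dvd \<dots>"
  proof (rule dvd_sum)
    fix k assume "k \<in> {1..<p}"
    then have "p dvd p choose k" by (intro dvd_choose_prime assms) auto
    then have "(of_nat p :: 'a) dvd of_nat (p choose k)" by (metis dvdE dvd_triv_left of_nat_mult)
    then show "(of_nat p :: 'a) dvd of_nat (p choose k) * x ^ k * y ^ (p - k)"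
      by (intro dvd_mult2)
  qed
  finally show ?thesis .
qed

lemma int_fermat: "prime (p::nat) \<Longrightarrow> int p dvd c ^ p - c"
proof -
  assume p: "prime p"
  have nonneg: "int p dvd int n ^ p - int n" for n
  proof (induction n)
    case (Suc n)
    have "int p dvd (int n + 1) ^ p - (int n ^ p + 1 ^ p)"
      using dvd_freshman_dream[OF p, of "int n" 1] by simp
    from dvd_add[OF this Suc] show ?case by (simp add: algebra_simps)
  qed (use p in \<open>simp add: prime_gt_0_nat zero_power\<close>)
  have "\<exists>n. [c = int n] (mod int p)"
    using p by (intro exI[of _ "nat (c mod int p)"]) (simp add: prime_gt_0_nat cong_def)
  then obtain n where n: "[c = int n] (mod int p)" ..
  then have "[c ^ p - c = int n ^ p - int n] (mod int p)" by (intro cong_diff cong_pow)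
  with nonneg[of n] show ?thesis by (simp add: cong_dvd_iff)
qed

text \<open>Splitting off the constant term, f = c + X g, the freshman's dream leaves c^p + X^p g^p
  modulo p. Fermat handles c^p, and the induction hypothesis is used for the different series g at
  the exponent n - p, hence the generalisation over \<open>f\<close>.\<close>

lemma fps_frobenius:
  fixes f :: "int fps"
  assumes p: "prime (p::nat)"
  shows "int p dvd (f ^ p) $ n - (if p dvd n then f $ (n div p) else 0)"
proof (induction n arbitrary: f rule: less_induct)
  case (less n)
  let ?c = "fps_const (f $ 0)" and ?g = "fps_shift 1 f"
  have pos: "p > 0" using p by (rule prime_gt_0_nat)
  have f: "f = ?c + fps_X * ?g"
    by (rule fps_ext) auto
  have "fps_const (int p) dvd f ^ p - (?c ^ p + (fps_X * ?g) ^ p)"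
    using dvd_freshman_dream[OF p, of ?c "fps_X * ?g"] f
    by (metis fps_of_nat of_nat_id int_ops(1))
  then have "int p dvd (f ^ p - (?c ^ p + (fps_X * ?g) ^ p)) $ n"
    by (metis dvdE dvd_triv_left fps_mult_left_const_nth)
  then have 1: "int p dvd (f ^ p) $ n - ((?c ^ p) $ n + (fps_X ^ p * ?g ^ p) $ n)"
    by (simp add: power_mult_distrib fps_sub_nth)
  have c: "(?c ^ p) $ n = (if n = 0 then (f $ 0) ^ p else 0)"
    by (simp add: fps_const_power)
  show ?case
  proof (cases "n < p")
    case True
    then have "(fps_X ^ p * ?g ^ p) $ n = 0" by (simp add: fps_X_power_mult_nth)
    moreover have "p dvd n \<longleftrightarrow> n = 0" using True by (auto dest: dvd_imp_le)
    moreover have "int p dvd (f ^ p) $ 0 - f $ 0" using int_fermat[OF p] by (simp add: fps_nth_power_0)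
    ultimately show ?thesis using 1 c by (auto split: if_splits)
  next
    case False
    with pos have "int p dvd (?g ^ p) $ (n - p) - (if p dvd n - p then ?g $ ((n - p) div p) else 0)"
      by (intro less) auto
    moreover have "(fps_X ^ p * ?g ^ p) $ n = (?g ^ p) $ (n - p)"
      using False by (simp add: fps_X_power_mult_nth)
    moreover have "(p dvd n - p) = (p dvd n)" using False by (simp add: dvd_minus_self)
    moreover have "?g $ ((n - p) div p) = f $ (n div p)"
      using False pos by (simp add: le_div_geq)
    moreover have "n \<noteq> 0" using False pos by auto
    ultimately have "int p dvd (fps_X ^ p * ?g ^ p) $ n - (if p dvd n then f $ (n div p) else 0)"
      and "int p dvd (f ^ p) $ n - (fps_X ^ p * ?g ^ p) $ n" using 1 c by auto
    from dvd_add[OF this] show ?thesis by simp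
  qed
qed

lemma fls_frobenius:
  fixes F :: "int fls"
  assumes p: "prime (p::nat)"
  shows "fls_const (int p) dvd F ^ p - fls_compose_power F p"
proof -
  define n where "n = nat (max 0 (- fls_subdegree F))"
  have n: "- fls_subdegree F \<le> int n" unfolding n_def by auto
  obtain f where f: "F = fls_shift n (fps_to_fls f)" using fls_as_fps[OF n] by blast
  have pos: "p > 0" using p by (rule prime_gt_0_nat)
  have "F ^ p = fls_shift (int p * n) (fps_to_fls (f ^ p))"
    unfolding f by (simp add: fls_shifted_pow fps_to_fls_power mult.commute)
  moreover have "fls_compose_power F p = fls_shift (int p * n) (fps_to_fls (f oo fps_X ^ p))"
    unfolding f using pos by (simp add: fls_compose_power_fps_to_fls)
  ultimately have eq: "F ^ p - fls_compose_power F p = fls_shift (int p * n) (fps_to_fls (f ^ p - (f oo fps_X ^ p)))"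
    by (intro fls_eqI) (simp add: fps_sub_nth)
  show ?thesis unfolding fls_const_dvd_iff eq
    using fps_frobenius[OF p, of f] by (auto simp: fps_nth_compose_X_power)
qed

section \<open>Polynomials in a Laurent series with a simple pole\<close>

locale simple_pole_fls =
  fixes Psi :: "int fls"
  assumes Psi_lead: "Psi $$ (-1) = 1" and Psi_low: "\<And>n. n < -1 \<Longrightarrow> Psi $$ n = 0"
begin

text \<open>This is the ring Z[Psi]. Closing only under multiplication by \<open>Psi\<close> keeps
  every induction over membership to a Horner step.\<close>

inductive_set R :: "int fls set" where
  R_const: "fls_const c \<in> R"
| R_Psi_mult: "F \<in> R \<Longrightarrow> Psi * F \<in> R"
| R_add: "F \<in> R \<Longrightarrow> G \<in> R \<Longrightarrow> F + G \<in> R"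

lemma R_1: "1 \<in> R" using R_const[of 1] by simp

lemma R_0: "0 \<in> R" using R_const[of 0] by simp

lemma R_Psi: "Psi \<in> R" using R_Psi_mult[OF R_1] by simp

lemma R_const_mult: "F \<in> R \<Longrightarrow> fls_const c * F \<in> R"
proof (induction rule: R.induct)
  case (R_const d)
  then show ?case using R.R_const[of "c * d"] by (simp add: fls_const_mult_const)
next
  case (R_Psi_mult F)
  then show ?case using R.R_Psi_mult[of "fls_const c * F"] by (simp add: mult.left_commute)
next
  case (R_add F G)
  then show ?case using R.R_add by (simp add: distrib_left)
qed

lemma R_mult: "F \<in> R \<Longrightarrow> G \<in> R \<Longrightarrow> F * G \<in> R"
proof (induction rule: R.induct)
  case (R_const c)
  then show ?case by (rule R_const_mult)
next
  case (R_Psi_mult F)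
  then show ?case using R.R_Psi_mult[of "F * G"] by (simp add: mult.assoc)
next
  case (R_add F F')
  then show ?case using R.R_add by (simp add: distrib_right)
qed

lemma R_power: "F \<in> R \<Longrightarrow> F ^ n \<in> R"
  by (induction n) (auto intro: R_mult R_1)

lemma R_diff: "F \<in> R \<Longrightarrow> G \<in> R \<Longrightarrow> F - G \<in> R"
  using R_add[of F "fls_const (-1) * G"] R_const_mult[of G "-1"] by (simp add: fls_const_uminus)

lemma R_sum: "(\<And>i. i \<in> A \<Longrightarrow> F i \<in> R) \<Longrightarrow> (\<Sum>i\<in>A. F i) \<in> R"
  by (induction A rule: infinite_finite_induct) (auto intro: R_add R_0)

text \<open>The representation holds for every large degree bound, padded with zeros, so that two of
  them can be brought to a common degree and added.\<close>

lemma R_representation: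
  "F \<in> R \<Longrightarrow> \<exists>c d. \<forall>D\<ge>d. F = (\<Sum>i\<le>D. fls_const (c i) * Psi ^ i)"
proof (induction rule: R.induct)
  case (R_const c)
  have "fls_const c = (\<Sum>i\<le>D. fls_const (if i = 0 then c else 0) * Psi ^ i)" for D
    by (induction D) auto
  then show ?case by (intro exI[of _ "\<lambda>i. if i = 0 then c else 0"]) blast
next
  case (R_Psi_mult F)
  then obtain c d where cd: "\<And>D. D \<ge> d \<Longrightarrow> F = (\<Sum>i\<le>D. fls_const (c i) * Psi ^ i)" by blast
  have "Psi * F = (\<Sum>i\<le>D. fls_const (case i of 0 \<Rightarrow> 0 | Suc j \<Rightarrow> c j) * Psi ^ i)" if "D \<ge> Suc d" for D
  proof -
    from that obtain D' where D': "D = Suc D'" "D' \<ge> d" by (cases D) auto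
    have "Psi * F = (\<Sum>i\<le>D'. fls_const (c i) * Psi ^ Suc i)"
      by (subst cd[OF D'(2)]) (simp add: sum_distrib_left mult_ac)
    also have "\<dots> = (\<Sum>i\<le>D. fls_const (case i of 0 \<Rightarrow> 0 | Suc j \<Rightarrow> c j) * Psi ^ i)"
      unfolding D'(1) by (subst sum.atMost_Suc_shift) simp
    finally show ?thesis .
  qed
  then show ?case by blast
next
  case (R_add F G)
  then obtain c d c' d' where F: "\<And>D. D \<ge> d \<Longrightarrow> F = (\<Sum>i\<le>D. fls_const (c i) * Psi ^ i)"
    and G: "\<And>D. D \<ge> d' \<Longrightarrow> G = (\<Sum>i\<le>D. fls_const (c' i) * Psi ^ i)" by metis
  have "F + G = (\<Sum>i\<le>D. fls_const (c i + c' i) * Psi ^ i)" if "D \<ge> max d d'" for D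
    using F[of D] G[of D] that by (simp add: distrib_right sum.distrib flip: fls_plus_const)
  then show ?case by (intro exI allI impI)
qed

section \<open>Leading terms of powers of \<open>Psi\<close> and the Faber polynomials\<close>

lemma subdegree_Psi: "fls_subdegree Psi = -1"
  by (rule fls_subdegree_eqI) (use Psi_lead Psi_low in auto)

lemma Psi_power_lead: "(Psi ^ n) $$ (- int n) = 1"
  using fls_pow_base[of Psi n] by (simp add: subdegree_Psi Psi_lead)

lemma Psi_power_low: "k < - int n \<Longrightarrow> (Psi ^ n) $$ k = 0"
  using fls_pow_nth_below_subdegree[of k n Psi] by (simp add: subdegree_Psi)

text \<open>The powers of \<open>Psi\<close> have different pole orders, so the vanishing
  coefficients at nonpositive exponents remove the polynomial coefficients one by one from the top,
  down to the constant one.\<close>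

lemma R_eq_0:
  assumes "F \<in> R" and "\<And>n. n \<le> 0 \<Longrightarrow> F $$ n = 0"
  shows "F = 0"
proof -
  obtain c D where F: "F = (\<Sum>i\<le>D. fls_const (c i) * Psi ^ i)"
    using R_representation[OF assms(1)] by blast
  have "F = 0" if "F = (\<Sum>i<D. fls_const (c i) * Psi ^ i)" for D
    using that
  proof (induction D)
    case (Suc D)
    have "(\<Sum>i<D. fls_const (c i) * Psi ^ i) $$ (- int D) = 0"
      unfolding fls_nth_sum by (intro sum.neutral ballI) (simp add: Psi_power_low)
    moreover have "F $$ (- int D) = 0" by (rule assms) simp
    ultimately have "c D = 0" using Suc.prems by (simp add: Psi_power_lead)
    with Suc show ?case by simp
  qed auto
  with F show ?thesis by (metis lessThan_Suc_atMost)
qed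

lemma R_eqI:
  assumes "F \<in> R" "G \<in> R" and "\<And>n. n \<le> 0 \<Longrightarrow> F $$ n = G $$ n"
  shows "F = G"
  using R_eq_0[of "F - G"] assms R_diff by simp

text \<open>Triangular elimination: earlier Faber polynomials have leading coefficient 1 and a
  single nonpositive exponent, so they clear the unwanted terms of \<open>Psi ^ m\<close> without
  denominators.\<close>

lemma faber_exists:
  "\<exists>F\<in>R. F $$ (- int m) = 1 \<and> (\<forall>n\<le>0. n \<noteq> - int m \<longrightarrow> F $$ n = 0)"
proof (induction m rule: less_induct)
  case (less m)
  then obtain F where F: "\<And>k. k < m \<Longrightarrow> F k \<in> R"
    "\<And>k. k < m \<Longrightarrow> F k $$ (- int k) = 1"
    "\<And>k n. k < m \<Longrightarrow> n \<le> 0 \<Longrightarrow> n \<noteq> - int k \<Longrightarrow> F k $$ n = 0"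
    by metis
  define G where "G = Psi ^ m - (\<Sum>k<m. fls_const ((Psi ^ m) $$ (- int k)) * F k)"
  have "G \<in> R"
    unfolding G_def by (intro R_diff R_power R_Psi R_sum R_const_mult F) auto
  moreover have "G $$ n = (if n = - int m then 1 else 0)" if "n \<le> 0" for n
  proof -
    define j where "j = nat (- n)"
    have n: "n = - int j" using that by (simp add: j_def)
    have "(\<Sum>k<m. (Psi ^ m) $$ (- int k) * F k $$ n) = (\<Sum>k<m. if k = j then (Psi ^ m) $$ n else 0)"
      using F n by (intro sum.cong) auto
    also have "\<dots> = (if j < m then (Psi ^ m) $$ n else 0)" by simp
    finally have "G $$ n = (Psi ^ m) $$ n - (if j < m then (Psi ^ m) $$ n else 0)"
      by (simp add: G_def fls_nth_sum)
    then show ?thesis using n by (auto simp: Psi_power_lead Psi_power_low)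
  qed
  ultimately show ?case by (intro bexI[of _ G]) auto
qed

definition faber :: "nat \<Rightarrow> int fls" where
  "faber m = (SOME F. F \<in> R \<and> F $$ (- int m) = 1 \<and> (\<forall>n\<le>0. n \<noteq> - int m \<longrightarrow> F $$ n = 0))"

lemma
  faber_in_R: "faber m \<in> R" and
  faber_nonpos: "n \<le> 0 \<Longrightarrow> faber m $$ n = (if n = - int m then 1 else 0)"
proof -
  have "faber m \<in> R \<and> faber m $$ (- int m) = 1 \<and> (\<forall>n\<le>0. n \<noteq> - int m \<longrightarrow> faber m $$ n = 0)"
    unfolding faber_def by (rule someI_ex) (use faber_exists[of m] in blast)
  then show "faber m \<in> R" "n \<le> 0 \<Longrightarrow> faber m $$ n = (if n = - int m then 1 else 0)" by auto
qed

lemma faber_0: "faber 0 = 1"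
  by (rule R_eqI) (auto simp: faber_in_R R_1 faber_nonpos)

lemma faber_expansion:
  assumes "F \<in> R" and "\<And>n. n < - int m \<Longrightarrow> F $$ n = 0"
  shows "F = (\<Sum>k\<le>m. fls_const (F $$ (- int k)) * faber k)"
proof (rule R_eqI)
  fix n :: int assume "n \<le> 0"
  define j where "j = nat (- n)"
  have n: "n = - int j" using \<open>n \<le> 0\<close> by (simp add: j_def)
  have "(\<Sum>k\<le>m. F $$ (- int k) * faber k $$ n) = (\<Sum>k\<le>m. if k = j then F $$ n else 0)"
    using n by (intro sum.cong) (auto simp: faber_nonpos)
  also have "\<dots> = F $$ n" using assms(2)[of n] n by auto
  finally show "F $$ n = (\<Sum>k\<le>m. fls_const (F $$ (- int k)) * faber k) $$ n"
    by (simp add: fls_nth_sum)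
qed (auto intro!: assms R_sum R_const_mult faber_in_R)

text \<open>All congruences use this form: a candidate \<open>F\<close> with the right leading term
  satisfies the congruence for structural reasons, and only the correction sum has to be controlled
  through its coefficients.\<close>

lemma faber_expansion_lead:
  assumes "F \<in> R" and "\<And>n. n < - int m \<Longrightarrow> F $$ n = 0" and "F $$ (- int m) = 1"
  shows "faber m = F - (\<Sum>k<m. fls_const (F $$ (- int k)) * faber k)"
proof -
  have "F = (\<Sum>k\<le>m. fls_const (F $$ (- int k)) * faber k)"
    by (rule faber_expansion[OF assms(1,2)])
  also have "\<dots> = (\<Sum>k<m. fls_const (F $$ (- int k)) * faber k) + faber m"
    using assms(3) by (simp flip: lessThan_Suc_atMost)
  finally have "(\<Sum>k<m. fls_const (F $$ (- int k)) * faber k) + faber m = F" by (rule sym)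
  then show ?thesis unfolding eq_diff_eq by (subst add.commute)
qed

text \<open>Multiplying the previous polynomial by \<open>Phi\<close> raises the pole order by
  \<open>d\<close> and preserves the support. It is used with \<open>d = 1\<close> for
  \<open>Psi\<close> up to a constant and with \<open>d = 2\<close> for its square.\<close>

lemma faber_supported_mod:
  assumes Phi: "Phi \<in> R" "Phi $$ (- int d) = 1" "\<And>n. n < - int d \<Longrightarrow> Phi $$ n = 0"
    and supp: "supported_mod M P (- int d) Phi" and d: "int d dvd P" "d > 0"
  shows "supported_mod M P (- int (d * m)) (faber (d * m))"
proof (induction m rule: less_induct)
  case (less m)
  show ?case
  proof (cases m)
    case 0
    then show ?thesis using supported_mod_const[of M P 1] by (simp add: faber_0)
  next
    case (Suc l)
    let ?G = "Phi * faber (d * l)"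
    have "faber (d * l) $$ n = 0" if "n < - int (d * l)" for n
      using that by (subst faber_nonpos) (simp_all del: of_nat_mult)
    then have nth: "?G $$ n = (\<Sum>i\<in>{- int d..n + int (d * l)}. Phi $$ i * faber (d * l) $$ (n - i))" for n
      by (subst fls_mult_nth_bounded[where N = "- int d" and N' = "- int (d * l)"])
         (auto simp: Phi simp del: of_nat_mult)
    have low: "?G $$ n = 0" if "n < - int (d * m)" for n
      unfolding nth using that Suc by (auto simp: algebra_simps)
    have lead: "?G $$ (- int (d * m)) = 1"
      unfolding nth using Suc Phi by (simp add: algebra_simps faber_nonpos)
    have "supported_mod M P (- int d + - int (d * l)) ?G"
      by (intro supported_mod_mult supp less) (use Suc in auto)
    also have "- int d + - int (d * l) = - int (d * m)" using Suc by (simp add: algebra_simps)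
    finally have G: "supported_mod M P (- int (d * m)) ?G" .
    have eq: "faber (d * m) = ?G - (\<Sum>k<d * m. fls_const (?G $$ (- int k)) * faber k)"
      by (intro faber_expansion_lead R_mult Phi faber_in_R low lead)
    have "supported_mod M P (- int (d * m)) (fls_const (?G $$ (- int k)) * faber k)" if k: "k < d * m" for k
    proof (cases "M dvd ?G $$ (- int k)")
      case True
      then show ?thesis by (auto simp: supported_mod_def)
    next
      case False
      \<comment> \<open>A coefficient that survives modulo \<open>M\<close> forces k into the class
        of d m modulo \<open>P\<close>. As d divides \<open>P\<close>, such a k is a multiple of d,
        so the induction hypothesis covers \<open>faber k\<close>.\<close>
      then have P: "P dvd - int k - - int (d * m)"
        using G unfolding supported_mod_def by blast
      with d have "int d dvd - int k - - int (d * m)" by (meson dvd_trans)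
      then have "int d dvd int k"
        by (metis (no_types) add_diff_cancel_right' diff_minus_eq_add dvd_add_left_iff dvd_minus_iff
            dvd_triv_left of_nat_mult add.commute)
      then obtain k' where k': "k = d * k'" by (auto elim: dvdE)
      with k d have "k' < m" by simp
      then have "supported_mod M P (- int k) (faber k)" using less k' by simp
      then have "supported_mod M P (- int (d * m)) (faber k)"
        by (rule supported_mod_cong) (use P in simp)
      from supported_mod_mult[OF supported_mod_const this] show ?thesis by simp
    qed
    then show ?thesis by (subst eq) (intro supported_mod_diff G supported_mod_sum, auto)
  qed
qed

lemma fls_const_dvd_nth: "fls_const M dvd F - G \<Longrightarrow> M dvd F $$ n - G $$ n" for F G :: "int fls"
  by (simp add: fls_const_dvd_iff)

text \<open>The candidate is \<open>faber m ^ p\<close>, congruent to F_m(q^p) by Frobenius. The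
  latter has the single nonpositive exponent -pm, so every correction coefficient is divisible by
  p.\<close>

lemma faber_prime_mult:
  assumes p: "prime p"
  shows "fls_const (int p) dvd faber (p * m) - fls_compose_power (faber m) p"
proof -
  let ?V = "fls_compose_power (faber m) p" and ?G = "faber m ^ p"
  have pos: "p > 0" using p by (rule prime_gt_0_nat)
  have frob: "fls_const (int p) dvd ?G - ?V" by (rule fls_frobenius[OF p])
  have sub: "fls_subdegree (faber m) = - int m"
    by (rule fls_subdegree_eqI) (auto simp: faber_nonpos)
  have low: "?G $$ n = 0" if "n < - int (p * m)" for n
    using that by (intro fls_pow_nth_below_subdegree) (simp add: sub)
  have lead: "?G $$ (- int (p * m)) = 1"
    using fls_pow_base[of "faber m" p] by (simp add: sub faber_nonpos)
  have eq: "faber (p * m) = ?G - (\<Sum>k<p * m. fls_const (?G $$ (- int k)) * faber k)"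
    by (intro faber_expansion_lead R_power faber_in_R low lead)
  have "int p dvd ?G $$ (- int k)" if "k < p * m" for k
  proof -
    have "?V $$ (- int k) = 0"
    proof (cases "p dvd k")
      case True
      then obtain j where j: "k = p * j" by (elim dvdE)
      then have "- int k = (- int j) * int p" by simp
      then have "- int k div int p = - int j" using pos by (simp only: nonzero_mult_div_cancel_right)
      then show ?thesis using that j pos
        by (simp add: fls_nth_compose_power faber_nonpos del: of_nat_mult)
    qed (simp add: fls_nth_compose_power pos)
    with fls_const_dvd_nth[OF frob, of "- int k"] show ?thesis by simp
  qed
  then have "fls_const (int p) dvd fls_const (?G $$ (- int k)) * faber k" if "k < p * m" for k
    using that by (auto simp: fls_const_dvd_iff)
  then have "fls_const (int p) dvd (\<Sum>k<p * m. fls_const (?G $$ (- int k)) * faber k)"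
    by (intro dvd_sum) auto
  from dvd_diff[OF frob this] show ?thesis unfolding eq by (simp add: algebra_simps)
qed

lemma sum_lessThan_double:
  fixes g :: "nat \<Rightarrow> 'a :: comm_monoid_add"
  shows "(\<Sum>k<2 * N. g k) = (\<Sum>j<N. g (2 * j) + g (2 * j + 1))"
  by (induction N) (simp_all add: add_ac)

text \<open>Let V replace q by q^2. The square of F_2m expands F_4m, the square of F_m expands F_2m,
  and V applied to the second expansion is compared with the first, correction term by correction
  term.\<close>

lemma faber_mult_4:
  assumes "m > 0"
  shows "fls_const 4 dvd faber (4 * m) - fls_compose_power (faber (2 * m)) 2"
proof -
  let ?V = "\<lambda>F. fls_compose_power F 2" and ?G = "faber (2 * m) ^ 2" and ?H = "faber m ^ 2"
  have two: "fls_const 2 dvd faber (2 * j) - ?V (faber j)" for j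
    using faber_prime_mult[of 2 j] by simp
  have sub: "fls_subdegree (faber k) = - int k" for k
    by (rule fls_subdegree_eqI) (auto simp: faber_nonpos)
  have low: "(faber k ^ 2) $$ n = 0" if "n < - int (2 * k)" for n k
    using that by (intro fls_pow_nth_below_subdegree) (simp add: sub)
  have lead: "(faber k ^ 2) $$ (- int (2 * k)) = 1" for k
    using fls_pow_base[of "faber k" 2] by (simp add: sub faber_nonpos)
  have G: "faber (2 * (2 * m)) = ?G - (\<Sum>k<2 * (2 * m). fls_const (?G $$ (- int k)) * faber k)"
    by (intro faber_expansion_lead R_power faber_in_R low lead)
  have H: "faber (2 * m) = ?H - (\<Sum>k<2 * m. fls_const (?H $$ (- int k)) * faber k)"
    by (intro faber_expansion_lead R_power faber_in_R low lead)
  have V_sum: "?V (\<Sum>k<n. f k) = (\<Sum>k<n. ?V (f k))" for f :: "nat \<Rightarrow> int fls" and n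
    by (induction n) simp_all
  have VH: "?V (faber (2 * m)) = ?V ?H - (\<Sum>k<2 * m. fls_const (?H $$ (- int k)) * ?V (faber k))"
    by (subst H) (simp add: V_sum)
  \<comment> \<open>From F_2m = V(F_m) + 2K the cross term and the last term of the square are both
    multiples of 4, and V is multiplicative.\<close>
  have GH: "fls_const 4 dvd ?G - ?V ?H"
  proof -
    obtain K where K: "faber (2 * m) = ?V (faber m) + fls_const 2 * K"
      using two[of m] by (metis dvdE diff_eq_eq add.commute)
    have "?G - ?V ?H = fls_const 4 * (?V (faber m) * K + K ^ 2)"
      unfolding K by (simp add: fls_const_numeral power2_eq_square algebra_simps)
    then show ?thesis by simp
  qed
  have c: "4 dvd ?G $$ (- int k) - ?V ?H $$ (- int k)" for k
    by (rule fls_const_dvd_nth[OF GH])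
  have c_odd: "4 dvd ?G $$ (- int (2 * j + 1))" for j
    using c[of "2 * j + 1"] by (simp add: fls_nth_compose_power del: fls_compose_power_power)
  have c_even: "4 dvd ?G $$ (- int (2 * j)) - ?H $$ (- int j)" for j
  proof -
    have "- int (2 * j) div 2 = - int j" by simp
    with c[of "2 * j"] show ?thesis
      by (simp add: fls_nth_compose_power del: fls_compose_power_power of_nat_mult)
  qed
  \<comment> \<open>Frobenius for the square of F_m: V(F_m) has no exponent between -2m + 1 and
    0.\<close>
  have d: "2 dvd ?H $$ (- int j)" if "j < 2 * m" for j
  proof -
    have "fls_const 2 dvd ?H - ?V (faber m)" using fls_frobenius[of 2 "faber m"] by simp
    then have "2 dvd ?H $$ (- int j) - ?V (faber m) $$ (- int j)" by (rule fls_const_dvd_nth)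
    moreover have "?V (faber m) $$ (- int j) = 0"
      using that by (auto simp: fls_nth_compose_power faber_nonpos elim!: dvdE)
    ultimately show ?thesis by simp
  qed
  \<comment> \<open>Odd indices have coefficients divisible by 4. At an even index 2j the two
    coefficients agree modulo 4 and are even, and F_2j - V(F_j) is even too, so two factors of 2
    combine.\<close>
  have "fls_const 4 dvd (\<Sum>k<2 * (2 * m). fls_const (?G $$ (- int k)) * faber k)
      - (\<Sum>k<2 * m. fls_const (?H $$ (- int k)) * ?V (faber k))"
    unfolding sum_lessThan_double[of _ "2 * m"] sum_subtractf[symmetric]
  proof (rule dvd_sum)
    fix j assume j: "j \<in> {..<2 * m}"
    obtain a where a: "?G $$ (- int (2 * j + 1)) = 4 * a" using c_odd[of j] by (elim dvdE)
    obtain b where b: "?G $$ (- int (2 * j)) = ?H $$ (- int j) + 4 * b"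
      using c_even by (metis dvdE diff_eq_eq add.commute)
    obtain e where e: "?H $$ (- int j) = 2 * e" using d j by (auto elim: dvdE)
    obtain K where K: "faber (2 * j) = ?V (faber j) + fls_const 2 * K"
      using two[of j] by (metis dvdE diff_eq_eq add.commute)
    have "fls_const (?G $$ (- int (2 * j))) * faber (2 * j) + fls_const (?G $$ (- int (2 * j + 1))) * faber (2 * j + 1)
      - fls_const (?H $$ (- int j)) * ?V (faber j)
      = fls_const 4 * (fls_const e * K + fls_const b * faber (2 * j) + fls_const a * faber (2 * j + 1))"
      unfolding a b e K
      by (simp add: fls_const_numeral algebra_simps flip: fls_plus_const fls_const_mult_const)
    then show "fls_const 4 dvd fls_const (?G $$ (- int (2 * j))) * faber (2 * j) + fls_const (?G $$ (- int (2 * j + 1))) * faber (2 * j + 1)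
      - fls_const (?H $$ (- int j)) * ?V (faber j)" by simp
  qed
  from dvd_diff[OF GH this] have *: "fls_const 4 dvd faber (2 * (2 * m)) - ?V (faber (2 * m))"
    unfolding G VH by (simp only: algebra_simps)
  have "4 * m = 2 * (2 * m)" by simp
  then show ?thesis using * by (simp only:)
qed

section \<open>Residues and the duality of Faber coefficients\<close>

lemma R_deriv: "F \<in> R \<Longrightarrow> \<exists>F'\<in>R. fls_deriv F = F' * fls_deriv Psi"
proof (induction rule: R.induct)
  case (R_const c)
  then show ?case by (intro bexI[of _ 0]) (auto simp: R_0)
next
  case (R_Psi_mult F)
  then obtain F' where F': "F' \<in> R" "fls_deriv F = F' * fls_deriv Psi" by blast
  moreover have "Psi * F' + F \<in> R" using R_Psi_mult F' by (intro R_add R.R_Psi_mult)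
  ultimately show ?case by (intro bexI[of _ "Psi * F' + F"]) (simp_all add: algebra_simps)
next
  case (R_add F G)
  then show ?case by (metis fls_deriv_add distrib_right R.R_add)
qed

text \<open>Psi^i Psi' times i + 1 is a derivative and has no residue; over the integers the nonzero
  factor i + 1 can be cancelled.\<close>

lemma R_residue_eq_0:
  assumes "F \<in> R"
  shows "(F * fls_deriv Psi) $$ (-1) = 0"
proof -
  obtain c D where F: "F = (\<Sum>i\<le>D. fls_const (c i) * Psi ^ i)"
    using R_representation[OF assms(1)] by blast
  have deriv: "fls_deriv (Psi ^ Suc i) = fls_const (int (Suc i)) * (Psi ^ i * fls_deriv Psi)" for i
    by (induction i) (simp_all add: algebra_simps flip: fls_plus_const)
  have "(Psi ^ i * fls_deriv Psi) $$ (-1) = 0" for i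
    using fls_deriv_residue[of "Psi ^ Suc i"] unfolding deriv by simp
  then have "(fls_const (c i) * Psi ^ i * fls_deriv Psi) $$ (-1) = 0" for i
    by (simp add: mult.assoc)
  then show ?thesis unfolding F by (simp add: sum_distrib_right fls_nth_sum)
qed

text \<open>The residue of F_m F_n' vanishes. Since both polynomials consist of one polar term and
  positive exponents, only the two products involving a polar term contribute to it.\<close>

lemma faber_duality:
  assumes "m > 0" "n > 0"
  shows "int n * faber m $$ (int n) = int m * faber n $$ (int m)"
proof -
  obtain F' where F': "F' \<in> R" "fls_deriv (faber n) = F' * fls_deriv Psi"
    using R_deriv[OF faber_in_R] by blast
  \<comment> \<open>The derivative contributes -i times the coefficient of F_n at -i; hence i = -m
    gives the positive and i = n the negative term.\<close>
  let ?t = "\<lambda>i. faber m $$ i * fls_deriv (faber n) $$ (- 1 - i)"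
  have "0 = (faber m * fls_deriv (faber n)) $$ (-1)"
    unfolding F'(2) mult.assoc[symmetric] by (intro R_residue_eq_0[symmetric] R_mult F' faber_in_R)
  also have "\<dots> = (\<Sum>i\<in>{- int m..- 1 - (- int n - 1)}. ?t i)"
    by (rule fls_mult_nth_bounded) (auto simp: faber_nonpos)
  also have "\<dots> = (\<Sum>i\<in>{- int m, int n}. ?t i)"
  proof (intro sum.mono_neutral_right ballI)
    fix i assume i: "i \<in> {- int m..- 1 - (- int n - 1)} - {- int m, int n}"
    show "?t i = 0"
    proof (cases "i \<le> 0")
      case True
      then show ?thesis using i by (simp add: faber_nonpos)
    next
      case False
      then show ?thesis using i by (simp add: faber_nonpos)
    qed
  qed auto
  also have "\<dots> = ?t (- int m) + ?t (int n)" using assms by (subst sum.insert) auto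
  also have "\<dots> = int m * faber n $$ (int m) - int n * faber m $$ (int n)"
    using assms by (simp add: faber_nonpos)
  finally show ?thesis by simp
qed

section \<open>Divisibility of the coefficients of the Faber polynomials\<close>

lemma faber_higher_mod:
  assumes p: "prime p" and supp: "supported_mod (int p) (int p) (- 1) (Psi - fls_const c)"
    and "\<not> p dvd r" "a < b"
  shows "int p dvd faber (p ^ a * r) $$ (int p ^ b * s)"
  using \<open>a < b\<close>
proof (induction a arbitrary: b)
  case 0
  \<comment> \<open>The support lies in the class -r modulo p, which contains no multiple of p.
    Subtracting \<open>c\<close> from \<open>Psi\<close> is harmless because the difference still
    lies in \<open>R\<close>.\<close>
  have "supported_mod (int p) (int p) (- int (1 * r)) (faber (1 * r))"
    by (rule faber_supported_mod[where Phi = "Psi - fls_const c"])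
       (use supp Psi_lead Psi_low in \<open>auto intro!: R_diff R_Psi R_const\<close>)
  moreover have "\<not> int p dvd int p ^ b * s + int r"
  proof
    assume "int p dvd int p ^ b * s + int r"
    moreover have "int p dvd int p ^ b * s" using 0 by (simp add: dvd_power dvd_mult2)
    ultimately show False using \<open>\<not> p dvd r\<close> by (simp add: dvd_add_right_iff)
  qed
  ultimately show ?case by (auto simp: supported_mod_def)
next
  case (Suc a)
  then obtain b' where b': "b = Suc b'" by (cases b) auto
  have pos: "p > 0" using p by (rule prime_gt_0_nat)
  \<comment> \<open>Substituting q^p lowers both exponents a and b by one, so a < b is
    preserved.\<close>
  from faber_prime_mult[OF p, of "p ^ a * r"]
  have "int p dvd faber (p * (p ^ a * r)) $$ (int p ^ b * s)
      - fls_compose_power (faber (p ^ a * r)) p $$ (int p ^ b * s)" by (rule fls_const_dvd_nth)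
  moreover have "fls_compose_power (faber (p ^ a * r)) p $$ (int p ^ b * s) = faber (p ^ a * r) $$ (int p ^ b' * s)"
    using pos b' by (simp add: fls_nth_compose_power mult.assoc)
  moreover have "int p dvd faber (p ^ a * r) $$ (int p ^ b' * s)" using Suc b' by simp
  ultimately show ?case by (metis diff_add_cancel dvd_add mult.assoc power_Suc)
qed

lemma faber_higher_mod_4:
  assumes supp4: "supported_mod 4 2 (- 1) (Psi - fls_const c)"
    and supp2: "supported_mod 2 4 (- 1) (Psi - fls_const c)"
    and "odd r" "a < b"
  shows "4 dvd faber (2 ^ a * r) $$ (2 ^ b * s)"
  using \<open>a < b\<close>
proof (induction a arbitrary: b rule: less_induct)
  case (less a)
  have r: "r > 0" using \<open>odd r\<close> by (auto intro: Nat.gr0I)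
  consider "a = 0" | "a = 1" | a' where "a = Suc (Suc a')" by (metis One_nat_def not0_implies_Suc)
  then show ?case
  proof cases
    case 1
    have "supported_mod 4 2 (- int (1 * r)) (faber (1 * r))"
      by (rule faber_supported_mod[where Phi = "Psi - fls_const c"])
         (use supp4 Psi_lead Psi_low in \<open>auto intro!: R_diff R_Psi R_const\<close>)
    moreover have "\<not> 2 dvd 2 ^ b * s + int r"
      using less 1 \<open>odd r\<close> by simp
    ultimately show ?thesis using 1 by (auto simp: supported_mod_def)
  next
    case 2
    let ?P = "Psi - fls_const c"
    have sub: "fls_subdegree ?P = -1"
      by (rule fls_subdegree_eqI) (use Psi_lead Psi_low in auto)
    have lead: "(?P ^ 2) $$ (- int 2) = 1"
      using fls_pow_base[of ?P 2] Psi_lead by (simp add: sub)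
    have low: "(?P ^ 2) $$ n = 0" if "n < - int 2" for n
      using that by (intro fls_pow_nth_below_subdegree) (simp add: sub)
    \<comment> \<open>Let A consist of the terms of ?P with exponent -1 mod 4. Then ?P = A + 2B, so
      its square agrees with the square of A modulo 4, and A * A has exponents -2 mod 4
      only.\<close>
    have "supported_mod 4 4 (- int 2) (?P ^ 2)"
    proof -
      define A where "A = Abs_fls (\<lambda>n. if 4 dvd n + 1 then ?P $$ n else 0)"
      have A: "A $$ n = (if 4 dvd n + 1 then ?P $$ n else 0)" for n
        unfolding A_def by (rule nth_Abs_fls_lower_bound[of "-1"]) (use Psi_low in auto)
      have "fls_const 2 dvd ?P - A"
        unfolding fls_const_dvd_iff
      proof
        fix n
        have "2 dvd ?P $$ n \<or> 4 dvd n - - 1" using supp2 unfolding supported_mod_def by blast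
        moreover have "(?P - A) $$ n = ?P $$ n - A $$ n" by (rule fls_minus_nth)
        ultimately show "2 dvd (?P - A) $$ n" unfolding A by (cases "4 dvd n + 1") auto
      qed
      then obtain B where B: "?P = A + fls_const 2 * B" by (metis dvdE diff_eq_eq add.commute)
      have "supported_mod 4 4 (- 1 + - 1) (A * A)"
        by (rule supported_mod_mult) (auto simp: supported_mod_def A)
      moreover have "fls_const 4 dvd ?P ^ 2 - A * A"
      proof -
        have "?P ^ 2 - A * A = fls_const 4 * (A * B + B * B)"
          unfolding B by (simp add: power2_eq_square algebra_simps)
        then show ?thesis by simp
      qed
      then have "4 dvd (?P ^ 2) $$ n - (A * A) $$ n" for n by (rule fls_const_dvd_nth)
      ultimately have "supported_mod 4 4 (- 1 + - 1) (?P ^ 2)"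
        unfolding supported_mod_def by (metis diff_add_cancel dvd_add)
      then show ?thesis by simp
    qed
    then have "supported_mod 4 4 (- int (2 * r)) (faber (2 * r))"
      using lead low by (intro faber_supported_mod[where Phi = "?P ^ 2"])
        (auto intro!: R_power R_diff R_Psi R_const)
    \<comment> \<open>Here b is at least 2, whereas 2r is 2 mod 4.\<close>
    moreover have "\<not> 4 dvd 2 ^ b * s + int (2 * r)"
    proof
      assume *: "4 dvd 2 ^ b * s + int (2 * r)"
      obtain b' where "b = Suc (Suc b')" using less 2 by (metis One_nat_def less_natE add_Suc)
      then have "4 dvd 2 ^ b * s" by simp
      with * have "4 dvd int (2 * r)" by (simp add: dvd_add_right_iff)
      then have "4 dvd 2 * r" by presburger
      with \<open>odd r\<close> show False by presburger
    qed
    ultimately show ?thesis using 2 by (auto simp: supported_mod_def)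
  next
    case 3
    then obtain b' where b': "b = Suc b'" using less by (cases b) auto
    have "fls_const 4 dvd faber (4 * (2 ^ a' * r)) - fls_compose_power (faber (2 * (2 ^ a' * r))) 2"
      using r by (intro faber_mult_4) simp
    then have "4 dvd faber (4 * (2 ^ a' * r)) $$ (2 ^ b * s)
       - fls_compose_power (faber (2 * (2 ^ a' * r))) 2 $$ (2 ^ b * s)" by (rule fls_const_dvd_nth)
    moreover have "fls_compose_power (faber (2 * (2 ^ a' * r))) 2 $$ (2 ^ b * s)
      = faber (2 ^ Suc a' * r) $$ (2 ^ b' * s)"
      using b' by (simp add: fls_nth_compose_power mult.assoc)
    moreover have "4 dvd faber (2 ^ Suc a' * r) $$ (2 ^ b' * s)"
      by (rule less) (use 3 b' less.prems in auto)
    ultimately have "4 dvd faber (4 * (2 ^ a' * r)) $$ (2 ^ b * s)"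
      by (metis diff_add_cancel dvd_add)
    then show ?thesis using 3 by (simp add: mult.assoc)
  qed
qed

text \<open>Duality reads p^b s A = p^a r B with B covered by \<open>dual\<close>; cancelling p^b
  and the factor s, coprime to p, leaves the surplus p^(a-b). For s that is not positive the
  coefficient is zero.\<close>

lemma faber_lower_mod:
  assumes p: "prime p" and b: "b < a" and r: "r > 0" and s: "coprime s (int p)"
    and dual: "\<And>s'. \<not> p dvd s' \<Longrightarrow> int p ^ e dvd faber (p ^ b * s') $$ (int p ^ a * int r)"
  shows "int p ^ (a - b + e) dvd faber (p ^ a * r) $$ (int p ^ b * s)"
proof -
  have pos: "p > 0" using p by (rule prime_gt_0_nat)
  have s0: "\<not> int p dvd s"
    using s p by (metis coprime_commute coprime_absorb_left not_prime_unit prime_nat_int_transfer)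
  show ?thesis
  proof (cases "s > 0")
    case True
    define n where "n = nat s"
    have n: "s = int n" "n > 0" using True by (simp_all add: n_def)
    let ?A = "faber (p ^ a * r) $$ (int p ^ b * s)" and ?B = "faber (p ^ b * n) $$ (int p ^ a * int r)"
    have "int (p ^ b * n) * faber (p ^ a * r) $$ (int (p ^ b * n)) =
        int (p ^ a * r) * faber (p ^ b * n) $$ (int (p ^ a * r))"
      using pos n r by (intro faber_duality) auto
    then have "int p ^ b * (s * ?A) = int p ^ a * (int r * ?B)" using n by (simp add: mult_ac)
    moreover have "int p ^ a = int p ^ b * int p ^ (a - b)" using b by (simp flip: power_add)
    ultimately have "int p ^ b * (s * ?A) = int p ^ b * (int p ^ (a - b) * (int r * ?B))"
      by (metis mult.assoc)
    then have "s * ?A = int p ^ (a - b) * (int r * ?B)" using pos by simp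
    moreover have "int p ^ e dvd ?B" using s0 n by (intro dual) auto
    ultimately have "int p ^ (a - b + e) dvd s * ?A" by (simp add: power_add mult_dvd_mono)
    moreover have "coprime (int p ^ (a - b + e)) s" using s by (simp add: coprime_commute)
    ultimately show ?thesis by (simp add: coprime_dvd_mult_right_iff)
  next
    case False
    \<comment> \<open>This excludes the one nonpositive exponent with coefficient 1: equality would
      make s divisible by p.\<close>
    have "int p ^ b * s \<noteq> - (int p ^ a * int r)"
    proof
      assume "int p ^ b * s = - (int p ^ a * int r)"
      also have "int p ^ a = int p ^ b * int p ^ (a - b)" using b by (simp flip: power_add)
      finally have "int p ^ b * s = int p ^ b * (int p ^ (a - b) * (- int r))" by simp
      then have "s = int p ^ (a - b) * (- int r)" using pos by (subst (asm) mult_cancel_left) auto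
      then show False using s0 b by (simp add: dvd_power dvd_mult2)
    qed
    then have "faber (p ^ a * r) $$ (int p ^ b * s) = 0"
      using False pos by (subst faber_nonpos) (auto simp: mult_le_0_iff)
    then show ?thesis by simp
  qed
qed

end

section \<open>Sums of divisors of odd numbers\<close>

definition sigma :: "nat \<Rightarrow> int" where
  "sigma N = (\<Sum>d | d dvd N. int d)"

lemma sigma_1: "sigma 1 = 1"
  by (simp add: sigma_def)

text \<open>Divisors are grouped with their cofactors, and \<open>P\<close> selects one divisor of
  each pair; in particular N is not a square. The divisor sum becomes a sum of terms d + e.\<close>

lemma dvd_sigma_by_pairing:
  assumes N: "N > 0"
    and pair: "\<And>d e. N = d * e \<Longrightarrow> P d \<longleftrightarrow> \<not> P e"
    and dvd: "\<And>d e. N = d * e \<Longrightarrow> m dvd d + e"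
  shows "int m dvd sigma N"
proof -
  define D where "D = {d. d dvd N \<and> P d}"
  have fin: "finite {d. d dvd N}" using N by simp
  have div: "N = d * (N div d)" if "d dvd N" for d using that by simp
  have "{d. d dvd N} - D = (\<lambda>d. N div d) ` D"
  proof (intro equalityI subsetI)
    fix e assume e: "e \<in> {d. d dvd N} - D"
    then obtain d where d: "N = e * d" by (auto elim: dvdE)
    with e pair[OF d] N have "d \<in> D" "e = N div d" by (auto simp: D_def)
    then show "e \<in> (\<lambda>d. N div d) ` D" by blast
  next
    fix e assume "e \<in> (\<lambda>d. N div d) ` D"
    then obtain d where "d dvd N" "P d" "e = N div d" by (auto simp: D_def)
    with pair[OF div[of d]] show "e \<in> {d. d dvd N} - D"
      by (auto simp: D_def div_dvd_iff_mult)
  qed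
  moreover have "inj_on (\<lambda>d. N div d) D"
  proof (rule inj_onI)
    fix x y assume "x \<in> D" "y \<in> D" "N div x = N div y"
    then have "x * (N div x) = y * (N div x)" using div[of x] div[of y] by (simp add: D_def)
    moreover have "N div x \<noteq> 0" using div[of x] \<open>x \<in> D\<close> N by (auto simp: D_def)
    ultimately show "x = y" by simp
  qed
  moreover have "D \<subseteq> {d. d dvd N}" by (auto simp: D_def)
  ultimately have "sigma N = (\<Sum>d\<in>D. int d) + (\<Sum>d\<in>D. int (N div d))"
    unfolding sigma_def using sum.subset_diff[of D "{d. d dvd N}" int] fin
    by (simp add: sum.reindex add.commute)
  also have "\<dots> = (\<Sum>d\<in>D. int (d + N div d))" by (simp add: sum.distrib)
  also have "int m dvd \<dots>"
    using dvd[OF div] by (intro dvd_sum) (simp only: D_def of_nat_dvd_iff mem_Collect_eq)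
  finally show ?thesis .
qed

text \<open>Reduces the pairing to a finite check on residues. The modulus \<open>M\<close> that
  tells a divisor from its cofactor may have to be larger than the modulus \<open>m\<close> of the
  claim.\<close>

lemma dvd_sigma_by_residues:
  assumes N: "N > 0" and M: "m dvd M" "M > 0"
    and S: "\<forall>x\<in>{..<M}. \<forall>y\<in>{..<M}. x * y mod M = N mod M \<longrightarrow> (x \<in> S \<longleftrightarrow> y \<notin> S) \<and> m dvd x + y"
  shows "int m dvd sigma N"
proof (rule dvd_sigma_by_pairing[where P = "\<lambda>d. d mod M \<in> S", OF N])
  fix d e assume "N = d * e"
  then have "(d mod M) * (e mod M) mod M = N mod M" by (simp add: mod_mult_eq)
  with S M(2) have de: "d mod M \<in> S \<longleftrightarrow> e mod M \<notin> S" "m dvd d mod M + e mod M" by auto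
  from de(1) show "d mod M \<in> S \<longleftrightarrow> \<not> e mod M \<in> S" .
  have "(d + e) mod m = (d mod M + e mod M) mod m"
    using M(1) by (metis mod_add_eq mod_mod_cancel)
  with de(2) show "m dvd d + e" by (simp add: dvd_eq_mod_eq_0)
qed

lemma sigma_mod_4: "N mod 4 = 3 \<Longrightarrow> 4 dvd sigma N"
  using dvd_sigma_by_residues[of N 4 4 "{1}"]
  by (cases "N = 0") (simp_all add: lessThan_nat_numeral)

lemma sigma_mod_3: "N mod 3 = 2 \<Longrightarrow> 3 dvd sigma N"
  using dvd_sigma_by_residues[of N 3 3 "{1}"]
  by (cases "N = 0") (simp_all add: lessThan_nat_numeral numeral_3_eq_3[symmetric])

text \<open>A divisor and its cofactor have residues 1 and 5, or 3 and 7, modulo 8. Modulo 4 they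
  would coincide, hence the larger modulus.\<close>

lemma sigma_mod_2: "N mod 8 = 5 \<Longrightarrow> 2 dvd sigma N"
  using dvd_sigma_by_residues[of N 2 8 "{1, 3}"]
  by (cases "N = 0") (simp_all add: lessThan_nat_numeral)

text \<open>The divisors of 3K that do not divide K are all multiples of 3.\<close>

lemma sigma_mult_3:
  assumes "K > 0"
  shows "3 dvd sigma (3 * K) - sigma K"
proof -
  have "{d. d dvd K} \<subseteq> {d. d dvd 3 * K}" "finite {d. d dvd 3 * K}" using assms by auto
  then have "sigma (3 * K) - sigma K = (\<Sum>d\<in>{d. d dvd 3 * K} - {d. d dvd K}. int d)"
    unfolding sigma_def by (simp add: sum_diff)
  also have "3 dvd \<dots>"
  proof (rule dvd_sum)
    fix d assume d: "d \<in> {d. d dvd 3 * K} - {d. d dvd K}"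
    have "3 dvd d"
    proof (rule ccontr)
      assume "\<not> 3 dvd d"
      then have "coprime 3 d" by (intro prime_imp_coprime) auto
      then show False using d by (auto simp: coprime_dvd_mult_right_iff coprime_commute)
    qed
    then show "3 dvd int d" by presburger
  qed
  finally show ?thesis .
qed

section \<open>The Hauptmodul of level six as a Laurent series\<close>

text \<open>Classically this is the fourth power of the generating series of the triangular
  numbers.\<close>

definition Y :: "int fps" where
  "Y = Abs_fps (\<lambda>n. sigma (2 * n + 1))"

definition Y3 :: "int fps" where
  "Y3 = Y oo fps_X ^ 3"

text \<open>The quotient Y(q) / Y(q^3), formed over the integers: the argument 1 is the inverse of
  the constant term of \<open>Y3\<close>.\<close>

definition T :: "int fps" where
  "T = fps_right_inverse Y3 1 * Y"

definition Psi :: "int fls" where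
  "Psi = fls_X_inv * fps_to_fls T"

lemma Y_nth: "Y $ n = sigma (2 * n + 1)"
  by (simp add: Y_def)

lemma Y3_nth: "Y3 $ n = (if 3 dvd n then Y $ (n div 3) else 0)"
  by (simp add: Y3_def fps_nth_compose_X_power)

lemma Y_0: "Y $ 0 = 1" using sigma_1 by (simp add: Y_nth)

lemma Y3_0: "Y3 $ 0 = 1" by (simp add: Y3_nth Y_0)

lemma Y3_mult_T: "Y3 * T = Y"
  using fps_right_inverse[of Y3 1] by (simp add: T_def Y3_0 mult.assoc[symmetric])

lemma T_0: "T $ 0 = 1"
proof -
  have "(Y3 * T) $ 0 = Y $ 0" by (simp only: Y3_mult_T)
  then show ?thesis by (simp add: Y_0 Y3_0)
qed

lemma Psi_nth: "Psi $$ n = (if n < -1 then 0 else T $ nat (n + 1))"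
  by (simp add: Psi_def fls_X_inv_times_conv_shift)

interpretation simple_pole_fls Psi
  by unfold_locales (auto simp: Psi_nth T_0)

lemma supported_mod_fps_iff:
  "supported_mod M P r (fps_to_fls f) \<longleftrightarrow> (\<forall>n::nat. M dvd f $ n \<or> P dvd int n - r)"
proof
  assume "\<forall>n::nat. M dvd f $ n \<or> P dvd int n - r"
  then show "supported_mod M P r (fps_to_fls f)"
    by (auto simp: supported_mod_def not_less)
qed (auto simp: supported_mod_def dest: spec[of _ "int _"])

text \<open>The recurrence for the quotient involves g at n only through the coefficient 1 of f;
  every other product has a factor divisible by \<open>M\<close> by support or by induction.\<close>

lemma supported_mod_divide:
  assumes f0: "f $ 0 = 1" and f: "supported_mod M P 0 (fps_to_fls f)"
    and fg: "supported_mod M P r (fps_to_fls (f * g))"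
  shows "supported_mod M P r (fps_to_fls g)"
  unfolding supported_mod_fps_iff
proof
  fix n
  show "M dvd g $ n \<or> P dvd int n - r"
  proof (induction n rule: less_induct)
    case (less n)
    show ?case
    proof (cases "P dvd int n - r")
      case False
      have "(f * g) $ n = g $ n + (\<Sum>i\<in>{1..n}. f $ i * g $ (n - i))"
        using f0 by (simp add: fps_mult_nth sum.atLeast_Suc_atMost)
      moreover have "M dvd f $ i * g $ (n - i)" if i: "i \<in> {1..n}" for i
      proof (cases "P dvd int i")
        case True
        have "\<not> P dvd int (n - i) - r"
        proof
          assume "P dvd int (n - i) - r"
          with True have "P dvd int i + (int (n - i) - r)" by (rule dvd_add)
          then show False using False i by (simp add: of_nat_diff)
        qed
        then have "M dvd g $ (n - i)" using less[of "n - i"] i by auto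
        then show ?thesis by simp
      next
        case False
        then have "M dvd f $ i" using f by (auto simp: supported_mod_fps_iff)
        then show ?thesis by simp
      qed
      then have "M dvd (\<Sum>i\<in>{1..n}. f $ i * g $ (n - i))" by (rule dvd_sum)
      moreover have "M dvd (f * g) $ n" using fg False by (auto simp: supported_mod_fps_iff)
      ultimately have "M dvd g $ n" by (simp add: dvd_add_left_iff)
      then show ?thesis ..
    qed simp
  qed
qed

lemma supported_mod_shift:
  "supported_mod M P 0 (fps_to_fls f) \<Longrightarrow> supported_mod M P (- 1) (fls_X_inv * fps_to_fls f)"
  using supported_mod_mult[of M P "-1" fls_X_inv 0 "fps_to_fls f"] by (simp add: supported_mod_def)

text \<open>For odd n the number 2n + 1 is 3 mod 4. Dividing n by 3 keeps its parity, so Y(q^3) has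
  the same support as Y(q).\<close>

lemma Psi_supported_mod_4: "supported_mod 4 2 (- 1) Psi"
  unfolding Psi_def
proof (rule supported_mod_shift, rule supported_mod_divide[where f = Y3])
  have odd: "4 dvd Y $ n" if "odd n" for n
    unfolding Y_nth using that by (intro sigma_mod_4) presburger
  then show "supported_mod 4 2 0 (fps_to_fls (Y3 * T))"
    unfolding supported_mod_fps_iff Y3_mult_T by auto
  show "supported_mod 4 2 0 (fps_to_fls Y3)"
    unfolding supported_mod_fps_iff
  proof
    fix n
    have "3 dvd n \<Longrightarrow> odd n \<Longrightarrow> odd (n div 3)" for n :: nat by presburger
    then show "4 dvd Y3 $ n \<or> 2 dvd int n - 0" using odd by (auto simp: Y3_nth)
  qed
qed (rule Y3_0)

text \<open>Beyond odd n this needs n = 2 mod 4, where 2n + 1 is 5 mod 8.\<close>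

lemma Psi_supported_mod_2: "supported_mod 2 4 (- 1) Psi"
  unfolding Psi_def
proof (rule supported_mod_shift, rule supported_mod_divide[where f = Y3])
  have not4: "2 dvd Y $ n" if "\<not> 4 dvd n" for n
  proof (cases "odd n")
    case True
    then have "4 dvd sigma (2 * n + 1)" by (intro sigma_mod_4) presburger
    then show ?thesis unfolding Y_nth by presburger
  next
    case False
    with that have "(2 * n + 1) mod 8 = 5" by presburger
    then show ?thesis unfolding Y_nth by (rule sigma_mod_2)
  qed
  then show "supported_mod 2 4 0 (fps_to_fls (Y3 * T))"
    unfolding supported_mod_fps_iff Y3_mult_T by (metis diff_zero int_dvd_int_iff of_nat_numeral)
  show "supported_mod 2 4 0 (fps_to_fls Y3)"
    unfolding supported_mod_fps_iff
  proof
    fix n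
    show "2 dvd Y3 $ n \<or> 4 dvd int n - 0"
    proof (cases "4 dvd n")
      case True
      then show ?thesis by presburger
    next
      case False
      then have "3 dvd n \<Longrightarrow> \<not> 4 dvd n div 3" by presburger
      then show ?thesis using not4 by (simp add: Y3_nth)
    qed
  qed
qed (rule Y3_0)

text \<open>The constant term of \<open>Psi\<close> is sigma(3) = 4, that is 1 mod 3. After
  multiplication by Y(q^3) the subtraction turns the coefficient at 3k + 1 into sigma(3(2k + 1)) -
  sigma(2k + 1), a multiple of 3.\<close>

lemma Psi_supported_mod_3: "supported_mod 3 3 (- 1) (Psi - fls_const 1)"
proof -
  have eq: "Psi - fls_const 1 = fls_X_inv * fps_to_fls (T - fps_X)"
    by (rule fls_eqI) (simp add: Psi_def fls_X_inv_times_conv_shift fps_sub_nth)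
  show ?thesis unfolding eq
  proof (rule supported_mod_shift, rule supported_mod_divide[where f = Y3])
    show "supported_mod 3 3 0 (fps_to_fls Y3)"
      by (auto simp: supported_mod_fps_iff Y3_nth int_dvd_int_iff[of 3, simplified])
    have "3 dvd (Y - fps_X * Y3) $ n" if n: "\<not> 3 dvd n" for n
    proof (cases "n mod 3 = 1")
      case True
      define k where "k = n div 3"
      have k: "n = 3 * k + 1" using True unfolding k_def by presburger
      have "(Y - fps_X * Y3) $ n = sigma (3 * (2 * k + 1)) - sigma (2 * k + 1)"
      proof -
        have "(Y - fps_X * Y3) $ n = Y $ n - Y $ k" unfolding k by (simp add: Y3_nth fps_sub_nth)
        moreover have "2 * n + 1 = 3 * (2 * k + 1)" using k by simp
        ultimately show ?thesis by (simp only: Y_nth)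
      qed
      also have "3 dvd \<dots>" by (rule sigma_mult_3) simp
      finally show ?thesis .
    next
      case False
      with n have 2: "n mod 3 = 2" by presburger
      then have "(2 * n + 1) mod 3 = 2" by presburger
      then have "3 dvd Y $ n" unfolding Y_nth by (rule sigma_mod_3)
      moreover have "\<not> 3 dvd n - 1" using 2 by presburger
      ultimately show ?thesis by (simp add: Y3_nth fps_sub_nth)
    qed
    then show "supported_mod 3 3 0 (fps_to_fls (Y3 * (T - fps_X)))"
      unfolding supported_mod_fps_iff right_diff_distrib Y3_mult_T
      by (metis diff_zero int_dvd_int_iff of_nat_numeral mult.commute)
  qed (rule Y3_0)
qed

lemma faber_upper_mod_4:
  "odd r \<Longrightarrow> a < b \<Longrightarrow> 4 dvd faber (2 ^ a * r) $$ (2 ^ b * s)"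
  using Psi_supported_mod_4 Psi_supported_mod_2 by (intro faber_higher_mod_4[where c = 0]) auto

lemma faber_upper_mod_3:
  "\<not> 3 dvd r \<Longrightarrow> a < b \<Longrightarrow> 3 dvd faber (3 ^ a * r) $$ (3 ^ b * s)"
  using faber_higher_mod[of 3 1 r a b s] Psi_supported_mod_3 by simp

lemma faber_lower_mod_2:
  "b < a \<Longrightarrow> r > 0 \<Longrightarrow> coprime s 2 \<Longrightarrow> 2 ^ (a - b + 2) dvd faber (2 ^ a * r) $$ (2 ^ b * s)"
  using faber_lower_mod[of 2 b a r s 2] faber_upper_mod_4[of _ b a "int r"] by simp

lemma faber_lower_mod_3:
  "b < a \<Longrightarrow> r > 0 \<Longrightarrow> coprime s 3 \<Longrightarrow> 3 ^ (a - b + 1) dvd faber (3 ^ a * r) $$ (3 ^ b * s)"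
  using faber_lower_mod[of 3 b a r s 1] faber_upper_mod_3[of _ b a "int r"] by simp

section \<open>Elliptic functions\<close>

definition lattice :: "complex \<Rightarrow> complex set" where
  "lattice \<tau> = {of_int m + of_int n * \<tau> | m n. True}"

lemma latticeI: "z = of_int m + of_int n * \<tau> \<Longrightarrow> z \<in> lattice \<tau>"
  by (auto simp: lattice_def)

lemma latticeE:
  assumes "z \<in> lattice \<tau>" obtains m n where "z = of_int m + of_int n * \<tau>"
  using assms by (auto simp: lattice_def)

lemma lattice_0: "0 \<in> lattice \<tau>"
  by (rule latticeI[of _ 0 0]) simp

lemma lattice_add: "u \<in> lattice \<tau> \<Longrightarrow> v \<in> lattice \<tau> \<Longrightarrow> u + v \<in> lattice \<tau>"
proof (elim latticeE)
  fix m n m' n' assume "u = of_int m + of_int n * \<tau>" "v = of_int m' + of_int n' * \<tau>"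
  then show "u + v \<in> lattice \<tau>"
    by (intro latticeI[of _ "m + m'" "n + n'"]) (simp add: algebra_simps)
qed

lemma lattice_minus: "u \<in> lattice \<tau> \<Longrightarrow> - u \<in> lattice \<tau>"
proof (elim latticeE)
  fix m n assume "u = of_int m + of_int n * \<tau>"
  then show "- u \<in> lattice \<tau>"
    by (intro latticeI[of _ "- m" "- n"]) (simp add: algebra_simps)
qed

lemma lattice_diff: "u \<in> lattice \<tau> \<Longrightarrow> v \<in> lattice \<tau> \<Longrightarrow> u - v \<in> lattice \<tau>"
  using lattice_add[of u \<tau> "- v"] lattice_minus by simp

lemma lattice_add_iff: "v \<in> lattice \<tau> \<Longrightarrow> u + v \<in> lattice \<tau> \<longleftrightarrow> u \<in> lattice \<tau>"
  using lattice_add[of u \<tau> v] lattice_diff[of "u + v" \<tau> v] by auto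

lemma lattice_norm_ge:
  assumes "Im \<tau> > 0" "z \<in> lattice \<tau>" "z \<noteq> 0"
  shows "norm z \<ge> min 1 (Im \<tau>)"
proof -
  obtain m n where z: "z = of_int m + of_int n * \<tau>" using assms by (elim latticeE)
  show ?thesis
  proof (cases "n = 0")
    case True
    then have "m \<noteq> 0" using z assms by auto
    then have "norm z \<ge> 1" using z True by simp
    then show ?thesis by simp
  next
    case False
    then have "\<bar>real_of_int n\<bar> \<ge> 1" by linarith
    then have "Im \<tau> \<le> \<bar>Im z\<bar>" using z assms by (simp add: abs_mult)
    then show ?thesis using abs_Im_le_cmod[of z] by linarith
  qed
qed

lemma closed_lattice:
  assumes "Im \<tau> > 0" shows "closed (lattice \<tau>)"
proof (rule discrete_imp_closed[of "min 1 (Im \<tau>)"])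
  show "\<forall>x\<in>lattice \<tau>. \<forall>y\<in>lattice \<tau>. dist y x < min 1 (Im \<tau>) \<longrightarrow> y = x"
    using lattice_norm_ge[OF assms lattice_diff] unfolding dist_norm by force
qed (use assms in simp)

lemma countable_lattice: "countable (lattice \<tau>)"
proof -
  have "lattice \<tau> = (\<lambda>(m, n). of_int m + of_int n * \<tau>) ` (UNIV :: (int \<times> int) set)"
    by (auto simp: lattice_def)
  then show ?thesis by simp
qed

lemma lattice_reduce:
  assumes "Im \<tau> > 0"
  obtains v s t where "v \<in> lattice \<tau>" "z = v + (of_real s + of_real t * \<tau>)" "s \<in> {0..1}" "t \<in> {0..1}"
proof -
  define t where "t = Im z / Im \<tau>"
  define s where "s = Re z - t * Re \<tau>"
  have "z = of_real s + of_real t * \<tau>"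
    using assms by (auto simp: complex_eq_iff s_def t_def)
  then have "z = (of_int \<lfloor>s\<rfloor> + of_int \<lfloor>t\<rfloor> * \<tau>) + (of_real (frac s) + of_real (frac t) * \<tau>)"
    by (simp add: frac_def algebra_simps)
  moreover have "frac s \<in> {0..1}" "frac t \<in> {0..1}" by (auto simp: frac_lt_1 less_imp_le)
  ultimately show thesis using that latticeI by blast
qed

text \<open>The limit hypothesis leaves at most a simple pole, and an even function has no residue
  at 0, so the singularity is removable.\<close>

lemma even_double_pole_cancel:
  fixes G :: "complex \<Rightarrow> complex"
  assumes r: "r > 0" and hol: "G holomorphic_on ball 0 r - {0}"
    and even: "\<And>z. z \<in> ball 0 r - {0} \<Longrightarrow> G (- z) = G z"
    and lim: "((\<lambda>z. z ^ 2 * G z) \<longlongrightarrow> 0) (at 0)"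
  obtains g where "g holomorphic_on ball 0 r" "\<And>z. z \<in> ball 0 r - {0} \<Longrightarrow> g z = G z"
proof -
  define h where "h = (\<lambda>z. if z = 0 then 0 else z ^ 2 * G z)"
  have "h 0 = 0" by (simp add: h_def)
  have "h holomorphic_on ball 0 r"
  proof (rule no_isolated_singularity'[where K = "{0}"])
    have "(\<lambda>z. z ^ 2 * G z) holomorphic_on ball 0 r - {0}" by (intro holomorphic_intros hol)
    then show "h holomorphic_on ball 0 r - {0}" by (rule holomorphic_transform) (auto simp: h_def)
    have "(h \<longlongrightarrow> 0) (at 0)"
      using lim by (rule Lim_transform_eventually) (auto simp: h_def eventually_at_filter)
    moreover have "at 0 within ball 0 r = at (0 :: complex)" using r by (intro at_within_open) auto
    ultimately show "(h \<longlongrightarrow> h z) (at z within ball 0 r)" if "z \<in> {0}" for z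
      using that \<open>h 0 = 0\<close> by simp
  qed auto
  then have "h field_differentiable at 0"
    by (rule holomorphic_on_imp_differentiable_at) (use r in auto)
  then obtain d where "(h has_field_derivative d) (at 0)" by (auto simp: field_differentiable_def)
  then have "((\<lambda>z. h z / z) \<longlongrightarrow> d) (at 0)" 
    by (simp only: DERIV_def \<open>h 0 = 0\<close> add_0_left diff_zero)
  then have 1: "((\<lambda>z. z * G z) \<longlongrightarrow> d) (at 0)"
    by (rule Lim_transform_eventually) (auto simp: h_def eventually_at_filter power2_eq_square)
  \<comment> \<open>Substituting -z shows that the limit d of z G(z) equals -d.\<close>
  have "filterlim (\<lambda>z::complex. - z) (at 0) (at 0)"
    by (rule filterlim_atI) (auto intro!: tendsto_eq_intros simp: eventually_at_filter)
  from filterlim_compose[OF 1 this] have "((\<lambda>z. - z * G (- z)) \<longlongrightarrow> d) (at 0)" .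
  moreover have "eventually (\<lambda>z. - z * G (- z) = - (z * G z)) (at 0)"
    using eventually_at_in_open[of "ball 0 r" 0] r by (auto elim!: eventually_mono simp: even)
  ultimately have "((\<lambda>z. - (z * G z)) \<longlongrightarrow> d) (at 0)"
    by (rule Lim_transform_eventually)
  from tendsto_minus[OF this] have "((\<lambda>z. z * G z) \<longlongrightarrow> - d) (at 0)" by simp
  from tendsto_unique[OF _ 1 this] have "d = 0" by simp
  with 1 have "((\<lambda>z. (z - 0) * G z) \<longlongrightarrow> 0) (at 0)" by simp
  moreover have "0 \<in> interior (ball 0 r :: complex set)" using r by (simp add: interior_open)
  ultimately have "\<exists>g. g holomorphic_on ball 0 r \<and> (\<forall>z\<in>ball 0 r - {0}. g z = G z)"
    using holomorphic_on_extend_lim[OF hol] by blast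
  then show thesis using that by blast
qed

text \<open>Evenness stands in for the residue theorem. The extension across 0 is carried to the
  other lattice points by periodicity; the resulting entire function is bounded by its values on a
  compact period parallelogram.\<close>

lemma elliptic_liouville:
  fixes G :: "complex \<Rightarrow> complex"
  assumes \<tau>: "Im \<tau> > 0" and hol: "G holomorphic_on - lattice \<tau>"
    and per: "\<And>z v. v \<in> lattice \<tau> \<Longrightarrow> G (z + v) = G z"
    and even: "\<And>z. G (- z) = G z"
    and lim: "((\<lambda>z. z ^ 2 * G z) \<longlongrightarrow> 0) (at 0)"
  shows "\<exists>c. \<forall>z. z \<notin> lattice \<tau> \<longrightarrow> G z = c"
proof -
  define \<delta> where "\<delta> = min 1 (Im \<tau>)"
  have \<delta>: "\<delta> > 0" using \<tau> by (simp add: \<delta>_def)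
  have ball: "z \<notin> lattice \<tau>" if "z \<in> ball 0 \<delta> - {0}" for z
    using that lattice_norm_ge[OF \<tau>, of z] by (auto simp: \<delta>_def)
  have "G holomorphic_on ball 0 \<delta> - {0}" by (rule holomorphic_on_subset[OF hol]) (use ball in auto)
  then obtain g where g: "g holomorphic_on ball 0 \<delta>" "\<And>z. z \<in> ball 0 \<delta> - {0} \<Longrightarrow> g z = G z"
    using even_double_pole_cancel[OF \<delta>, of G] even lim by blast
  define F where "F = (\<lambda>z. if z \<in> lattice \<tau> then g 0 else G z)"
  have per_F: "F (z + v) = F z" if "v \<in> lattice \<tau>" for z v
    using that per by (simp add: F_def lattice_add_iff)
  have F_near: "F z = g z" if "z \<in> ball 0 \<delta>" for z
    using that ball g by (cases "z = 0") (auto simp: F_def lattice_0)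
  have "F holomorphic_on UNIV"
  proof -
    have "F holomorphic_on - lattice \<tau>"
      using hol by (rule holomorphic_transform) (auto simp: F_def)
    moreover have "F holomorphic_on ball v \<delta>" if "v \<in> lattice \<tau>" for v
    proof (rule holomorphic_transform)
      show "(\<lambda>z. g (z - v)) holomorphic_on ball v \<delta>"
      proof -
        have "(\<lambda>z. z - v) ` ball v \<delta> \<subseteq> ball 0 \<delta>" by (auto simp: dist_norm norm_minus_commute)
        moreover have "(\<lambda>z. z - v) holomorphic_on ball v \<delta>" by (intro holomorphic_intros)
        ultimately have "g \<circ> (\<lambda>z. z - v) holomorphic_on ball v \<delta>"
          using g(1) holomorphic_on_compose_gen by blast
        then show ?thesis by (simp add: o_def)
      qed
      show "g (z - v) = F z" if "z \<in> ball v \<delta>" for z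
        using that F_near[of "z - v"] per_F[of v "z - v"] \<open>v \<in> lattice \<tau>\<close>
        by (simp add: dist_norm norm_minus_commute)
    qed
    ultimately have "F holomorphic_on (- lattice \<tau> \<union> (\<Union>v\<in>lattice \<tau>. ball v \<delta>))"
      using closed_lattice[OF \<tau>] by (intro holomorphic_on_Un holomorphic_on_UN_open) auto
    moreover have "- lattice \<tau> \<union> (\<Union>v\<in>lattice \<tau>. ball v \<delta>) = UNIV" using \<delta> by auto
    ultimately show ?thesis by simp
  qed
  moreover have "bounded (range F)"
  proof -
    define K where "K = (\<lambda>(s, t). complex_of_real s + of_real t * \<tau>) ` ({0..1} \<times> {0..1})"
    have "compact K" unfolding K_def
      by (intro compact_continuous_image compact_Times) (auto intro!: continuous_intros simp: case_prod_unfold)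
    moreover have "continuous_on K F"
      using \<open>F holomorphic_on UNIV\<close> continuous_on_subset holomorphic_on_imp_continuous_on by blast
    ultimately have "bounded (F ` K)" by (intro compact_imp_bounded compact_continuous_image)
    moreover have "range F \<subseteq> F ` K"
    proof
      fix y assume "y \<in> range F"
      then obtain z where z: "y = F z" by auto
      obtain v s t where v: "v \<in> lattice \<tau>" "z = v + (of_real s + of_real t * \<tau>)" "s \<in> {0..1}" "t \<in> {0..1}"
        by (rule lattice_reduce[OF \<tau>])
      then have "y = F (of_real s + of_real t * \<tau>)" using z per_F[OF v(1)] by (metis add.commute)
      then show "y \<in> F ` K" using v unfolding K_def by force
    qed
    ultimately show ?thesis by (rule bounded_subset)
  qed
  ultimately obtain c where "\<And>z. F z = c"
    using Liouville_theorem[of F] by (auto simp: constant_on_def)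
  then have "G z = c" if "z \<notin> lattice \<tau>" for z using that by (metis F_def)
  then show ?thesis by blast
qed

section \<open>The Weierstrass function as a sum over the rows of the lattice\<close>

definition nome :: "complex \<Rightarrow> complex" where
  "nome z = exp (2 * of_real pi * \<i> * z)"

lemma nome_add: "nome (x + y) = nome x * nome y"
  by (simp add: nome_def distrib_left exp_add)

lemma nome_minus: "nome (- x) = inverse (nome x)"
  by (simp add: nome_def exp_minus)

lemma nome_nonzero [simp]: "nome x \<noteq> 0"
  by (simp add: nome_def)

lemma nome_0 [simp]: "nome 0 = 1"
  by (simp add: nome_def)

lemma nome_eq_1_iff: "nome z = 1 \<longleftrightarrow> z \<in> \<int>"
proof -
  have "nome z = 1 \<longleftrightarrow> Im z = 0 \<and> (\<exists>n::int. Re z = of_int n)"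
    unfolding nome_def exp_eq_1 by auto
  then show ?thesis by (simp add: complex_is_Int_iff)
qed

lemma nome_of_int [simp]: "nome (of_int n) = 1"
  by (simp add: nome_eq_1_iff)

lemma nome_of_nat_mult: "nome (of_nat n * z) = nome z ^ n"
  by (simp add: nome_def exp_of_nat_mult[symmetric] mult_ac)

lemma norm_nome: "norm (nome z) = exp (- (2 * pi * Im z))"
  by (simp add: nome_def)

lemma holomorphic_on_nome [holomorphic_intros]:
  "f holomorphic_on A \<Longrightarrow> (\<lambda>z. nome (f z)) holomorphic_on A"
  unfolding nome_def by (intro holomorphic_intros)

text \<open>At \<open>nome z\<close> this is -1 / (4 sin^2(pi z)), with double poles at the
  integers; its Taylor series is the sum of n w^n. At w = 1 division by zero gives the value
  0.\<close>

definition koebe :: "complex \<Rightarrow> complex" where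
  "koebe w = w / (1 - w) ^ 2"

lemma koebe_inverse: "w \<noteq> 0 \<Longrightarrow> koebe (inverse w) = koebe w"
  by (cases "w = 1") (auto simp: koebe_def field_simps power2_eq_square)

lemma norm_koebe_le:
  assumes "norm w \<le> 1 / 2" shows "norm (koebe w) \<le> 4 * norm w"
proof -
  have "norm (1 - w) \<ge> 1 / 2" using norm_triangle_ineq2[of 1 w] assms by simp
  then have "norm (1 - w) ^ 2 \<ge> (1 / 2) ^ 2" by (intro power_mono) auto
  then have "norm w * (1 / 4) \<le> norm w * norm (1 - w) ^ 2"
    by (intro mult_left_mono) (auto simp: power2_eq_square)
  moreover have "norm (1 - w) ^ 2 > 0" using \<open>norm (1 - w) \<ge> 1 / 2\<close> by (intro zero_less_power) linarith
  ultimately show ?thesis by (simp add: koebe_def norm_divide norm_power field_simps)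
qed

lemma summable_on_powr_abs_int:
  assumes "0 \<le> q" "q < (1 :: real)"
  shows "(\<lambda>n::int. q ^ nat \<bar>n\<bar>) summable_on A"
proof -
  have nat: "(\<lambda>n::nat. q ^ n) summable_on UNIV"
    by (rule norm_summable_imp_summable_on) (use assms in \<open>simp add: summable_geometric\<close>)
  have 1: "(\<lambda>n::int. q ^ nat \<bar>n\<bar>) summable_on range int"
    by (subst summable_on_reindex) (use nat in \<open>auto simp: o_def inj_on_def\<close>)
  have "(\<lambda>n::int. q ^ nat \<bar>n\<bar>) summable_on range (\<lambda>n. - int n)"
    by (subst summable_on_reindex) (use nat in \<open>auto simp: o_def inj_on_def\<close>)
  then have 2: "(\<lambda>n::int. q ^ nat \<bar>n\<bar>) summable_on (range (\<lambda>n. - int n) - range int)"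
    by (rule summable_on_subset_banach) auto
  have "range int \<union> (range (\<lambda>n. - int n) - range int) = UNIV"
  proof (intro equalityI subsetI UNIV_I)
    fix n :: int
    have "n = int (nat n) \<or> n = - int (nat (- n))" by linarith
    then show "n \<in> range int \<union> (range (\<lambda>n. - int n) - range int)" by (metis Diff_iff UnCI rangeI)
  qed
  with summable_on_Un_disjoint[OF 1 2] have "(\<lambda>n::int. q ^ nat \<bar>n\<bar>) summable_on UNIV" by auto
  then show ?thesis by (rule summable_on_subset_banach) auto
qed

text \<open>The contribution of a whole row of lattice points in closed form, so that a single
  absolutely convergent sum remains.\<close>

definition wp_term :: "complex \<Rightarrow> complex \<Rightarrow> int \<Rightarrow> complex" where
  "wp_term \<tau> z n = koebe (nome (z + of_int n * \<tau>))"

text \<open>Up to the factor \<open>(2 \<pi> \<i>)\<^sup>2\<close> and an additive constant depending on \<open>\<tau>\<close>, this is the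
  Weierstrass function of the lattice spanned by \<open>1\<close> and \<open>\<tau>\<close>; at lattice points the
  singular summand has the junk value \<open>0\<close>, which keeps all symmetries valid everywhere.\<close>

definition wp :: "complex \<Rightarrow> complex \<Rightarrow> complex" where
  "wp \<tau> z = (\<Sum>\<^sub>\<infinity>n\<in>UNIV. wp_term \<tau> z n)"

lemma wp_term_minus: "wp_term \<tau> (- z) (- n) = wp_term \<tau> z n"
proof -
  have "- z + of_int (- n) * \<tau> = - (z + of_int n * \<tau>)" by simp
  then show ?thesis unfolding wp_term_def by (simp only: nome_minus koebe_inverse[OF nome_nonzero])
qed

text \<open>The hypothesis \<open>small\<close> keeps the argument of \<open>koebe\<close> in the
  disc of radius 1/2, away from its pole; negative n reduce to positive n by the invariance of
  \<open>koebe\<close> under inversion.\<close>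

lemma norm_wp_term_le:
  assumes \<tau>: "Im \<tau> > 0" and B: "\<bar>Im z\<bar> \<le> B"
    and small: "exp (2 * pi * B) * exp (- (2 * pi * Im \<tau>)) ^ nat \<bar>n\<bar> \<le> 1 / 2"
  shows "norm (wp_term \<tau> z n) \<le> 4 * exp (2 * pi * B) * exp (- (2 * pi * Im \<tau>)) ^ nat \<bar>n\<bar>"
proof -
  have nonneg: "norm (wp_term \<tau> z n) \<le> 4 * exp (2 * pi * B) * exp (- (2 * pi * Im \<tau>)) ^ nat \<bar>n\<bar>"
    if "n \<ge> 0" "\<bar>Im z\<bar> \<le> B" "exp (2 * pi * B) * exp (- (2 * pi * Im \<tau>)) ^ nat \<bar>n\<bar> \<le> 1 / 2" for z n
  proof -
    have "norm (nome (z + of_int n * \<tau>)) = exp (- (2 * pi * Im z)) * exp (- (2 * pi * Im \<tau>)) ^ nat \<bar>n\<bar>"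
      using that by (simp add: norm_nome exp_of_nat_mult[symmetric] algebra_simps flip: exp_add)
    also have "\<dots> \<le> exp (2 * pi * B) * exp (- (2 * pi * Im \<tau>)) ^ nat \<bar>n\<bar>"
    proof (intro mult_right_mono)
      have "- (2 * pi * Im z) = 2 * pi * (- Im z)" by simp
      also have "\<dots> \<le> 2 * pi * B" using that by (intro mult_left_mono) auto
      finally show "exp (- (2 * pi * Im z)) \<le> exp (2 * pi * B)" by simp
    qed simp
    finally have le: "norm (nome (z + of_int n * \<tau>)) \<le> exp (2 * pi * B) * exp (- (2 * pi * Im \<tau>)) ^ nat \<bar>n\<bar>" .
    then have "norm (nome (z + of_int n * \<tau>)) \<le> 1 / 2" using that by linarith
    from norm_koebe_le[OF this] le show ?thesis unfolding wp_term_def by linarith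
  qed
  show ?thesis
  proof (cases "n \<ge> 0")
    case True
    then show ?thesis using nonneg B small by blast
  next
    case False
    then show ?thesis using nonneg[of "- n" "- z"] B small by (simp add: wp_term_minus)
  qed
qed

lemma eventually_small_int:
  assumes "Im \<tau> > 0"
  shows "\<exists>N. \<forall>n::int. nat \<bar>n\<bar> \<ge> N \<longrightarrow> exp (2 * pi * B) * exp (- (2 * pi * Im \<tau>)) ^ nat \<bar>n\<bar> \<le> 1 / 2"
proof -
  have "(\<lambda>k. exp (2 * pi * B) * exp (- (2 * pi * Im \<tau>)) ^ k) \<longlonglongrightarrow> 0"
    using assms by (intro tendsto_mult_right_zero LIMSEQ_power_zero) simp
  then have "eventually (\<lambda>k. exp (2 * pi * B) * exp (- (2 * pi * Im \<tau>)) ^ k < 1 / 2) sequentially"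
    by (rule order_tendstoD(2)) simp
  then show ?thesis unfolding eventually_sequentially by (meson less_imp_le)
qed

lemma finite_abs_int_less: "finite {n::int. nat \<bar>n\<bar> < N}"
  by (rule finite_subset[of _ "{- int N..int N}"]) auto

text \<open>On a bounded set of z all but finitely many rows obey the geometric bound. The index set
  \<open>A\<close> is arbitrary so that the row containing the pole at 0 can later be left
  out.\<close>

lemma
  assumes \<tau>: "Im \<tau> > 0"
  shows wp_term_summable: "wp_term \<tau> z summable_on A"
    and wp_partial_holomorphic:
      "open U \<Longrightarrow> (\<And>z n. z \<in> U \<Longrightarrow> n \<in> A \<Longrightarrow> z + of_int n * \<tau> \<notin> \<int>) \<Longrightarrow>
         (\<lambda>z. \<Sum>\<^sub>\<infinity>n\<in>A. wp_term \<tau> z n) holomorphic_on U"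
proof -
  let ?q = "exp (- (2 * pi * Im \<tau>))"
  have q: "0 \<le> ?q" "?q < 1" using \<tau> by auto
  have summable_tail: "wp_term \<tau> z summable_on A'"
    if "\<And>n. n \<in> A' \<Longrightarrow> exp (2 * pi * \<bar>Im z\<bar>) * ?q ^ nat \<bar>n\<bar> \<le> 1 / 2" for z A'
  proof (rule abs_summable_summable, rule summable_on_comparison_test)
    show "(\<lambda>n. 4 * exp (2 * pi * \<bar>Im z\<bar>) * ?q ^ nat \<bar>n\<bar>) summable_on A'"
      by (intro summable_on_cmult_right summable_on_powr_abs_int q)
  qed (use norm_wp_term_le[OF \<tau> order_refl] that in auto)
  show summable: "wp_term \<tau> z summable_on A" for z A
  proof -
    obtain N where N: "\<And>n::int. nat \<bar>n\<bar> \<ge> N \<Longrightarrow> exp (2 * pi * \<bar>Im z\<bar>) * ?q ^ nat \<bar>n\<bar> \<le> 1 / 2"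
      using eventually_small_int[OF \<tau>, of "\<bar>Im z\<bar>"] by blast
    have "wp_term \<tau> z summable_on ((A \<inter> {n. nat \<bar>n\<bar> < N}) \<union> (A \<inter> {n. nat \<bar>n\<bar> \<ge> N}))"
      using N by (intro summable_on_Un_disjoint summable_tail summable_on_finite)
        (auto intro: finite_Int finite_abs_int_less)
    moreover have "(A \<inter> {n. nat \<bar>n\<bar> < N}) \<union> (A \<inter> {n. nat \<bar>n\<bar> \<ge> N}) = A" by auto
    ultimately show ?thesis by simp
  qed
  assume U: "open U" "\<And>z n. z \<in> U \<Longrightarrow> n \<in> A \<Longrightarrow> z + of_int n * \<tau> \<notin> \<int>"
  show "(\<lambda>z. \<Sum>\<^sub>\<infinity>n\<in>A. wp_term \<tau> z n) holomorphic_on U"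
  proof -
    have hol: "(\<lambda>z. wp_term \<tau> z n) holomorphic_on U" if "n \<in> A" for n
      unfolding wp_term_def koebe_def using U(2) that
      by (intro holomorphic_intros) (auto simp: nome_eq_1_iff eq_commute[of 1])
    have "\<exists>r>0. (\<lambda>z. \<Sum>\<^sub>\<infinity>n\<in>A. wp_term \<tau> z n) holomorphic_on ball z0 r" if z0: "z0 \<in> U" for z0
    proof -
      obtain r where r: "r > 0" "cball z0 r \<subseteq> U" using U(1) z0 open_contains_cball by blast
      define B where "B = \<bar>Im z0\<bar> + r"
      have B: "\<bar>Im z\<bar> \<le> B" if "z \<in> cball z0 r" for z
      proof -
        have "\<bar>Im z - Im z0\<bar> \<le> r" using that abs_Im_le_cmod[of "z - z0"] by (simp add: dist_norm norm_minus_commute)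
        then show ?thesis unfolding B_def by linarith
      qed
      obtain N where N: "\<And>n::int. nat \<bar>n\<bar> \<ge> N \<Longrightarrow> exp (2 * pi * B) * ?q ^ nat \<bar>n\<bar> \<le> 1 / 2"
        using eventually_small_int[OF \<tau>, of B] by blast
      \<comment> \<open>The finite part A1 may have large terms and is holomorphic term by term; the
        Weierstrass test is applied to A2.\<close>
      define A1 A2 where "A1 = A \<inter> {n. nat \<bar>n\<bar> < N}" and "A2 = A \<inter> {n. nat \<bar>n\<bar> \<ge> N}"
      have A1: "finite A1" unfolding A1_def by (intro finite_Int disjI2 finite_abs_int_less)
      have ulim: "uniform_limit (cball z0 r) (\<lambda>X z. \<Sum>n\<in>X. wp_term \<tau> z n) (\<lambda>z. \<Sum>\<^sub>\<infinity>n\<in>A2. wp_term \<tau> z n) (finite_subsets_at_top A2)"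
      proof (rule Weierstrass_m_test_general)
        show "norm (wp_term \<tau> z n) \<le> 4 * exp (2 * pi * B) * ?q ^ nat \<bar>n\<bar>" if "n \<in> A2" "z \<in> cball z0 r" for n z
          using norm_wp_term_le[OF \<tau> B[OF that(2)] N] that(1) by (simp add: A2_def)
        show "(\<lambda>n. 4 * exp (2 * pi * B) * ?q ^ nat \<bar>n\<bar>) summable_on A2"
          by (intro summable_on_cmult_right summable_on_powr_abs_int q)
      qed
      have ev: "\<forall>\<^sub>F X in finite_subsets_at_top A2. continuous_on (cball z0 r) (\<lambda>z. \<Sum>n\<in>X. wp_term \<tau> z n) \<and>
          (\<lambda>z. \<Sum>n\<in>X. wp_term \<tau> z n) holomorphic_on ball z0 r"
      proof (rule eventually_finite_subsets_at_top_weakI)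
        fix X assume "finite X" "X \<subseteq> A2"
        then have "(\<lambda>z. \<Sum>n\<in>X. wp_term \<tau> z n) holomorphic_on U"
          by (intro holomorphic_on_sum hol) (auto simp: A2_def)
        then show "continuous_on (cball z0 r) (\<lambda>z. \<Sum>n\<in>X. wp_term \<tau> z n) \<and>
          (\<lambda>z. \<Sum>n\<in>X. wp_term \<tau> z n) holomorphic_on ball z0 r"
          using r by (meson ball_subset_cball continuous_on_subset holomorphic_on_imp_continuous_on
              holomorphic_on_subset order_trans)
      qed
      have "(\<lambda>z. \<Sum>\<^sub>\<infinity>n\<in>A2. wp_term \<tau> z n) holomorphic_on ball z0 r"
        by (rule holomorphic_uniform_limit[OF ev ulim]) auto
      moreover have "(\<lambda>z. \<Sum>n\<in>A1. wp_term \<tau> z n) holomorphic_on ball z0 r"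
      proof -
        have "(\<lambda>z. \<Sum>n\<in>A1. wp_term \<tau> z n) holomorphic_on U"
          by (intro holomorphic_on_sum hol) (auto simp: A1_def)
        then show ?thesis using r by (meson ball_subset_cball holomorphic_on_subset order_trans)
      qed
      ultimately have "(\<lambda>z. (\<Sum>n\<in>A1. wp_term \<tau> z n) + (\<Sum>\<^sub>\<infinity>n\<in>A2. wp_term \<tau> z n)) holomorphic_on ball z0 r"
        by (intro holomorphic_on_add)
      moreover have "(\<Sum>n\<in>A1. wp_term \<tau> z n) + (\<Sum>\<^sub>\<infinity>n\<in>A2. wp_term \<tau> z n) = (\<Sum>\<^sub>\<infinity>n\<in>A. wp_term \<tau> z n)" for z
      proof -
        have "A = A1 \<union> A2" "A1 \<inter> A2 = {}" by (auto simp: A1_def A2_def)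
        then show ?thesis using A1 by (simp add: infsum_Un_disjoint summable)
      qed
      ultimately show ?thesis using r(1) by auto
    qed
    then show ?thesis
      by (metis U(1) centre_in_ball holomorphic_on_def holomorphic_on_imp_differentiable_at field_differentiable_at_within open_ball)
  qed
qed

lemma wp_periodic:
  assumes "v \<in> lattice \<tau>"
  shows "wp \<tau> (z + v) = wp \<tau> z"
proof -
  obtain m k where v: "v = of_int m + of_int k * \<tau>" using assms by (elim latticeE)
  have "z + v + of_int n * \<tau> = (z + of_int (n + k) * \<tau>) + of_int m" for n
    by (simp add: v algebra_simps)
  then have "wp_term \<tau> (z + v) n = wp_term \<tau> z (n + k)" for n
    unfolding wp_term_def by (simp only: nome_add nome_of_int mult_1_right)
  then show ?thesis unfolding wp_def
    by (intro infsum_reindex_bij_witness[of _ "\<lambda>n. n - k" "\<lambda>n. n + k"]) auto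
qed

lemma wp_minus: "wp \<tau> (- z) = wp \<tau> z"
  unfolding wp_def
  by (rule infsum_reindex_bij_witness[of _ uminus uminus]) (use wp_term_minus[of \<tau> "- z"] in auto)

lemma wp_holomorphic: "Im \<tau> > 0 \<Longrightarrow> wp \<tau> holomorphic_on - lattice \<tau>"
proof -
  assume \<tau>: "Im \<tau> > 0"
  have "(\<lambda>z. \<Sum>\<^sub>\<infinity>n\<in>UNIV. wp_term \<tau> z n) holomorphic_on - lattice \<tau>"
  proof (rule wp_partial_holomorphic[OF \<tau>])
    fix z n assume z: "z \<in> - lattice \<tau>"
    show "z + of_int n * \<tau> \<notin> \<int>"
    proof
      assume "z + of_int n * \<tau> \<in> \<int>"
      then obtain m where "z + of_int n * \<tau> = of_int m" by (elim Ints_cases)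
      then have "z = of_int m + of_int (- n) * \<tau>" by (simp add: algebra_simps)
      then show False using z latticeI by blast
    qed
  qed (use closed_lattice[OF \<tau>] in auto)
  then show ?thesis by (simp add: wp_def[abs_def])
qed

text \<open>The coefficient of z^(-2) at the origin, from \<open>nome z - 1\<close> being asymptotic
  to 2 pi i z.\<close>

definition wp_pole :: complex where
  "wp_pole = (1 / (2 * of_real pi * \<i>)) ^ 2"

lemma wp_pole_nonzero: "wp_pole \<noteq> 0"
  by (simp add: wp_pole_def)

lemma koebe_nome_tendsto: "((\<lambda>z. z ^ 2 * koebe (nome z)) \<longlongrightarrow> wp_pole) (at 0)"
proof -
  have "(nome has_field_derivative 2 * of_real pi * \<i>) (at 0)"
    unfolding nome_def by (auto intro!: derivative_eq_intros)
  then have "((\<lambda>z. (nome z - 1) / z) \<longlongrightarrow> 2 * of_real pi * \<i>) (at 0)"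
    by (simp add: DERIV_def)
  then have "((\<lambda>z. inverse ((nome z - 1) / z)) \<longlongrightarrow> inverse (2 * of_real pi * \<i>)) (at 0)"
    by (rule tendsto_inverse) simp
  moreover have "(nome \<longlongrightarrow> nome 0) (at 0)"
    unfolding nome_def by (intro tendsto_intros)
  ultimately have "((\<lambda>z. inverse ((nome z - 1) / z) ^ 2 * nome z) \<longlongrightarrow> inverse (2 * of_real pi * \<i>) ^ 2 * nome 0) (at 0)"
    by (intro tendsto_mult tendsto_power)
  moreover have "inverse ((nome z - 1) / z) ^ 2 * nome z = z ^ 2 * koebe (nome z)" for z
    by (simp add: koebe_def power_divide power2_commute[of 1])
  ultimately show ?thesis by (simp add: wp_pole_def inverse_eq_divide)
qed

lemma wp_tendsto:
  assumes \<tau>: "Im \<tau> > 0"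
  shows "((\<lambda>z. z ^ 2 * wp \<tau> z) \<longlongrightarrow> wp_pole) (at 0)"
proof -
  define \<delta> where "\<delta> = min 1 (Im \<tau>)"
  have \<delta>: "\<delta> > 0" using \<tau> by (simp add: \<delta>_def)
  define h where "h = (\<lambda>z. \<Sum>\<^sub>\<infinity>n\<in>-{0}. wp_term \<tau> z n)"
  have "h holomorphic_on ball 0 \<delta>"
    unfolding h_def
  proof (rule wp_partial_holomorphic[OF \<tau>])
    fix z :: complex and n :: int assume z: "z \<in> ball 0 \<delta>" and n: "n \<in> - {0}"
    show "z + of_int n * \<tau> \<notin> \<int>"
    proof
      assume "z + of_int n * \<tau> \<in> \<int>"
      then obtain m where "z + of_int n * \<tau> = of_int m" by (elim Ints_cases)
      then have zl: "z = of_int m + of_int (- n) * \<tau>" by (simp add: algebra_simps)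
      then have "z \<in> lattice \<tau>" by (rule latticeI)
      moreover have "z \<noteq> 0"
      proof
        assume "z = 0"
        then have "Im (of_int m + of_int (- n) * \<tau>) = 0" using zl by (metis zero_complex.sel(2))
        then show False using n \<tau> by simp
      qed
      ultimately show False using lattice_norm_ge[OF \<tau>, of z] z
        by (simp add: \<delta>_def min_def split: if_splits)
    qed
  qed simp
  then have "continuous_on (ball 0 \<delta>) h" by (rule holomorphic_on_imp_continuous_on)
  then have "(h \<longlongrightarrow> h 0) (at 0)"
    using \<delta> by (simp add: continuous_on_eq_continuous_at isCont_def)
  then have "((\<lambda>z. z ^ 2 * koebe (nome z) + z ^ 2 * h z) \<longlongrightarrow> wp_pole + 0 ^ 2 * h 0) (at 0)"
    by (intro tendsto_intros koebe_nome_tendsto)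
  moreover have "wp \<tau> z = koebe (nome z) + h z" for z
  proof -
    have "wp \<tau> z = (\<Sum>\<^sub>\<infinity>n\<in>{0} \<union> -{0}. wp_term \<tau> z n)" by (simp add: wp_def)
    also have "\<dots> = (\<Sum>\<^sub>\<infinity>n\<in>{0}. wp_term \<tau> z n) + h z"
      unfolding h_def by (rule infsum_Un_disjoint) (auto intro: wp_term_summable[OF \<tau>])
    finally show ?thesis by (simp add: wp_term_def)
  qed
  ultimately show ?thesis by (simp add: distrib_left)
qed

text \<open>Multiplication by j maps the lattice of \<tau>' onto that of \<tau>, so both functions
  of z are even with the same periods, and the double poles match after scaling by j^2. Liouville
  leaves a constant \<open>C\<close>, which drops out of differences of values.\<close>

lemma wp_transform:
  fixes a b c d :: int
  assumes \<tau>: "Im \<tau> > 0" and det: "a * d - b * c = 1"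
  defines "j \<equiv> of_int c * \<tau> + of_int d"
  defines "\<tau>' \<equiv> (of_int a * \<tau> + of_int b) / j"
  shows "j \<noteq> 0" "Im \<tau>' > 0" "\<exists>C. \<forall>z. z \<notin> lattice \<tau> \<longrightarrow> wp \<tau>' (z / j) = j ^ 2 * wp \<tau> z + C"
proof -
  show j: "j \<noteq> 0"
  proof
    assume j0: "j = 0"
    then have "Im j = 0" by simp
    then have "c = 0" using \<tau> by (simp add: j_def)
    with j0 have "d = 0" by (simp add: j_def)
    with \<open>c = 0\<close> det show False by simp
  qed
  have "Im \<tau>' = Im ((of_int a * \<tau> + of_int b) * cnj j) / (norm j) ^ 2"
    unfolding \<tau>'_def by (simp add: complex_div_cnj[of _ j])
  also have "Im ((of_int a * \<tau> + of_int b) * cnj j) = of_int (a * d - b * c) * Im \<tau>"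
    by (simp add: j_def algebra_simps)
  finally have "Im \<tau>' = Im \<tau> / (norm j) ^ 2" using det by simp
  then show \<tau>': "Im \<tau>' > 0" using \<tau> j by simp
  have det': "of_int a * of_int d - of_int b * of_int c = (1 :: complex)"
    using det by (metis of_int_1 of_int_diff of_int_mult)
  have one: "1 / j = of_int a + of_int (- c) * \<tau>'"
    using j det' by (simp add: \<tau>'_def field_simps j_def)
  have tau: "\<tau> / j = of_int (- b) + of_int d * \<tau>'"
  proof -
    have "\<tau> = of_int (- b) * j + of_int d * (of_int a * \<tau> + of_int b)"
      using det' unfolding j_def by (simp add: algebra_simps)
    then show ?thesis using j by (simp add: \<tau>'_def field_simps)
  qed
  have lat1: "v / j \<in> lattice \<tau>'" if "v \<in> lattice \<tau>" for v
  proof -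
    obtain m n where "v = of_int m + of_int n * \<tau>" using \<open>v \<in> lattice \<tau>\<close> by (elim latticeE)
    then have "v / j = of_int m * (1 / j) + of_int n * (\<tau> / j)" by (simp add: add_divide_distrib)
    also have "\<dots> = of_int (m * a - n * b) + of_int (n * d - m * c) * \<tau>'"
      unfolding one tau by (simp add: algebra_simps)
    finally show ?thesis by (rule latticeI)
  qed
  have lat2: "v \<in> lattice \<tau>" if "v / j \<in> lattice \<tau>'" for v
  proof -
    obtain m n where "v / j = of_int m + of_int n * \<tau>'" using \<open>v / j \<in> lattice \<tau>'\<close> by (elim latticeE)
    then have "v = of_int m * j + of_int n * (of_int a * \<tau> + of_int b)"
      using j by (simp add: \<tau>'_def field_simps)
    also have "\<dots> = of_int (m * d + n * b) + of_int (m * c + n * a) * \<tau>"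
      by (simp add: j_def algebra_simps)
    finally show ?thesis by (rule latticeI)
  qed
  define G where "G = (\<lambda>z. wp \<tau>' (z / j) - j ^ 2 * wp \<tau> z)"
  have "G holomorphic_on - lattice \<tau>"
  proof -
    have "wp \<tau>' \<circ> (\<lambda>z. z / j) holomorphic_on - lattice \<tau>"
      by (rule holomorphic_on_compose_gen[OF _ wp_holomorphic[OF \<tau>']])
        (use j lat2 in \<open>auto intro!: holomorphic_intros\<close>)
    then show ?thesis unfolding G_def o_def by (intro holomorphic_intros wp_holomorphic[OF \<tau>])
  qed
  moreover have "G (z + v) = G z" if "v \<in> lattice \<tau>" for z v
    using wp_periodic[OF that] wp_periodic[OF lat1[OF that]] by (simp add: G_def add_divide_distrib)
  moreover have "G (- z) = G z" for z by (simp add: G_def wp_minus)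
  moreover have "((\<lambda>z. z ^ 2 * G z) \<longlongrightarrow> 0) (at 0)"
  proof -
    have "filterlim (\<lambda>z. z / j) (at 0) (at 0)"
      using j by (intro filterlim_atI) (auto intro!: tendsto_eq_intros simp: eventually_at_filter)
    from filterlim_compose[OF wp_tendsto[OF \<tau>'] this]
    have "((\<lambda>z. j ^ 2 * ((z / j) ^ 2 * wp \<tau>' (z / j)) - j ^ 2 * (z ^ 2 * wp \<tau> z)) \<longlongrightarrow> j ^ 2 * wp_pole - j ^ 2 * wp_pole) (at 0)"
      by (intro tendsto_intros wp_tendsto[OF \<tau>])
    moreover have "j ^ 2 * ((z / j) ^ 2 * wp \<tau>' (z / j)) - j ^ 2 * (z ^ 2 * wp \<tau> z) = z ^ 2 * G z" for z
      using j by (simp add: G_def power_divide algebra_simps)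
    ultimately show ?thesis by simp
  qed
  ultimately have "\<exists>C. \<forall>z. z \<notin> lattice \<tau> \<longrightarrow> G z = C" by (rule elliptic_liouville[OF \<tau>])
  then obtain C where "\<And>z. z \<notin> lattice \<tau> \<Longrightarrow> G z = C" by blast
  then show "\<exists>C. \<forall>z. z \<notin> lattice \<tau> \<longrightarrow> wp \<tau>' (z / j) = j ^ 2 * wp \<tau> z + C"
    by (auto simp: G_def algebra_simps intro!: exI[of _ C])
qed

lemma half_lattice_iff:
  assumes "Im \<tau> > 0"
  shows "(of_int r * \<tau> + of_int s) / 2 \<in> lattice \<tau> \<longleftrightarrow> even r \<and> even s"
proof
  assume "(of_int r * \<tau> + of_int s) / 2 \<in> lattice \<tau>"
  then obtain m n where eq: "of_int r * \<tau> + of_int s = 2 * (of_int m + of_int n * \<tau>)"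
    by (elim latticeE) (simp add: field_simps)
  from arg_cong[OF eq, of Im] have "of_int r * Im \<tau> = of_int (2 * n) * Im \<tau>" by simp
  then have r: "r = 2 * n" using assms by (metis less_irrefl mult_right_cancel of_int_eq_iff)
  from eq have "(of_int s :: complex) = of_int (2 * m)" by (simp add: r algebra_simps)
  then have "s = 2 * m" by (simp only: of_int_eq_iff)
  with r show "even r \<and> even s" by simp
next
  assume "even r \<and> even s"
  then obtain m n where "r = 2 * n" "s = 2 * m" by (auto elim!: evenE)
  then show "(of_int r * \<tau> + of_int s) / 2 \<in> lattice \<tau>"
    by (intro latticeI[of _ m n]) (simp add: algebra_simps)
qed

text \<open>The product of two translates is constant by Liouville's theorem; if the two values agreed,
  the constant would be \<open>0\<close>.\<close>

lemma wp_half_periods_distinct: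
  assumes \<tau>: "Im \<tau> > 0"
  shows "wp \<tau> (\<tau> / 2) \<noteq> wp \<tau> ((\<tau> + 1) / 2)"
proof
  assume eq: "wp \<tau> (\<tau> / 2) = wp \<tau> ((\<tau> + 1) / 2)"
  define B where "B = (\<lambda>z. wp \<tau> z - wp \<tau> (\<tau> / 2))"
  have tau2: "\<tau> / 2 \<notin> lattice \<tau>" using half_lattice_iff[OF \<tau>, of 1 0] by simp
  have tau: "\<tau> \<in> lattice \<tau>" by (rule latticeI[of _ 0 1]) simp
  have \<tau>2: "Im (\<tau> / 2) > 0" using \<tau> by simp
  have B_hol: "B holomorphic_on - lattice \<tau>"
    unfolding B_def by (intro holomorphic_intros wp_holomorphic \<tau>)
  have B_per: "B (z + v) = B z" if "v \<in> lattice \<tau>" for z v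
    using wp_periodic[OF that] by (simp add: B_def)
  have B_minus: "B (- z) = B z" for z by (simp add: B_def wp_minus)
  have B_lim: "((\<lambda>z. z ^ 2 * B z) \<longlongrightarrow> wp_pole) (at 0)"
  proof -
    have "((\<lambda>z. z ^ 2 * wp \<tau> z - z ^ 2 * wp \<tau> (\<tau> / 2)) \<longlongrightarrow> wp_pole - 0 ^ 2 * wp \<tau> (\<tau> / 2)) (at 0)"
      by (intro tendsto_intros wp_tendsto \<tau>)
    then show ?thesis by (simp add: B_def right_diff_distrib)
  qed
  have sub: "lattice \<tau> \<subseteq> lattice (\<tau> / 2)"
  proof
    fix v assume "v \<in> lattice \<tau>"
    then obtain m n where "v = of_int m + of_int n * \<tau>" by (elim latticeE)
    then show "v \<in> lattice (\<tau> / 2)" by (intro latticeI[of _ m "2 * n"]) simp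
  qed
  have shift: "z + \<tau> / 2 \<notin> lattice \<tau>" if "z \<notin> lattice (\<tau> / 2)" for z
  proof
    assume "z + \<tau> / 2 \<in> lattice \<tau>"
    then have "z + \<tau> / 2 \<in> lattice (\<tau> / 2)" using sub by blast
    moreover have "\<tau> / 2 \<in> lattice (\<tau> / 2)" by (rule latticeI[of _ 0 1]) simp
    ultimately show False using that lattice_add_iff by blast
  qed
  \<comment> \<open>The shift by \<tau>/2 swaps the factors up to periods, so G has the finer
    lattice. The zero of B at \<tau>/2 lowers the double pole at 0, as Liouville requires.\<close>
  define G where "G = (\<lambda>z. B z * B (z + \<tau> / 2))"
  have B_shift_hol: "(\<lambda>z. B (z + \<tau> / 2)) holomorphic_on - lattice (\<tau> / 2)"
  proof -
    have "B \<circ> (\<lambda>z. z + \<tau> / 2) holomorphic_on - lattice (\<tau> / 2)"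
      by (rule holomorphic_on_compose_gen[OF _ B_hol]) (use shift in \<open>auto intro!: holomorphic_intros\<close>)
    then show ?thesis by (simp add: o_def)
  qed
  have "G holomorphic_on - lattice (\<tau> / 2)"
    unfolding G_def using sub
    by (intro holomorphic_intros holomorphic_on_subset[OF B_hol] B_shift_hol) auto
  moreover have "G (z + v) = G z" if "v \<in> lattice (\<tau> / 2)" for z v
  proof -
    obtain m n where v: "v = of_int m + of_int n * (\<tau> / 2)" using \<open>v \<in> lattice (\<tau> / 2)\<close> by (elim latticeE)
    show ?thesis
    proof (cases "even n")
      case True
      then obtain k where "n = 2 * k" by (elim evenE)
      then have vl: "v \<in> lattice \<tau>" using v by (intro latticeI[of _ m k]) simp
      have "B (z + v + \<tau> / 2) = B (z + \<tau> / 2)"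
        using B_per[OF vl, of "z + \<tau> / 2"] by (simp add: algebra_simps)
      then show ?thesis using B_per[OF vl] by (simp add: G_def)
    next
      case False
      then obtain k where "n = 2 * k + 1" by (elim oddE)
      then have v': "v = (of_int m + of_int k * \<tau>) + \<tau> / 2" using v by (simp add: algebra_simps)
      have vl: "of_int m + of_int k * \<tau> \<in> lattice \<tau>" by (rule latticeI) simp
      have "B (z + v) = B (z + \<tau> / 2)"
        using B_per[OF vl, of "z + \<tau> / 2"] by (simp add: v' algebra_simps)
      moreover have "B (z + v + \<tau> / 2) = B z"
        using B_per[OF lattice_add[OF vl tau], of z] by (simp add: v' algebra_simps)
      ultimately show ?thesis by (simp add: G_def)
    qed
  qed
  moreover have "G (- z) = G z" for z
  proof -
    have "B (- z + \<tau> / 2) = B (z - \<tau> / 2)" using B_minus[of "z - \<tau> / 2"] by simp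
    also have "\<dots> = B (z - \<tau> / 2 + \<tau>)" by (rule B_per[OF tau, symmetric])
    also have "z - \<tau> / 2 + \<tau> = z + \<tau> / 2" by (simp add: field_simps)
    finally show ?thesis by (simp add: G_def B_minus)
  qed
  moreover have "((\<lambda>z. z ^ 2 * G z) \<longlongrightarrow> 0) (at 0)"
  proof -
    have "isCont B (\<tau> / 2)"
      using holomorphic_on_imp_continuous_on[OF B_hol] tau2 closed_lattice[OF \<tau>]
      by (simp add: continuous_on_eq_continuous_at open_Compl)
    then have "((\<lambda>z. B (z + \<tau> / 2)) \<longlongrightarrow> B (\<tau> / 2)) (at 0)"
      by (rule isCont_tendsto_compose) (auto intro!: tendsto_eq_intros)
    moreover have "B (\<tau> / 2) = 0" by (simp add: B_def)
    ultimately have "((\<lambda>z. (z ^ 2 * B z) * B (z + \<tau> / 2)) \<longlongrightarrow> wp_pole * 0) (at 0)"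
      by (intro tendsto_mult B_lim) simp
    then show ?thesis by (simp add: G_def mult.assoc)
  qed
  ultimately have "\<exists>C. \<forall>z. z \<notin> lattice (\<tau> / 2) \<longrightarrow> G z = C" by (rule elliptic_liouville[OF \<tau>2])
  then obtain C where C: "\<And>z. z \<notin> lattice (\<tau> / 2) \<Longrightarrow> G z = C" by blast
  have "1 / 2 \<notin> lattice (\<tau> / 2)"
  proof
    assume "1 / 2 \<in> lattice (\<tau> / 2)"
    then obtain m n where mn: "1 / 2 = of_int m + of_int n * (\<tau> / 2)" by (elim latticeE)
    from arg_cong[OF mn, of Im] have "n = 0" using \<tau> by simp
    with mn have "(1 :: complex) = of_int (2 * m)" by (simp add: field_simps)
    then have "1 = 2 * m" by (metis of_int_1 of_int_eq_iff)
    then show False by presburger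
  qed
  then have "C = G (1 / 2)" using C by simp
  also have "\<dots> = 0" using eq by (simp add: G_def B_def add_divide_distrib add.commute)
  finally have G0: "G z = 0" if "z \<notin> lattice (\<tau> / 2)" for z using C that by simp
  \<comment> \<open>Near its pole B is nonzero, so the other factor of G vanishes around \<tau>/2.
    The identity theorem then makes B zero off the lattice, against its pole.\<close>
  have "eventually (\<lambda>z. z ^ 2 * B z \<noteq> 0) (at 0)"
    using tendsto_imp_eventually_ne[OF B_lim wp_pole_nonzero] .
  moreover have "eventually (\<lambda>z. z \<notin> lattice (\<tau> / 2)) (at 0)"
    unfolding eventually_at using lattice_norm_ge[OF \<tau>2] \<tau>2
    by (intro exI[of _ "min 1 (Im (\<tau> / 2))"]) force
  ultimately have "eventually (\<lambda>z. B (z + \<tau> / 2) = 0) (at 0)"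
    by eventually_elim (use G0 in \<open>auto simp: G_def\<close>)
  then obtain \<epsilon> where \<epsilon>: "\<epsilon> > 0" "\<And>z. z \<noteq> 0 \<Longrightarrow> norm z < \<epsilon> \<Longrightarrow> B (z + \<tau> / 2) = 0"
    unfolding eventually_at by (auto simp: dist_norm)
  obtain \<epsilon>' where \<epsilon>': "\<epsilon>' > 0" "ball (\<tau> / 2) \<epsilon>' \<subseteq> - lattice \<tau>"
    using closed_lattice[OF \<tau>] tau2 by (metis ComplI open_Compl open_contains_ball)
  have B0: "B z = 0" if "z \<in> - lattice \<tau>" for z
  proof (rule analytic_continuation_open[of "ball (\<tau> / 2) (min \<epsilon> \<epsilon>')" "- lattice \<tau>" B "\<lambda>_. 0"])
    show "connected (- lattice \<tau>)"
      using connected_open_diff_countable[of UNIV "lattice \<tau>"] countable_lattice convex_connected[OF convex_UNIV]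
      by (simp add: Compl_eq_Diff_UNIV)
    fix w assume "w \<in> ball (\<tau> / 2) (min \<epsilon> \<epsilon>')"
    then show "B w = 0"
      using \<epsilon>(2)[of "w - \<tau> / 2"] by (cases "w = \<tau> / 2") (auto simp: dist_norm norm_minus_commute B_def)
  qed (use \<epsilon> \<epsilon>' that B_hol closed_lattice[OF \<tau>] in auto)
  have "((\<lambda>z::complex. 0::complex) \<longlongrightarrow> wp_pole) (at 0)"
  proof (rule Lim_transform_eventually[OF B_lim])
    show "\<forall>\<^sub>F z in at 0. z ^ 2 * B z = 0"
      unfolding eventually_at using lattice_norm_ge[OF \<tau>] \<tau> B0
      by (intro exI[of _ "min 1 (Im \<tau>)"]) force
  qed
  then show False using wp_pole_nonzero by (simp add: tendsto_const_iff)
qed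

section \<open>The difference of two half-period values as a power series\<close>

definition half_diff :: "complex \<Rightarrow> complex" where
  "half_diff \<tau> = wp \<tau> (\<tau> / 2) - wp \<tau> ((\<tau> + 1) / 2)"

text \<open>Adding the half period 1/2 negates the nome, so this is the difference of corresponding
  rows of the two half-period values; only odd powers survive.\<close>

definition koebe_odd :: "complex \<Rightarrow> complex" where
  "koebe_odd y = koebe y - koebe (- y)"

lemma koebe_odd_inverse: "y \<noteq> 0 \<Longrightarrow> koebe_odd (inverse y) = koebe_odd y"
  unfolding koebe_odd_def using koebe_inverse[of y] koebe_inverse[of "- y"] by simp

lemma koebe_has_sum:
  assumes "norm w < 1"
  shows "((\<lambda>n. of_nat n * w ^ n) has_sum koebe w) UNIV"
proof (rule norm_summable_imp_has_sum)
  have "(\<lambda>n. of_nat (Suc n) * norm w ^ n * norm w) sums (1 / (1 - norm w) ^ 2 * norm w)"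
    by (intro sums_mult2 geometric_deriv_sums) (use assms in simp)
  then have "summable (\<lambda>n. norm (of_nat (Suc n) * w ^ Suc n))"
    by (simp add: sums_iff norm_mult norm_power mult_ac del: of_nat_Suc)
  then show "summable (\<lambda>n. norm (of_nat n * w ^ n))" by (subst (asm) summable_Suc_iff)
  have "(\<lambda>n. of_nat (Suc n) * w ^ n * w) sums (1 / (1 - w) ^ 2 * w)"
    by (intro sums_mult2 geometric_deriv_sums assms)
  then have "(\<lambda>n. of_nat (Suc n) * w ^ Suc n) sums koebe w"
    by (simp add: koebe_def mult_ac del: of_nat_Suc)
  then show "(\<lambda>n. of_nat n * w ^ n) sums koebe w" by (subst (asm) sums_Suc_iff) simp
qed

lemma koebe_odd_has_sum:
  assumes "norm y < 1"
  shows "((\<lambda>k. 2 * of_nat (2 * k + 1) * y ^ (2 * k + 1)) has_sum koebe_odd y) UNIV"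
proof -
  have "((\<lambda>n. of_nat n * y ^ n + (- 1) * (of_nat n * (- y) ^ n)) has_sum (koebe y + (- 1) * koebe (- y))) UNIV"
    by (intro has_sum_add has_sum_cmult_right koebe_has_sum) (use assms in auto)
  then have "((\<lambda>n. of_nat n * y ^ n - of_nat n * (- y) ^ n) has_sum koebe_odd y) UNIV"
    by (simp add: koebe_odd_def)
  then have "((\<lambda>n. of_nat n * y ^ n - of_nat n * (- y) ^ n) has_sum koebe_odd y) (range (\<lambda>k. 2 * k + 1))"
  proof (subst (asm) has_sum_cong_neutral[where T = "range (\<lambda>k. 2 * k + 1)"])
    fix n :: nat assume "n \<in> UNIV - range (\<lambda>k. 2 * k + 1)"
    then have "even n" by (metis DiffD2 oddE rangeI)
    then show "of_nat n * y ^ n - of_nat n * (- y) ^ n = 0" by simp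
  qed auto
  then have "((\<lambda>n. of_nat n * y ^ n - of_nat n * (- y) ^ n) \<circ> (\<lambda>k. 2 * k + 1) has_sum koebe_odd y) UNIV"
    by (subst (asm) has_sum_reindex) (auto simp: inj_on_def)
  then show ?thesis by (simp add: o_def algebra_simps)
qed

text \<open>The rows n and -1 - n lie at opposite odd multiples of \<tau>/2 and contribute equally,
  whence the factor 2.\<close>

lemma half_diff_eq_infsum:
  assumes \<tau>: "Im \<tau> > 0"
  shows "((\<lambda>n. 2 * koebe_odd (nome (\<tau> / 2) ^ (2 * n + 1))) has_sum half_diff \<tau>) (UNIV :: nat set)"
proof -
  let ?x = "nome (\<tau> / 2)"
  let ?f = "\<lambda>n::int. wp_term \<tau> (\<tau> / 2) n - wp_term \<tau> ((\<tau> + 1) / 2) n"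
  have f: "?f n = koebe_odd (nome (of_int (2 * n + 1) * (\<tau> / 2)))" for n
  proof -
    have 1: "\<tau> / 2 + of_int n * \<tau> = of_int (2 * n + 1) * (\<tau> / 2)" by (simp add: field_simps)
    have 2: "(\<tau> + 1) / 2 + of_int n * \<tau> = 1 / 2 + of_int (2 * n + 1) * (\<tau> / 2)" by (simp add: field_simps)
    have "nome (1 / 2) = - 1" by (simp add: nome_def mult.commute)
    then show ?thesis unfolding wp_term_def koebe_odd_def 1 2 nome_add by simp
  qed
  have "(?f has_sum half_diff \<tau>) UNIV"
  proof -
    have "((\<lambda>n. wp_term \<tau> (\<tau> / 2) n + (- 1) * wp_term \<tau> ((\<tau> + 1) / 2) n) has_sum (wp \<tau> (\<tau> / 2) + (- 1) * wp \<tau> ((\<tau> + 1) / 2))) UNIV"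
      unfolding wp_def by (intro has_sum_add has_sum_cmult_right has_sum_infsum wp_term_summable \<tau>)
    then show ?thesis by (simp add: half_diff_def)
  qed
  then have f_summable: "?f summable_on A" for A
    by (meson has_sum_imp_summable subset_UNIV summable_on_subset_banach)
  have x: "?f (int n) = koebe_odd (?x ^ (2 * n + 1))" for n
  proof -
    have "nome (of_int (2 * int n + 1) * (\<tau> / 2)) = ?x ^ (2 * n + 1)"
      using nome_of_nat_mult[of "2 * n + 1" "\<tau> / 2"] by (simp add: algebra_simps)
    then show ?thesis unfolding f by simp
  qed
  have x': "?f (- 1 - int n) = koebe_odd (?x ^ (2 * n + 1))" for n
  proof -
    have "of_int (2 * (- 1 - int n) + 1) * (\<tau> / 2) = - (of_int (2 * int n + 1) * (\<tau> / 2))"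
      by (simp add: field_simps)
    then have "?f (- 1 - int n) = koebe_odd (inverse (nome (of_int (2 * int n + 1) * (\<tau> / 2))))"
      unfolding f by (simp only: nome_minus)
    also have "\<dots> = ?f (int n)" unfolding f by (simp add: koebe_odd_inverse)
    finally show ?thesis using x by simp
  qed
  have 1: "(\<lambda>n. koebe_odd (?x ^ (2 * n + 1))) summable_on UNIV"
  proof -
    have "(?f \<circ> int) summable_on UNIV"
      using summable_on_reindex[of int UNIV ?f] f_summable[of "range int"] by (simp add: inj_on_def)
    then show ?thesis unfolding o_def x .
  qed
  then obtain S where S: "((\<lambda>n. koebe_odd (?x ^ (2 * n + 1))) has_sum S) UNIV"
    by (auto simp: summable_on_def)
  have "(?f has_sum S) (range int)"
    using S has_sum_reindex[of int UNIV ?f S] by (simp add: o_def x inj_on_def)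
  moreover have "(?f has_sum S) (range (\<lambda>n. - 1 - int n))"
    using S has_sum_reindex[of "\<lambda>n. - 1 - int n" UNIV ?f S] by (simp add: o_def x' inj_on_def)
  moreover have "range int \<inter> range (\<lambda>n. - 1 - int n) = {}" by auto
  ultimately have "(?f has_sum (S + S)) (range int \<union> range (\<lambda>n. - 1 - int n))"
    by (rule has_sum_Un_disjoint)
  also have "range int \<union> range (\<lambda>n. - 1 - int n) = UNIV"
  proof (intro equalityI subsetI UNIV_I)
    fix n :: int
    have "n = int (nat n) \<or> n = - 1 - int (nat (- 1 - n))" by linarith
    then show "n \<in> range int \<union> range (\<lambda>n. - 1 - int n)" by (metis UnCI rangeI)
  qed
  finally have "S + S = half_diff \<tau>"
    using \<open>(?f has_sum half_diff \<tau>) UNIV\<close> has_sum_unique by blast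
  moreover have "((\<lambda>n. 2 * koebe_odd (?x ^ (2 * n + 1))) has_sum (2 * S)) UNIV"
    by (intro has_sum_cmult_right S)
  ultimately show ?thesis by simp
qed

text \<open>Absolute summability permits regrouping the double series. The exponent (2n+1)(2k+1) is
  at least n + k, which gives a product of two summable series as majorant.\<close>

lemma lambert_summable:
  fixes x :: complex
  assumes x: "norm x < 1"
  shows "(\<lambda>(n, k). 4 * of_nat (2 * k + 1) * x ^ ((2 * n + 1) * (2 * k + 1))) summable_on (UNIV :: (nat \<times> nat) set)"
proof -
  let ?r = "norm x"
  have "summable (\<lambda>k. of_nat (2 * k + 1) * ?r ^ k)"
  proof -
    have "summable (\<lambda>k. 2 * (of_nat (Suc k) * ?r ^ k) - ?r ^ k)"
      using geometric_deriv_sums[of ?r] x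
      by (intro summable_diff summable_mult summable_geometric) (auto simp: sums_iff)
    then show ?thesis by (simp add: algebra_simps)
  qed
  then have "(\<lambda>k. of_nat (2 * k + 1) * ?r ^ k) summable_on UNIV"
    by (intro norm_summable_imp_summable_on) simp
  then obtain S where S: "((\<lambda>k. of_nat (2 * k + 1) * ?r ^ k) has_sum S) UNIV" by (auto simp: summable_on_def)
  have *: "(\<lambda>(n, k). 4 * (of_nat (2 * k + 1) * ?r ^ k) * ?r ^ n) summable_on (UNIV \<times> UNIV :: (nat \<times> nat) set)"
  proof (rule summable_on_SigmaI)
    show "((\<lambda>k. case (n, k) of (n, k) \<Rightarrow> 4 * (of_nat (2 * k + 1) * ?r ^ k) * ?r ^ n) has_sum (4 * S * ?r ^ n)) UNIV" for n
      unfolding prod.case by (intro has_sum_cmult_left has_sum_cmult_right S)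
    show "(\<lambda>n. 4 * S * ?r ^ n) summable_on UNIV"
      by (intro summable_on_cmult_right norm_summable_imp_summable_on) (use x in simp)
  qed auto
  show ?thesis
  proof (rule abs_summable_summable, rule summable_on_comparison_test[where f = "\<lambda>(n, k). 4 * (of_nat (2 * k + 1) * ?r ^ k) * ?r ^ n"])
    fix p :: "nat \<times> nat"
    obtain n k where p: "p = (n, k)" by (cases p)
    have "?r ^ ((2 * n + 1) * (2 * k + 1)) \<le> ?r ^ (n + k)"
      by (rule power_decreasing) (use x in auto)
    then have "4 * real (2 * k + 1) * ?r ^ ((2 * n + 1) * (2 * k + 1)) \<le> 4 * real (2 * k + 1) * ?r ^ (n + k)"
      by (intro mult_left_mono) auto
    moreover have "norm (4 * of_nat (2 * k + 1) * x ^ ((2 * n + 1) * (2 * k + 1))) = 4 * real (2 * k + 1) * ?r ^ ((2 * n + 1) * (2 * k + 1))"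
      by (simp only: norm_mult norm_power norm_of_nat norm_numeral)
    ultimately show "norm (case p of (n, k) \<Rightarrow> 4 * of_nat (2 * k + 1) * x ^ ((2 * n + 1) * (2 * k + 1)))
      \<le> (case p of (n, k) \<Rightarrow> 4 * (of_nat (2 * k + 1) * ?r ^ k) * ?r ^ n)"
      unfolding p prod.case by (simp only: power_add mult_ac)
  qed (use * in \<open>simp_all add: case_prod_unfold\<close>)
qed

text \<open>Lambert rearrangement: the terms are collected by (2n+1)(2k+1) = 2j+1, with d = 2k+1
  running over the divisors. The factor 4 combines the two equal rows with the factor 2 of
  \<open>koebe_odd\<close>.\<close>

lemma half_diff_has_sum:
  assumes \<tau>: "Im \<tau> > 0"
  shows "((\<lambda>j. 4 * of_int (Y $ j) * nome (\<tau> / 2) ^ (2 * j + 1)) has_sum half_diff \<tau>) UNIV"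
proof -
  let ?x = "nome (\<tau> / 2)"
  let ?F = "\<lambda>(n, k). 4 * of_nat (2 * k + 1) * ?x ^ ((2 * n + 1) * (2 * k + 1))"
  let ?G = "\<lambda>(j, d). 4 * of_nat d * ?x ^ (2 * j + 1)"
  let ?D = "Sigma UNIV (\<lambda>j::nat. {d. d dvd 2 * j + 1})"
  have x: "norm ?x < 1" using \<tau> by (simp add: norm_nome)
  have "(?F has_sum half_diff \<tau>) (UNIV \<times> UNIV)"
  proof (rule has_sum_SigmaI)
    show "((\<lambda>k. ?F (n, k)) has_sum (2 * koebe_odd (?x ^ (2 * n + 1)))) UNIV" for n
    proof -
      have "norm (?x ^ (2 * n + 1)) < 1"
        using x by (simp add: norm_power power_less_one_iff del: power_Suc)
      from has_sum_cmult_right[OF koebe_odd_has_sum[OF this], of 2]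
      have "((\<lambda>k. 2 * (2 * of_nat (2 * k + 1) * (?x ^ (2 * n + 1)) ^ (2 * k + 1))) has_sum
          (2 * koebe_odd (?x ^ (2 * n + 1)))) UNIV" .
      moreover have "2 * (2 * of_nat (2 * k + 1) * (?x ^ (2 * n + 1)) ^ (2 * k + 1)) = ?F (n, k)" for k
        unfolding power_mult[symmetric] prod.case by (simp only: mult.assoc[symmetric]) simp
      ultimately show ?thesis by (simp only:)
    qed
  qed (use half_diff_eq_infsum[OF \<tau>] lambert_summable[OF x] in auto)
  also have "(?F has_sum half_diff \<tau>) (UNIV \<times> UNIV) \<longleftrightarrow> (?G has_sum half_diff \<tau>) ?D"
  proof (rule has_sum_reindex_bij_witness[where
        i = "\<lambda>(j, d). ((2 * j + 1) div d div 2, d div 2)" and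
        j = "\<lambda>(n, k). (((2 * n + 1) * (2 * k + 1)) div 2, 2 * k + 1)"])
    fix p :: "nat \<times> nat"
    obtain n k where p: "p = (n, k)" by (cases p)
    have e: "2 * (((2 * n + 1) * (2 * k + 1)) div 2) + 1 = (2 * n + 1) * (2 * k + 1)" by simp
    show "(case case p of (n, k) \<Rightarrow> (((2 * n + 1) * (2 * k + 1)) div 2, 2 * k + 1) of
        (j, d) \<Rightarrow> ((2 * j + 1) div d div 2, d div 2)) = p"
    proof -
      have "(2 * n + 1) * (2 * k + 1) div (2 * k + 1) = 2 * n + 1"
        by (rule nonzero_mult_div_cancel_right) simp
      then show ?thesis unfolding p prod.case e by simp
    qed
    show "(case p of (n, k) \<Rightarrow> (((2 * n + 1) * (2 * k + 1)) div 2, 2 * k + 1)) \<in> ?D"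
      unfolding p prod.case mem_Sigma_iff mem_Collect_eq e by (intro conjI UNIV_I dvd_triv_right)
    show "?G (case p of (n, k) \<Rightarrow> (((2 * n + 1) * (2 * k + 1)) div 2, 2 * k + 1)) = ?F p"
      unfolding p prod.case e by simp
  next
    fix p assume "p \<in> ?D"
    then obtain j d where p: "p = (j, d)" "d dvd 2 * j + 1" by auto
    then obtain e where e: "2 * j + 1 = d * e" by (elim dvdE)
    then have "odd (d * e)" unfolding e[symmetric] by simp
    then have odd: "odd d" "odd e" by simp_all
    have "d > 0" using odd(1) by (cases d) auto
    then have e': "(2 * j + 1) div d = e" unfolding e by simp
    have "2 * (e div 2) + 1 = e" "2 * (d div 2) + 1 = d" using odd by simp_all
    then have "(2 * (e div 2) + 1) * (2 * (d div 2) + 1) = 2 * j + 1" using e by (simp add: mult.commute)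
    then show "(case case p of (j, d) \<Rightarrow> ((2 * j + 1) div d div 2, d div 2) of
        (n, k) \<Rightarrow> (((2 * n + 1) * (2 * k + 1)) div 2, 2 * k + 1)) = p"
      unfolding p(1) prod.case e' using odd by simp
  qed auto
  finally have "(?G has_sum half_diff \<tau>) ?D" .
  then show ?thesis
  proof (rule has_sum_SigmaD)
    fix j :: nat
    have "(\<Sum>d | d dvd 2 * j + 1. 4 * of_nat d * ?x ^ (2 * j + 1)) = 4 * of_int (Y $ j) * ?x ^ (2 * j + 1)"
      by (simp add: Y_nth sigma_def sum_distrib_left sum_distrib_right)
    then show "((\<lambda>d. ?G (j, d)) has_sum (4 * of_int (Y $ j) * ?x ^ (2 * j + 1))) {d. d dvd 2 * j + 1}"
      by (intro has_sum_finiteI) auto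
  qed
qed

definition complex_fps :: "int fps \<Rightarrow> complex fps" where
  "complex_fps f = Abs_fps (\<lambda>n. of_int (f $ n))"

lemma complex_fps_nth [simp]: "complex_fps f $ n = of_int (f $ n)"
  by (simp add: complex_fps_def)

lemma complex_fps_mult: "complex_fps (f * g) = complex_fps f * complex_fps g"
  by (rule fps_ext) (simp add: fps_mult_nth)

lemma nome_surj:
  assumes "q \<noteq> 0" "norm q < 1"
  obtains z where "Im z > 0" "nome z = q"
proof -
  define z where "z = Ln q / (2 * of_real pi * \<i>)"
  have q: "nome z = q" using assms by (simp add: nome_def z_def)
  then have "exp (- (2 * pi * Im z)) < 1" using assms norm_nome[of z] by simp
  then have "Im z > 0" by (simp add: zero_less_mult_iff)
  with q that show thesis by blast
qed

text \<open>No growth estimate for \<open>sigma\<close> is made: each radius below 1 is the nome of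
  some point, where the series of \<open>half_diff\<close> already converges.\<close>

lemma Y_conv_radius: "fps_conv_radius (complex_fps Y) \<ge> 1"
  unfolding fps_conv_radius_def
proof (rule conv_radius_geI_ex)
  fix r :: real assume r: "0 < r" "ereal r < 1"
  obtain z where z: "Im z > 0" "nome z = of_real r"
    by (rule nome_surj[of "of_real r"]) (use r in auto)
  let ?x = "nome (z / 2)"
  have x2: "?x ^ 2 = of_real r" using z nome_of_nat_mult[of 2 "z / 2"] by simp
  have "summable (\<lambda>j. 4 * of_int (Y $ j) * ?x ^ (2 * j + 1))"
    using half_diff_has_sum[OF z(1)] has_sum_imp_sums sums_summable by blast
  then have "summable (\<lambda>j. inverse (4 * ?x) * (4 * of_int (Y $ j) * ?x ^ (2 * j + 1)))"
    by (rule summable_mult)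
  moreover have "inverse (4 * ?x) * (4 * of_int (Y $ j) * ?x ^ (2 * j + 1)) = of_int (Y $ j) * of_real r ^ j" for j
  proof -
    have "?x ^ (2 * j + 1) = of_real r ^ j * ?x" by (simp only: power_add power_mult x2 power_one_right)
    then show ?thesis by simp
  qed
  ultimately have "summable (\<lambda>j. of_int (Y $ j) * complex_of_real r ^ j)" by (simp only:)
  then show "\<exists>z. norm z = r \<and> summable (\<lambda>n. complex_fps Y $ n * z ^ n)"
    using r by (intro exI[of _ "of_real r"]) simp
qed

definition Yc :: "complex \<Rightarrow> complex" where
  "Yc = eval_fps (complex_fps Y)"

lemma Yc_holomorphic: "Yc holomorphic_on ball 0 1"
  unfolding Yc_def
  by (rule holomorphic_on_subset[OF holomorphic_on_eval_fps[OF subset_refl]])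
     (auto intro!: less_le_trans[OF _ Y_conv_radius] simp: one_ereal_def)

lemma Yc_expansion: "Yc has_fps_expansion complex_fps Y"
  unfolding Yc_def by (intro eval_fps_has_fps_expansion less_le_trans[OF _ Y_conv_radius]) simp

lemma Yc_0: "Yc 0 = 1"
  by (simp add: Yc_def eval_fps_at_0 Y_0)

lemma half_diff_eq: "Im \<tau> > 0 \<Longrightarrow> half_diff \<tau> = 4 * nome (\<tau> / 2) * Yc (nome \<tau>)"
proof -
  assume \<tau>: "Im \<tau> > 0"
  let ?x = "nome (\<tau> / 2)"
  have x2: "?x ^ 2 = nome \<tau>" using nome_of_nat_mult[of 2 "\<tau> / 2"] by simp
  have "norm (nome \<tau>) < 1" using \<tau> by (simp add: norm_nome)
  then have "(\<lambda>j. complex_fps Y $ j * nome \<tau> ^ j) sums Yc (nome \<tau>)"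
    unfolding Yc_def by (intro sums_eval_fps less_le_trans[OF _ Y_conv_radius]) (simp add: one_ereal_def)
  from sums_mult[OF this, of "4 * ?x"]
  moreover have "4 * ?x * (complex_fps Y $ j * nome \<tau> ^ j) = 4 * of_int (Y $ j) * ?x ^ (2 * j + 1)" for j
  proof -
    have "?x ^ (2 * j + 1) = nome \<tau> ^ j * ?x" by (simp only: power_add power_mult x2 power_one_right)
    then show ?thesis by simp
  qed
  ultimately have "(\<lambda>j. 4 * of_int (Y $ j) * ?x ^ (2 * j + 1)) sums (4 * ?x * Yc (nome \<tau>))"
    by (simp only:)
  moreover have "(\<lambda>j. 4 * of_int (Y $ j) * ?x ^ (2 * j + 1)) sums half_diff \<tau>"
    by (intro has_sum_imp_sums half_diff_has_sum \<tau>)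
  ultimately show ?thesis using sums_unique2 by metis
qed

lemma half_diff_nonzero: "Im \<tau> > 0 \<Longrightarrow> half_diff \<tau> \<noteq> 0"
  using wp_half_periods_distinct by (simp add: half_diff_def)

text \<open>Every point of the punctured disc is a nome, so the zero-freeness of
  \<open>half_diff\<close> transfers; the centre has the value 1.\<close>

lemma Yc_nonzero: "norm q < 1 \<Longrightarrow> Yc q \<noteq> 0"
proof (cases "q = 0")
  case False
  assume "norm q < 1"
  with False obtain z where "Im z > 0" "nome z = q" by (rule nome_surj)
  then show ?thesis using half_diff_nonzero half_diff_eq by fastforce
qed (simp add: Yc_0)

section \<open>Expansions at the cusps\<close>

lemma upper_half_plane_iff [simp]: "z \<in> upper_half_plane \<longleftrightarrow> Im z > 0"
  by (simp add: upper_half_plane_def)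

lemma norm_nome_less_1: "h > 0 \<Longrightarrow> Im z > 0 \<Longrightarrow> norm (nome (z / of_nat h)) < 1"
  by (simp add: norm_nome)

lemma norm_nome_less_1_iff: "h > 0 \<Longrightarrow> norm (nome (z / of_nat h)) < 1 \<longleftrightarrow> Im z > 0"
  by (simp add: norm_nome zero_less_divide_iff zero_less_mult_iff)

lemma nome_power_int: "exp (2 * of_real pi * \<i> * of_int n * z / of_nat h) = nome (z / of_nat h) powi n"
proof -
  have "2 * of_real pi * \<i> * of_int n * z / of_nat h = of_int n * (2 * of_real pi * \<i> * (z / of_nat h))"
    by simp
  then show ?thesis by (simp only: nome_def exp_power_int mult.commute)
qed

text \<open>Periodicity makes the composition with a logarithm independent of the branch, hence
  holomorphic on the punctured disc; boundedness high in the half plane removes the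
  puncture.\<close>

lemma periodic_function_of_nome:
  assumes h: "h > 0" and hol: "f holomorphic_on upper_half_plane"
    and per: "\<And>z. Im z > 0 \<Longrightarrow> f (z + of_nat h) = f z"
    and bound: "\<And>z. Im z > Y0 \<Longrightarrow> norm (f z) \<le> B" and Y0: "Y0 > 0"
  obtains g where "g holomorphic_on ball 0 1" "\<And>z. Im z > 0 \<Longrightarrow> f z = g (nome (z / of_nat h))"
proof -
  define G where "G = (\<lambda>w. f (of_nat h * (Ln w / (2 * of_real pi * \<i>))))"
  have per_nat: "f (z + of_nat n * of_nat h) = f z" if "Im z > 0" for z n
  proof (induction n)
    case (Suc n)
    have "f (z + of_nat (Suc n) * of_nat h) = f ((z + of_nat n * of_nat h) + of_nat h)"
      by (simp add: algebra_simps)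
    also have "\<dots> = f (z + of_nat n * of_nat h)" by (rule per) (use that in simp)
    finally show ?case using Suc by simp
  qed simp
  have per_int: "f (z + of_int n * of_nat h) = f z" if "Im z > 0" for z n
  proof (cases "n \<ge> 0")
    case True
    then show ?thesis using per_nat[OF that, of "nat n"] by simp
  next
    case False
    then show ?thesis using per_nat[of "z + of_int n * of_nat h" "nat (- n)"] that by simp
  qed
  have nome_ln: "nome (of_nat h * (Ln w / (2 * of_real pi * \<i>)) / of_nat h) = w" if "w \<noteq> 0" for w
    using that h by (simp add: nome_def)
  have fG: "f z = G (nome (z / of_nat h))" if z: "Im z > 0" for z
  proof -
    let ?w = "nome (z / of_nat h)" let ?z = "of_nat h * (Ln ?w / (2 * of_real pi * \<i>))"
    have nz: "nome (?z / of_nat h) = ?w" by (intro nome_ln) simp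
    have "(z - ?z) / of_nat h = z / of_nat h + - (?z / of_nat h)" by (simp add: diff_divide_distrib)
    then have "nome ((z - ?z) / of_nat h) = ?w * inverse ?w" by (simp only: nome_add nome_minus nz)
    then have "(z - ?z) / of_nat h \<in> \<int>" by (simp add: nome_eq_1_iff)
    then obtain n where "(z - ?z) / of_nat h = of_int n" by (elim Ints_cases)
    then have "z = ?z + of_int n * of_nat h" using h by (simp add: field_simps)
    moreover have "Im ?z > 0"
      using norm_nome_less_1_iff[OF h, of ?z] norm_nome_less_1[OF h z] unfolding nz by simp
    ultimately show ?thesis unfolding G_def using per_int by metis
  qed
  have G_hol: "G holomorphic_on ball 0 1 - {0}"
  proof -
    have "G field_differentiable at w0" if w0: "w0 \<in> ball 0 1 - {0}" for w0
    proof -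
      define U where "U = ball w0 (norm w0) \<inter> ball 0 1"
      \<comment> \<open>A rotated branch of the logarithm, holomorphic near w0 even if w0 lies on
        the cut of \<open>Ln\<close>.\<close>
      define zz where "zz = (\<lambda>w. of_nat h * ((Ln (w / w0) + Ln w0) / (2 * of_real pi * \<i>)))"
      have U: "open U" "w0 \<in> U" using w0 by (auto simp: U_def)
      have Re_pos: "Re (w / w0) > 0" "w \<noteq> 0" if "w \<in> U" for w
      proof -
        have "norm (1 - w / w0) = norm (w0 - w) / norm w0"
          using w0 by (simp add: norm_divide[symmetric] diff_divide_distrib)
        also have "\<dots> < 1" using that w0 by (simp add: U_def dist_norm)
        finally have "\<bar>Re (1 - w / w0)\<bar> < 1" using abs_Re_le_cmod le_less_trans by blast
        then show "Re (w / w0) > 0" by simp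
        then show "w \<noteq> 0" by auto
      qed
      have nome_zz: "nome (zz w / of_nat h) = w" if "w \<in> U" for w
        using Re_pos[OF that] w0 h by (simp add: zz_def nome_def exp_add)
      have zz_pos: "Im (zz w) > 0" if "w \<in> U" for w
        using norm_nome_less_1_iff[OF h, of "zz w"] nome_zz[OF that] that by (simp add: U_def)
      have "zz holomorphic_on U"
      proof -
        have "w / w0 \<notin> \<real>\<^sub>\<le>\<^sub>0" if "w \<in> U" for w
          using Re_pos(1)[OF that] by (auto simp: complex_nonpos_Reals_iff)
        then show ?thesis unfolding zz_def using w0 by (intro holomorphic_intros) auto
      qed
      moreover have "zz ` U \<subseteq> upper_half_plane" using zz_pos by auto
      ultimately have "f \<circ> zz holomorphic_on U" using hol by (intro holomorphic_on_compose_gen)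
      moreover have "(f \<circ> zz) w = G w" if "w \<in> U" for w
        using fG[OF zz_pos[OF that]] nome_zz[OF that] by simp
      ultimately have "G holomorphic_on U" by (rule holomorphic_transform)
      then show ?thesis using U by (rule holomorphic_on_imp_differentiable_at)
    qed
    then show ?thesis by (simp add: holomorphic_on_def field_differentiable_at_within)
  qed
  have "\<forall>\<^sub>F w in at 0. norm (G w) \<le> B"
    unfolding eventually_at
  proof (intro exI conjI ballI impI)
    let ?\<rho> = "exp (- (2 * pi * Y0 / of_nat h))"
    show "?\<rho> > 0" by simp
    fix w :: complex assume w: "w \<noteq> 0 \<and> dist w 0 < ?\<rho>"
    define z where "z = of_nat h * (Ln w / (2 * of_real pi * \<i>))"
    have "norm (nome (z / of_nat h)) < ?\<rho>" using nome_ln w by (simp add: dist_norm z_def)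
    then have "2 * pi * (Y0 / of_nat h) < 2 * pi * (Im z / of_nat h)" unfolding norm_nome by simp
    then have "Y0 < Im z" using h by (simp add: divide_less_cancel)
    then have "Y0 < Im (of_nat h * (Ln w / (2 * of_real pi * \<i>)))" by (simp only: z_def)
    then show "norm (G w) \<le> B" unfolding G_def by (rule bound)
  qed
  then obtain g where g: "g holomorphic_on ball 0 1" "\<And>w. w \<in> ball 0 1 - {0} \<Longrightarrow> g w = G w"
    using holomorphic_on_extend_bounded[OF G_hol] by (auto simp: interior_open)
  show thesis
  proof (rule that[OF g(1)])
    fix z assume z: "Im z > 0"
    show "f z = g (nome (z / of_nat h))" using fG[OF z] g(2) norm_nome_less_1[OF h z] by simp
  qed
qed

text \<open>Holomorphy on the whole punctured disc makes the Laurent series converge absolutely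
  there, which turns the ordinary series into the unordered sum over all integers.\<close>

lemma has_q_expansionI:
  assumes h: "h > 0" and hol: "g holomorphic_on ball 0 1 - {0}" and F: "g has_laurent_expansion F"
    and f: "\<And>z. Im z > 0 \<Longrightarrow> f z = g (nome (z / of_nat h))"
  shows "has_q_expansion h f (\<lambda>n. F $$ n)"
  unfolding has_q_expansion_def
proof (intro conjI ballI)
  define N where "N = fls_subdegree F"
  have "{n. n < 0 \<and> F $$ n \<noteq> 0} \<subseteq> {N..0}"
    unfolding N_def using fls_subdegree_leI by fastforce
  then show "finite {n. n < 0 \<and> F $$ n \<noteq> 0}" by (rule finite_subset) simp
  fix z assume "z \<in> upper_half_plane"
  then have z: "Im z > 0" by simp
  define q where "q = nome (z / of_nat h)"
  have q: "norm q < 1" "q \<noteq> 0" using norm_nome_less_1[OF h z] by (simp_all add: q_def)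
  have hol': "g holomorphic_on eball 0 (ereal 1) - {0}" using hol by simp
  have "ereal (norm q) < ereal 1" using q by simp
  also have "\<dots> \<le> fls_conv_radius F" by (rule fls_conv_radius_ge[OF F hol'])
  finally have rad: "ereal (norm q) < fls_conv_radius F" .
  have eval: "eval_fls F q = g q" by (rule eval_fls_eqI[OF F hol']) (use q in simp)
  have "(\<lambda>k. F $$ (int k + N) * q powi (int k + N)) sums g q"
    unfolding N_def eval[symmetric] by (rule sums_eval_fls[OF rad]) (use q in simp)
  moreover have "summable (\<lambda>k. norm (F $$ (int k + N) * q powi (int k + N)))"
  proof -
    have "summable (\<lambda>k. norm (F $$ (int k + N) * q ^ k) * norm (q powi N))"
      unfolding N_def by (intro summable_mult2 norm_summable_fls' rad)
    then show ?thesis using q by (simp add: power_int_add norm_mult mult_ac)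
  qed
  ultimately have "((\<lambda>k. F $$ (int k + N) * q powi (int k + N)) has_sum g q) UNIV"
    by (intro norm_summable_imp_has_sum)
  then have "((\<lambda>n. F $$ n * q powi n) has_sum g q) (range (\<lambda>k. int k + N))"
    by (subst has_sum_reindex) (auto simp: inj_on_def o_def)
  then have "((\<lambda>n. F $$ n * q powi n) has_sum g q) UNIV"
  proof (subst (asm) has_sum_cong_neutral[where T = UNIV])
    fix n assume "n \<in> UNIV - range (\<lambda>k. int k + N)"
    moreover have "n = int (nat (n - N)) + N" if "n \<ge> N" using that by simp
    ultimately have "n < N" by (metis DiffD2 not_less rangeI)
    then show "F $$ n * q powi n = 0" by (simp add: N_def)
  qed auto
  then show "((\<lambda>n. F $$ n * exp (2 * complex_of_real pi * \<i> * of_int n * z / of_nat h)) has_sum f z) UNIV"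
    unfolding nome_power_int f[OF z] q_def .
qed

text \<open>The converse passage: multiplication by the K-th power of the nome removes negative
  exponents, and every nonzero point of the disc is attained as \<open>nome (z / h)\<close>.\<close>

lemma has_q_expansion_imp_power_series:
  assumes h: "h > 0" and c: "has_q_expansion h f c" and K: "\<And>n. n < - int K \<Longrightarrow> c n = 0"
  obtains g where "g holomorphic_on ball 0 1"
    and "\<And>w. norm w < 1 \<Longrightarrow> (\<lambda>n. c (int n - int K) * w ^ n) sums g w"
    and "\<And>z. Im z > 0 \<Longrightarrow> f z * nome (z / of_nat h) ^ K = g (nome (z / of_nat h))"
proof -
  define g where "g = (\<lambda>w. suminf (\<lambda>n. c (int n - int K) * w ^ n))"
  have sums: "(\<lambda>n. c (int n - int K) * nome (z / of_nat h) ^ n) sums (f z * nome (z / of_nat h) ^ K)"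
    if z: "Im z > 0" for z
  proof -
    let ?q = "nome (z / of_nat h)"
    have "((\<lambda>n. c n * ?q powi n) has_sum f z) UNIV"
      using c z unfolding has_q_expansion_def nome_power_int by simp
    then have "((\<lambda>n. c n * ?q powi n) has_sum f z) (range (\<lambda>n. int n - int K))"
    proof (subst (asm) has_sum_cong_neutral[where T = "range (\<lambda>n. int n - int K)"])
      fix n assume "n \<in> UNIV - range (\<lambda>n. int n - int K)"
      moreover have "n = int (nat (n + int K)) - int K" if "n \<ge> - int K" using that by simp
      ultimately have "n < - int K" by (metis DiffD2 not_less rangeI)
      then show "c n * ?q powi n = 0" by (simp add: K)
    qed auto
    then have "((\<lambda>n. c (int n - int K) * ?q powi (int n - int K)) has_sum f z) UNIV"
      by (subst (asm) has_sum_reindex) (auto simp: inj_on_def o_def)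
    from sums_mult2[OF has_sum_imp_sums[OF this], of "?q ^ K"] show ?thesis
      by (simp add: power_int_diff)
  qed
  have g_sums: "(\<lambda>n. c (int n - int K) * w ^ n) sums g w" if w: "norm w < 1" for w
  proof (cases "w = 0")
    case True
    then show ?thesis unfolding g_def
      by (intro summable_sums) (auto intro!: summable_finite[of "{0}"])
  next
    case False
    then obtain z where z: "Im z > 0" "nome z = w" using w by (rule nome_surj)
    have "Im (of_nat h * z) > 0" "nome (of_nat h * z / of_nat h) = w" using z h by simp_all
    with sums[of "of_nat h * z"] show ?thesis by (auto simp: g_def sums_iff)
  qed
  show thesis
  proof (rule that)
    show "g holomorphic_on ball 0 1"
      by (rule power_series_holomorphic) (use g_sums in simp)
    show "f z * nome (z / of_nat h) ^ K = g (nome (z / of_nat h))" if "Im z > 0" for z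
      using sums[OF that] by (simp add: g_def sums_iff)
  qed (rule g_sums)
qed

lemma has_q_expansion_lower_bound:
  assumes "has_q_expansion h f c"
  shows "\<exists>K. \<forall>n. n < - int K \<longrightarrow> c n = 0"
proof -
  define S where "S = insert 0 {n. n < 0 \<and> c n \<noteq> 0}"
  have "finite S" using assms by (simp add: S_def has_q_expansion_def)
  then have Min: "Min S \<le> n" if "n < 0" "c n \<noteq> 0" for n using that by (intro Min_le) (auto simp: S_def)
  have "c n = 0" if n: "n < - int (nat (- Min S))" for n
  proof (rule ccontr)
    assume "c n \<noteq> 0"
    moreover have "n < 0" using n by linarith
    ultimately have "Min S \<le> n" by (intro Min)
    with n show False by linarith
  qed
  then show ?thesis by blast
qed

lemma has_q_expansion_unique:
  assumes h: "h > 0" and c: "has_q_expansion h f c" and c': "has_q_expansion h f c'"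
  shows "c = c'"
proof
  fix n
  obtain K1 where K1: "\<And>n. n < - int K1 \<Longrightarrow> c n = 0" using has_q_expansion_lower_bound[OF c] by blast
  obtain K2 where K2: "\<And>n. n < - int K2 \<Longrightarrow> c' n = 0" using has_q_expansion_lower_bound[OF c'] by blast
  \<comment> \<open>Besides bounding both pole orders, K is at least -n, so that the exponent n
    appears in the shifted power series.\<close>
  define K where "K = max (max K1 K2) (nat (- n))"
  have K: "\<And>n. n < - int K \<Longrightarrow> c n = 0" "\<And>n. n < - int K \<Longrightarrow> c' n = 0"
    using K1 K2 by (auto simp: K_def)
  obtain g where g: "\<And>w. norm w < 1 \<Longrightarrow> (\<lambda>n. c (int n - int K) * w ^ n) sums g w"
    "\<And>z. Im z > 0 \<Longrightarrow> f z * nome (z / of_nat h) ^ K = g (nome (z / of_nat h))"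
    using has_q_expansion_imp_power_series[OF h c K(1)] by blast
  obtain g' where g': "\<And>w. norm w < 1 \<Longrightarrow> (\<lambda>n. c' (int n - int K) * w ^ n) sums g' w"
    "\<And>z. Im z > 0 \<Longrightarrow> f z * nome (z / of_nat h) ^ K = g' (nome (z / of_nat h))"
    using has_q_expansion_imp_power_series[OF h c' K(2)] by blast
  have gg': "g w = g' w" if w: "norm w < 1" "w \<noteq> 0" for w
  proof -
    obtain z where z: "Im z > 0" "nome z = w" using w(2,1) by (rule nome_surj)
    have "Im (of_nat h * z) > 0" "nome (of_nat h * z / of_nat h) = w" using z h by simp_all
    with g(2) g'(2) show ?thesis by metis
  qed
  have ev: "eventually (\<lambda>w::complex. norm w < 1) (nhds 0)"
    using eventually_nhds_in_open[of "ball 0 1" "0 :: complex"] by simp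
  have "g has_fps_expansion Abs_fps (\<lambda>n. c (int n - int K))"
    by (rule has_fps_expansionI) (use ev g(1) in \<open>auto elim: eventually_mono\<close>)
  then have 1: "g has_laurent_expansion fps_to_fls (Abs_fps (\<lambda>n. c (int n - int K)))"
    by (rule has_laurent_expansion_fps)
  have "g' has_fps_expansion Abs_fps (\<lambda>n. c' (int n - int K))"
    by (rule has_fps_expansionI) (use ev g'(1) in \<open>auto elim: eventually_mono\<close>)
  then have 2: "g' has_laurent_expansion fps_to_fls (Abs_fps (\<lambda>n. c' (int n - int K)))"
    by (rule has_laurent_expansion_fps)
  have "eventually (\<lambda>w. g w = g' w) (at 0)"
    using ev unfolding eventually_at_filter by eventually_elim (use gg' in auto)
  then have "g' has_laurent_expansion fps_to_fls (Abs_fps (\<lambda>n. c (int n - int K)))"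
    using 1 has_laurent_expansion_cong by blast
  from has_laurent_expansion_unique[OF this 2]
  have "(\<lambda>n. c (int n - int K)) = (\<lambda>n. c' (int n - int K))"
    by (simp add: fps_eq_iff)
  then have "c (int (nat (n + int K)) - int K) = c' (int (nat (n + int K)) - int K)" by metis
  moreover have "int (nat (n + int K)) - int K = n" unfolding K_def by linarith
  ultimately show "c n = c' n" by (simp only:)
qed

lemma fourier_coeff_eqI: "has_q_expansion 1 f c \<Longrightarrow> fourier_coeff f = c"
  unfolding fourier_coeff_def using has_q_expansion_unique[of 1] by (intro the_equality) auto

section \<open>The Hauptmodul on the upper half plane\<close>

definition half_value :: "complex \<Rightarrow> int \<Rightarrow> int \<Rightarrow> complex" where
  "half_value \<tau> r s = wp \<tau> ((of_int r * \<tau> + of_int s) / 2)"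

lemma half_value_mod_2: "half_value \<tau> r s = half_value \<tau> (r mod 2) (s mod 2)"
proof -
  have r: "r = r mod 2 + 2 * (r div 2)" and s: "s = s mod 2 + 2 * (s div 2)" by simp_all
  have "(of_int r * \<tau> + of_int s) / 2 =
      (of_int (r mod 2) * \<tau> + of_int (s mod 2)) / 2 + (of_int (s div 2) + of_int (r div 2) * \<tau>)"
    by (subst r, subst s) (simp only: of_int_add of_int_mult of_int_numeral, simp add: field_simps)
  then show ?thesis
    unfolding half_value_def using wp_periodic[OF latticeI[OF refl]] by metis
qed

lemma half_diff_half_value: "half_diff \<tau> = half_value \<tau> 1 0 - half_value \<tau> 1 1"
  by (simp add: half_diff_def half_value_def)

text \<open>Scaled by j, the half periods of the image point become (a\<tau> + b)/2 and ((a+c)\<tau>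
  + (b+d))/2. The determinant keeps both off the lattice, so the additive constants of
  \<open>wp_transform\<close> cancel.\<close>

lemma half_diff_transform:
  fixes a b c d :: int
  assumes \<tau>: "Im \<tau> > 0" and det: "a * d - b * c = 1"
  defines "j \<equiv> of_int c * \<tau> + of_int d"
  shows "half_diff ((of_int a * \<tau> + of_int b) / j) = j ^ 2 * (half_value \<tau> a b - half_value \<tau> (a + c) (b + d))"
proof -
  let ?\<tau>' = "(of_int a * \<tau> + of_int b) / j"
  have j: "j \<noteq> 0" using wp_transform(1)[OF \<tau> det] by (simp add: j_def)
  obtain C where C: "\<And>z. z \<notin> lattice \<tau> \<Longrightarrow> wp ?\<tau>' (z / j) = j ^ 2 * wp \<tau> z + C"
    using wp_transform(3)[OF \<tau> det] unfolding j_def by blast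
  have "\<not> (even a \<and> even b)"
  proof
    assume "even a \<and> even b"
    then have "even (a * d - b * c)" by simp
    then show False using det by simp
  qed
  then have 1: "wp ?\<tau>' ((of_int a * \<tau> + of_int b) / 2 / j) = j ^ 2 * half_value \<tau> a b + C"
    unfolding half_value_def by (intro C) (simp add: half_lattice_iff[OF \<tau>])
  have "\<not> (even (a + c) \<and> even (b + d))"
  proof
    assume "even (a + c) \<and> even (b + d)"
    then have "even ((a + c) * d - (b + d) * c)" by simp
    moreover have "(a + c) * d - (b + d) * c = 1" using det by (simp add: algebra_simps)
    ultimately show False by simp
  qed
  then have 2: "wp ?\<tau>' ((of_int (a + c) * \<tau> + of_int (b + d)) / 2 / j) = j ^ 2 * half_value \<tau> (a + c) (b + d) + C"
    unfolding half_value_def by (intro C) (simp add: half_lattice_iff[OF \<tau>] del: of_int_add)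
  have 3: "(of_int a * \<tau> + of_int b) / 2 / j = ?\<tau>' / 2" by simp
  have 4: "(of_int (a + c) * \<tau> + of_int (b + d)) / 2 / j = (?\<tau>' + 1) / 2"
    using j by (simp add: field_simps j_def)
  show ?thesis
    unfolding half_diff_def 1[unfolded 3] 2[unfolded 4] by (simp add: algebra_simps)
qed

text \<open>With c even, a and d are odd: the two half periods are the original ones modulo the
  lattice, exchanged exactly when b is odd.\<close>

lemma half_diff_transform_even:
  fixes a b c d :: int
  assumes \<tau>: "Im \<tau> > 0" and det: "a * d - b * c = 1" and c: "even c"
  defines "j \<equiv> of_int c * \<tau> + of_int d"
  shows "half_diff ((of_int a * \<tau> + of_int b) / j) = (if even b then 1 else - 1) * j ^ 2 * half_diff \<tau>"
proof -
  have "odd a" "odd d"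
  proof -
    have "a * d = 1 + b * c" using det by simp
    then have "odd (a * d)" using c by simp
    then show "odd a" "odd d" by simp_all
  qed
  then have mods: "a mod 2 = 1" "(a + c) mod 2 = 1" "b mod 2 = (if even b then 0 else 1)"
    "(b + d) mod 2 = (if even b then 1 else 0)"
    using c by (simp_all add: mod2_eq_if)
  show ?thesis
    unfolding j_def half_diff_transform[OF \<tau> det] half_value_mod_2[of \<tau> a b]
      half_value_mod_2[of \<tau> "a + c"] mods half_diff_half_value[of \<tau>] by (auto simp: algebra_simps)
qed

text \<open>With c odd, a and a + c have opposite parity, so exactly one of the two half periods is
  1/2 modulo the lattice. The norm hides which one, and size is all that is wanted at the
  cusps.\<close>

lemma half_diff_transform_odd:
  fixes a b c d :: int
  assumes \<tau>: "Im \<tau> > 0" and det: "a * d - b * c = 1" and c: "odd c"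
  defines "j \<equiv> of_int c * \<tau> + of_int d"
  obtains s where "norm (half_diff ((of_int a * \<tau> + of_int b) / j)) = norm j ^ 2 * norm (half_value \<tau> 0 1 - half_value \<tau> 1 s)"
proof (cases "even a")
  case True
  have "odd b"
  proof
    assume "even b"
    with True have "even (a * d - b * c)" by simp
    then show False using det by simp
  qed
  then have mods: "a mod 2 = 0" "b mod 2 = 1" "(a + c) mod 2 = 1"
    using True c by (simp_all add: mod2_eq_if)
  have "norm (half_diff ((of_int a * \<tau> + of_int b) / j)) = norm j ^ 2 * norm (half_value \<tau> 0 1 - half_value \<tau> 1 ((b + d) mod 2))"
    unfolding j_def half_diff_transform[OF \<tau> det] half_value_mod_2[of \<tau> a b]
      half_value_mod_2[of \<tau> "a + c"] mods by (simp add: norm_mult norm_power)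
  then show thesis by (rule that)
next
  case False
  have "odd (b + d)"
  proof
    assume "even (b + d)"
    moreover have "even (a + c)" using False c by simp
    ultimately have "even ((a + c) * d - (b + d) * c)" by simp
    moreover have "(a + c) * d - (b + d) * c = 1" using det by (simp add: algebra_simps)
    ultimately show False by simp
  qed
  then have mods: "a mod 2 = 1" "(b + d) mod 2 = 1" "(a + c) mod 2 = 0"
    using False c by (simp_all add: mod2_eq_if)
  have "norm (half_diff ((of_int a * \<tau> + of_int b) / j)) = norm j ^ 2 * norm (half_value \<tau> 0 1 - half_value \<tau> 1 (b mod 2))"
    unfolding j_def half_diff_transform[OF \<tau> det] half_value_mod_2[of \<tau> a b]
      half_value_mod_2[of \<tau> "a + c"] mods by (simp add: norm_mult norm_power norm_minus_commute)
  then show thesis by (rule that)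
qed

section \<open>Size of the half-period values high in the half plane\<close>

lemma infsum_norm_wp_term_le:
  obtains K where "K \<ge> 0"
    "\<And>\<tau> z. \<bar>Im z\<bar> \<le> Im \<tau> / 2 \<Longrightarrow> exp (- (pi * Im \<tau>)) \<le> 1 / 2 \<Longrightarrow> Im \<tau> > 0 \<Longrightarrow>
      norm (wp \<tau> z - koebe (nome z)) \<le> K * exp (- (pi * Im \<tau>))"
proof -
  define S where "S = (\<Sum>\<^sub>\<infinity>n\<in>-{0::int}. (1 / 2 :: real) ^ nat \<bar>n\<bar>)"
  have half: "(\<lambda>n::int. (1 / 2 :: real) ^ nat \<bar>n\<bar>) summable_on A" for A
    by (rule summable_on_powr_abs_int) auto
  have S: "S \<ge> 0" unfolding S_def by (rule infsum_nonneg) simp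
  have "norm (wp \<tau> z - koebe (nome z)) \<le> (8 * S) * exp (- (pi * Im \<tau>))"
    if z: "\<bar>Im z\<bar> \<le> Im \<tau> / 2" and small: "exp (- (pi * Im \<tau>)) \<le> 1 / 2" and \<tau>: "Im \<tau> > 0" for \<tau> z
  proof -
    define \<rho> where "\<rho> = exp (- (pi * Im \<tau>))"
    have \<rho>: "0 < \<rho>" "\<rho> \<le> 1 / 2" using small by (simp_all add: \<rho>_def)
    have q: "exp (- (2 * pi * Im \<tau>)) = \<rho> ^ 2"
      unfolding \<rho>_def power2_eq_square by (simp flip: exp_add)
    have B: "exp (2 * pi * (Im \<tau> / 2)) = inverse \<rho>" by (simp add: \<rho>_def exp_minus)
    \<comment> \<open>One power of \<rho> is kept as decay in \<tau>; the remaining powers are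
      weakened to powers of 1/2, so that the sum over n does not depend on \<tau>.\<close>
    have le: "exp (2 * pi * (Im \<tau> / 2)) * exp (- (2 * pi * Im \<tau>)) ^ nat \<bar>n\<bar> \<le> \<rho> * (2 * (1 / 2) ^ nat \<bar>n\<bar>)"
      if n: "n \<in> -{0}" for n :: int
    proof -
      obtain k where k: "nat \<bar>n\<bar> = Suc k" using n by (cases "nat \<bar>n\<bar>") auto
      have "(\<rho> ^ 2) ^ k \<le> (1 / 2) ^ k"
      proof (rule power_mono)
        have "\<rho> ^ 2 \<le> (1 / 2) * 1" unfolding power2_eq_square using \<rho> by (intro mult_mono) auto
        then show "\<rho> ^ 2 \<le> 1 / 2" by simp
      qed simp
      then have "\<rho> * (\<rho> ^ 2) ^ k \<le> \<rho> * (1 / 2) ^ k" using \<rho> by simp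
      moreover have "inverse \<rho> * (\<rho> ^ 2) ^ Suc k = \<rho> * (\<rho> ^ 2) ^ k"
        using \<rho> by (simp add: power2_eq_square field_simps)
      moreover have "\<rho> * (2 * (1 / 2) ^ Suc k) = \<rho> * (1 / 2) ^ k" by simp
      ultimately show ?thesis unfolding B q k by (simp only:)
    qed
    have term_le: "norm (wp_term \<tau> z n) \<le> 8 * \<rho> * (1 / 2) ^ nat \<bar>n\<bar>" if n: "n \<in> -{0}" for n :: int
    proof -
      have "(1 / 2 :: real) ^ nat \<bar>n\<bar> \<le> 1 / 2"
        using n power_decreasing[of 1 "nat \<bar>n\<bar>" "1 / 2 :: real"] by simp
      then have "\<rho> * (2 * (1 / 2) ^ nat \<bar>n\<bar>) \<le> (1 / 2) * 1"
        using \<rho> by (intro mult_mono) auto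
      then have "exp (2 * pi * (Im \<tau> / 2)) * exp (- (2 * pi * Im \<tau>)) ^ nat \<bar>n\<bar> \<le> 1 / 2"
        using le[OF n] by linarith
      from norm_wp_term_le[OF \<tau> z this] le[OF n] show ?thesis by simp
    qed
    have "wp \<tau> z = (\<Sum>\<^sub>\<infinity>n\<in>{0} \<union> -{0}. wp_term \<tau> z n)" by (simp add: wp_def)
    also have "\<dots> = (\<Sum>\<^sub>\<infinity>n\<in>{0}. wp_term \<tau> z n) + (\<Sum>\<^sub>\<infinity>n\<in>-{0}. wp_term \<tau> z n)"
      by (rule infsum_Un_disjoint) (auto intro: wp_term_summable[OF \<tau>])
    finally have "wp \<tau> z - koebe (nome z) = (\<Sum>\<^sub>\<infinity>n\<in>-{0}. wp_term \<tau> z n)" by (simp add: wp_term_def)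
    also have "norm \<dots> \<le> (\<Sum>\<^sub>\<infinity>n\<in>-{0}. 8 * \<rho> * (1 / 2) ^ nat \<bar>n\<bar>)"
      by (rule norm_infsum_le[OF has_sum_infsum has_sum_infsum])
         (auto intro: wp_term_summable[OF \<tau>] summable_on_cmult_right half term_le)
    also have "\<dots> = 8 * \<rho> * S" unfolding S_def by (rule infsum_cmult_right) (rule half)
    finally show ?thesis by (simp add: \<rho>_def mult_ac)
  qed
  then show thesis using that[of "8 * S"] S by simp
qed

lemma exp_minus_pi_le: "y > 0 \<Longrightarrow> exp (- (pi * y)) \<le> 1 / y"
proof -
  assume y: "y > 0"
  have "y \<le> pi * y" using y pi_gt3 by simp
  also have "\<dots> \<le> exp (pi * y)" using exp_ge_add_one_self[of "pi * y"] by linarith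
  finally show ?thesis using y by (simp add: exp_minus field_simps)
qed

lemma half_value_limits:
  obtains Y0 where "Y0 > 0"
    and "\<And>\<tau>. Im \<tau> > Y0 \<Longrightarrow> norm (half_value \<tau> 0 1 + 1 / 4) \<le> 1 / 16"
    and "\<And>\<tau> s. Im \<tau> > Y0 \<Longrightarrow> norm (half_value \<tau> 1 s) \<le> 1 / 16"
proof -
  obtain K where K: "K \<ge> 0" "\<And>\<tau> z. \<bar>Im z\<bar> \<le> Im \<tau> / 2 \<Longrightarrow> exp (- (pi * Im \<tau>)) \<le> 1 / 2 \<Longrightarrow> Im \<tau> > 0 \<Longrightarrow>
      norm (wp \<tau> z - koebe (nome z)) \<le> K * exp (- (pi * Im \<tau>))"
    using infsum_norm_wp_term_le by blast
  \<comment> \<open>K comes from the rows other than 0 and 4 from \<open>norm_koebe_le\<close>; with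
    exp(-pi y) at most 1/y this gives 1/16. The limits are -1/4, the value of \<open>koebe\<close>
    at -1, and 0.\<close>
  define Y0 where "Y0 = 16 * (K + 4)"
  have Y0: "Y0 > 0" using K(1) by (simp add: Y0_def)
  have small: "exp (- (pi * Im \<tau>)) \<le> 1 / 2" "(K + 4) * exp (- (pi * Im \<tau>)) \<le> 1 / 16" "Im \<tau> > 0"
    if "Im \<tau> > Y0" for \<tau>
  proof -
    show pos: "Im \<tau> > 0" using that Y0 by linarith
    have le: "exp (- (pi * Im \<tau>)) \<le> 1 / Y0"
    proof -
      have "1 / Im \<tau> \<le> 1 / Y0" using that Y0 by (intro divide_left_mono) auto
      then show ?thesis using exp_minus_pi_le[OF pos] by linarith
    qed
    have "1 / Y0 \<le> 1 / 2" using K(1) by (simp add: Y0_def field_simps)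
    then show "exp (- (pi * Im \<tau>)) \<le> 1 / 2" using le by linarith
    have "(K + 4) * exp (- (pi * Im \<tau>)) \<le> (K + 4) * (1 / Y0)" using le K(1) by (intro mult_left_mono) auto
    moreover have "(K + 4) * (1 / Y0) = 1 / 16" using K(1) by (simp add: Y0_def field_simps)
    ultimately show "(K + 4) * exp (- (pi * Im \<tau>)) \<le> 1 / 16" by linarith
  qed
  have 1: "norm (half_value \<tau> 0 1 + 1 / 4) \<le> 1 / 16" if "Im \<tau> > Y0" for \<tau>
  proof -
    have "nome (1 / 2) = - 1" by (simp add: nome_def mult.commute)
    then have "koebe (nome (1 / 2)) = - 1 / 4" by (simp add: koebe_def power2_eq_square)
    moreover have "norm (wp \<tau> (1 / 2) - koebe (nome (1 / 2))) \<le> K * exp (- (pi * Im \<tau>))"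
      by (rule K) (use small[OF that] in auto)
    ultimately have "norm (half_value \<tau> 0 1 + 1 / 4) \<le> K * exp (- (pi * Im \<tau>))"
      by (simp add: half_value_def)
    also have "\<dots> \<le> (K + 4) * exp (- (pi * Im \<tau>))" by (intro mult_right_mono) auto
    finally show ?thesis using small[OF that] by linarith
  qed
  have 2: "norm (half_value \<tau> 1 s) \<le> 1 / 16" if "Im \<tau> > Y0" for \<tau> s
  proof -
    let ?z = "(\<tau> + of_int s) / 2"
    have nz: "norm (nome ?z) = exp (- (pi * Im \<tau>))" by (simp add: norm_nome)
    have "norm (koebe (nome ?z)) \<le> 4 * exp (- (pi * Im \<tau>))"
      using norm_koebe_le[of "nome ?z"] small(1)[OF that] unfolding nz by simp
    moreover have "norm (wp \<tau> ?z - koebe (nome ?z)) \<le> K * exp (- (pi * Im \<tau>))"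
      by (rule K) (use small[OF that] in auto)
    moreover have "norm (wp \<tau> ?z) \<le> norm (wp \<tau> ?z - koebe (nome ?z)) + norm (koebe (nome ?z))"
      using norm_triangle_ineq[of "wp \<tau> ?z - koebe (nome ?z)" "koebe (nome ?z)"] by simp
    ultimately have "norm (half_value \<tau> 1 s) \<le> (K + 4) * exp (- (pi * Im \<tau>))"
      by (simp add: half_value_def distrib_right)
    then show ?thesis using small[OF that] by linarith
  qed
  show thesis by (rule that[OF Y0 1 2])
qed

lemma Yc_limit:
  obtains Y0 where "Y0 > 0" and "\<And>\<tau>. Im \<tau> > Y0 \<Longrightarrow> norm (Yc (nome \<tau>)) \<le> 3 / 2"
    and "\<And>\<tau>. Im \<tau> > Y0 \<Longrightarrow> norm (Yc (nome \<tau>)) \<ge> 1 / 2"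
proof -
  have "isCont Yc 0"
    using holomorphic_on_imp_continuous_on[OF Yc_holomorphic] by (simp add: continuous_on_eq_continuous_at)
  then obtain \<epsilon> where \<epsilon>: "\<epsilon> > 0" "\<And>w. norm w < \<epsilon> \<Longrightarrow> norm (Yc w - 1) < 1 / 2"
    unfolding continuous_at_eps_delta by (auto simp: Yc_0 dist_norm dest!: spec[of _ "1 / 2 :: real"])
  have near: "norm (Yc (nome \<tau>) - 1) < 1 / 2" if "Im \<tau> > 1 / \<epsilon>" for \<tau>
  proof (rule \<epsilon>(2))
    have pos: "Im \<tau> > 0" using that \<epsilon>(1) by (meson less_trans zero_less_divide_1_iff)
    have "norm (nome \<tau>) = exp (- (pi * (2 * Im \<tau>)))" by (simp add: norm_nome mult_ac)
    also have "\<dots> \<le> 1 / (2 * Im \<tau>)" using pos by (intro exp_minus_pi_le) simp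
    also have "\<dots> < \<epsilon>" using that pos \<epsilon>(1) by (simp add: field_simps)
    finally show "norm (nome \<tau>) < \<epsilon>" .
  qed
  show thesis
  proof (rule that)
    show "1 / \<epsilon> > 0" using \<epsilon>(1) by simp
    fix \<tau> assume \<tau>: "Im \<tau> > 1 / \<epsilon>"
    show "norm (Yc (nome \<tau>)) \<le> 3 / 2"
      using near[OF \<tau>] norm_triangle_ineq[of "Yc (nome \<tau>) - 1" 1] by simp
    show "norm (Yc (nome \<tau>)) \<ge> 1 / 2"
      using near[OF \<tau>] norm_triangle_ineq[of "1 - Yc (nome \<tau>)" "Yc (nome \<tau>)"] by (simp add: norm_minus_commute)
  qed
qed

text \<open>Classically the eta quotient
  \<open>eta(2t)^8 eta(3t)^4 / (eta(t)^4 eta(6t)^8)\<close>.\<close>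

definition psi :: "complex \<Rightarrow> complex" where
  "psi \<tau> = half_diff \<tau> / half_diff (3 * \<tau>)"

definition psi_disc :: "complex \<Rightarrow> complex" where
  "psi_disc w = Yc w / Yc (w ^ 3) / w"

lemma psi_eq: "Im \<tau> > 0 \<Longrightarrow> psi \<tau> = psi_disc (nome \<tau>)"
proof -
  assume \<tau>: "Im \<tau> > 0"
  have 3: "nome (3 * z) = nome z ^ 3" for z using nome_of_nat_mult[of 3 z] by simp
  have 2: "nome (\<tau> / 2) ^ 2 = nome \<tau>" using nome_of_nat_mult[of 2 "\<tau> / 2"] by simp
  have "half_diff (3 * \<tau>) = 4 * nome (3 * (\<tau> / 2)) * Yc (nome (3 * \<tau>))"
    using half_diff_eq[of "3 * \<tau>"] \<tau> by simp
  also have "\<dots> = 4 * (nome \<tau> * nome (\<tau> / 2)) * Yc (nome \<tau> ^ 3)"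
    unfolding 3 by (simp add: power3_eq_cube power2_eq_square flip: 2)
  finally show ?thesis
    unfolding psi_def psi_disc_def by (subst half_diff_eq[OF \<tau>]) (simp add: field_simps)
qed

lemma Yc3_nonzero: "norm w < 1 \<Longrightarrow> Yc (w ^ 3) \<noteq> 0"
  by (intro Yc_nonzero) (simp add: norm_power power_less_one_iff)

lemma psi_disc_holomorphic: "psi_disc holomorphic_on ball 0 1 - {0}"
proof -
  have Y: "Yc holomorphic_on ball 0 1 - {0}" by (rule holomorphic_on_subset[OF Yc_holomorphic]) auto
  have "Yc \<circ> (\<lambda>w. w ^ 3) holomorphic_on ball 0 1 - {0}"
    by (rule holomorphic_on_compose_gen[OF _ Yc_holomorphic])
       (auto intro!: holomorphic_intros simp: norm_power power_less_one_iff)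
  then show ?thesis unfolding psi_disc_def[abs_def] o_def using Y Yc3_nonzero
    by (intro holomorphic_on_divide) (auto intro!: holomorphic_intros)
qed

text \<open>For both \<open>\<tau>\<close> and \<open>3 \<tau>\<close> the parity of the upper right entry decides the sign, so the signs cancel.\<close>

lemma psi_invariant:
  fixes a b c d :: int
  assumes \<tau>: "Im \<tau> > 0" and det: "a * d - b * c = 1" and c: "6 dvd c"
  shows "psi ((of_int a * \<tau> + of_int b) / (of_int c * \<tau> + of_int d)) = psi \<tau>"
proof -
  obtain c' where c': "c = 6 * c'" using c by (elim dvdE)
  let ?j = "of_int c * \<tau> + of_int d"
  have j: "?j \<noteq> 0" by (rule wp_transform(1)[OF \<tau> det])
  have 1: "half_diff ((of_int a * \<tau> + of_int b) / ?j) = (if even b then 1 else - 1) * ?j ^ 2 * half_diff \<tau>"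
    by (rule half_diff_transform_even[OF \<tau> det]) (simp add: c')
  have \<tau>3: "Im (3 * \<tau>) > 0" using \<tau> by simp
  \<comment> \<open>Conjugation by diag(3, 1): the matrix with rows (a, 3b) and (c/3, d) acts on
    3\<tau>, and c/3 = 2c' is still even.\<close>
  have det3: "a * d - (3 * b) * (2 * c') = 1" using det c' by simp
  have h: "half_diff ((of_int a * (3 * \<tau>) + of_int (3 * b)) / (of_int (2 * c') * (3 * \<tau>) + of_int d))
      = (if even (3 * b) then 1 else - 1) * (of_int (2 * c') * (3 * \<tau>) + of_int d) ^ 2 * half_diff (3 * \<tau>)"
    by (rule half_diff_transform_even[OF \<tau>3 det3]) simp
  have e1: "of_int (2 * c') * (3 * \<tau>) + of_int d = ?j" by (simp add: c')
  have e2: "(of_int a * (3 * \<tau>) + of_int (3 * b)) / ?j = 3 * ((of_int a * \<tau> + of_int b) / ?j)"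
    by (simp add: algebra_simps)
  have "even (3 * b) \<longleftrightarrow> even b" by simp
  then have 2: "half_diff (3 * ((of_int a * \<tau> + of_int b) / ?j))
      = (if even b then 1 else - 1) * ?j ^ 2 * half_diff (3 * \<tau>)" using h unfolding e1 e2 by (simp only:)
  show ?thesis unfolding psi_def 1 2 using j by simp
qed

text \<open>The cases follow gcd(c, 6). For odd c numerator and denominator of \<open>psi\<close>,
  freed of their weight factors, stay near 1/4 in absolute value; for even c prime to 3 both decay,
  the numerator faster.\<close>

lemma psi_bounded_at_cusp:
  fixes a b c d :: int
  assumes det: "a * d - b * c = 1" and c: "\<not> 6 dvd c"
  obtains Y0 B where "Y0 > 0"
    and "\<And>\<tau>. Im \<tau> > Y0 \<Longrightarrow> norm (psi ((of_int a * \<tau> + of_int b) / (of_int c * \<tau> + of_int d))) \<le> B"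
proof -
  obtain Y1 where Y1: "Y1 > 0" "\<And>\<tau>. Im \<tau> > Y1 \<Longrightarrow> norm (half_value \<tau> 0 1 + 1 / 4) \<le> 1 / 16"
    "\<And>\<tau> s. Im \<tau> > Y1 \<Longrightarrow> norm (half_value \<tau> 1 s) \<le> 1 / 16" by (rule half_value_limits) metis
  obtain Y2 where Y2: "Y2 > 0" "\<And>\<tau>. Im \<tau> > Y2 \<Longrightarrow> norm (Yc (nome \<tau>)) \<le> 3 / 2"
    "\<And>\<tau>. Im \<tau> > Y2 \<Longrightarrow> norm (Yc (nome \<tau>)) \<ge> 1 / 2" by (rule Yc_limit) metis
  have diff: "norm (half_value \<tau> 0 1 - half_value \<tau> 1 s) \<le> 3 / 8" "norm (half_value \<tau> 0 1 - half_value \<tau> 1 s) \<ge> 1 / 8"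
    if "Im \<tau> > Y1" for \<tau> s
  proof -
    let ?x = "half_value \<tau> 0 1" and ?y = "half_value \<tau> 1 s"
    have x: "norm (?x + 1 / 4) \<le> 1 / 16" and y: "norm ?y \<le> 1 / 16" using Y1 that by auto
    have "norm (?x - ?y) \<le> norm (?x + 1 / 4) + norm (?y + 1 / 4)"
      using norm_triangle_ineq4[of "?x + 1 / 4" "?y + 1 / 4"] by simp
    moreover have "norm (?y + 1 / 4) \<le> norm ?y + 1 / 4" using norm_triangle_ineq[of ?y "1 / 4"] by simp
    ultimately show "norm (?x - ?y) \<le> 3 / 8" using x y by linarith
    have "1 / 4 = norm ((?x + 1 / 4) - ?y - (?x - ?y))" by simp
    also have "\<dots> \<le> norm ((?x + 1 / 4) - ?y) + norm (?x - ?y)" by (rule norm_triangle_ineq4)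
    finally show "norm (?x - ?y) \<ge> 1 / 8"
      using norm_triangle_ineq4[of "?x + 1 / 4" ?y] x y by linarith
  qed
  \<comment> \<open>The factor 3 makes the estimates valid at (\<tau> + \<beta>)/3 as well.\<close>
  define Y0 where "Y0 = 3 * max Y1 Y2"
  have Y0: "Y0 > 0" using Y1(1) by (simp add: Y0_def)
  have "norm (psi ((of_int a * \<tau> + of_int b) / (of_int c * \<tau> + of_int d))) \<le> 27" if Y: "Im \<tau> > Y0" for \<tau>
  proof -
    have \<tau>: "Im \<tau> > 0" and \<tau>1: "Im \<tau> > Y1" and \<tau>2: "Im \<tau> > Y2" and \<tau>3: "Im \<tau> > 3 * Y1" "Im \<tau> > 3 * Y2"
      using Y Y0 Y1(1) Y2(1) by (auto simp: Y0_def)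
    let ?j = "of_int c * \<tau> + of_int d" and ?A = "(of_int a * \<tau> + of_int b) / (of_int c * \<tau> + of_int d)"
    have j: "?j \<noteq> 0" by (rule wp_transform(1)[OF \<tau> det])
    have ratio: "x / y \<le> 3" if "x \<le> 3 / 8" "y \<ge> 1 / 8" for x y :: real
      using that by (simp add: divide_le_eq)
    have ratio_9: "J ^ 2 * x / ((J / 3) ^ 2 * y) = 9 * (x / y)" if "J \<noteq> 0" for J x y :: real
      using that by (simp add: power_divide)
    show ?thesis
    proof (cases "3 dvd c")
      case True
      then obtain c' where c': "c = 3 * c'" by (elim dvdE)
      have "odd c" using c True by presburger
      then have "odd c'" using c' by simp
      obtain s where s: "norm (half_diff ?A) = norm ?j ^ 2 * norm (half_value \<tau> 0 1 - half_value \<tau> 1 s)"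
        by (rule half_diff_transform_odd[OF \<tau> det \<open>odd c\<close>])
      have "Im (3 * \<tau>) > 0" "a * d - (3 * b) * c' = 1" using \<tau> det c' by simp_all
      then obtain s' where h: "norm (half_diff ((of_int a * (3 * \<tau>) + of_int (3 * b)) / (of_int c' * (3 * \<tau>) + of_int d)))
          = norm (of_int c' * (3 * \<tau>) + of_int d) ^ 2 * norm (half_value (3 * \<tau>) 0 1 - half_value (3 * \<tau>) 1 s')"
        using half_diff_transform_odd \<open>odd c'\<close> by blast
      have e1: "of_int c' * (3 * \<tau>) + of_int d = ?j" by (simp add: c')
      have e2: "(of_int a * (3 * \<tau>) + of_int (3 * b)) / ?j = 3 * ?A" by (simp add: algebra_simps)
      note s' = h[unfolded e1 e2]
      have "norm (psi ?A) = norm (half_value \<tau> 0 1 - half_value \<tau> 1 s) / norm (half_value (3 * \<tau>) 0 1 - half_value (3 * \<tau>) 1 s')"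
        unfolding psi_def norm_divide s s' using j by simp
      also have "\<dots> \<le> 3" using \<tau>1 \<tau> by (intro ratio diff) auto
      finally show ?thesis by simp
    next
      case False
      \<comment> \<open>If 3 does not divide c, then diag(3, 1) times the matrix is a matrix of
        determinant 1 times the one with rows (1, \<beta>) and (0, 3). Integrality needs 3 to divide
        d - c\<beta>, and c^2 = 1 mod 3 suggests this choice. The denominator becomes j/3, whence
        the factor 9.\<close>
      define \<beta> where "\<beta> = c * d"
      have "3 dvd d - c * \<beta>"
      proof -
        have "c mod 3 = 1 \<or> c mod 3 = 2" using False by presburger
        then have "3 dvd 1 - c * c"
        proof
          assume "c mod 3 = 1"
          then obtain k where "c = 3 * k + 1" by (metis mult_div_mod_eq)
          then have "1 - c * c = 3 * (- 3 * k * k - 2 * k)" by (simp add: algebra_simps)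
          then show ?thesis by (rule dvdI)
        next
          assume "c mod 3 = 2"
          then obtain k where "c = 3 * k + 2" by (metis mult_div_mod_eq)
          then have "1 - c * c = 3 * (- 3 * k * k - 4 * k - 1)" by (simp add: algebra_simps)
          then show ?thesis by (rule dvdI)
        qed
        moreover have "d - c * \<beta> = (1 - c * c) * d" by (simp add: \<beta>_def algebra_simps)
        ultimately show ?thesis by simp
      qed
      then obtain v where v: "d - c * \<beta> = 3 * v" by (elim dvdE)
      define \<tau>' where "\<tau>' = (\<tau> + of_int \<beta>) / 3"
      have \<tau>': "Im \<tau>' = Im \<tau> / 3" by (simp add: \<tau>'_def)
      have \<tau>'_pos: "Im \<tau>' > 0" using \<tau> \<tau>' by simp
      have det': "(3 * a) * v - (b - a * \<beta>) * c = 1"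
      proof -
        have "(3 * a) * v = a * (d - c * \<beta>)" by (simp add: v)
        then show ?thesis using det by (simp add: algebra_simps)
      qed
      have d: "d = 3 * v + c * \<beta>" using v by simp
      have j': "of_int c * \<tau>' + of_int v = ?j / 3" by (simp add: \<tau>'_def d field_simps)
      have A': "(of_int (3 * a) * \<tau>' + of_int (b - a * \<beta>)) / (of_int c * \<tau>' + of_int v) = 3 * ?A"
      proof -
        have num: "of_int (3 * a) * \<tau>' + of_int (b - a * \<beta>) = of_int a * \<tau> + of_int b"
          by (simp add: \<tau>'_def field_simps)
        show ?thesis unfolding j' num by simp
      qed
      show ?thesis
      proof (cases "odd c")
        case True
        obtain s where s: "norm (half_diff ?A) = norm ?j ^ 2 * norm (half_value \<tau> 0 1 - half_value \<tau> 1 s)"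
          by (rule half_diff_transform_odd[OF \<tau> det True])
        obtain s' where h: "norm (half_diff ((of_int (3 * a) * \<tau>' + of_int (b - a * \<beta>)) / (of_int c * \<tau>' + of_int v)))
            = norm (of_int c * \<tau>' + of_int v) ^ 2 * norm (half_value \<tau>' 0 1 - half_value \<tau>' 1 s')"
          by (rule half_diff_transform_odd[OF \<tau>'_pos det' True])
        note s' = h[unfolded A', unfolded j']
        have "norm (psi ?A) = 9 * (norm (half_value \<tau> 0 1 - half_value \<tau> 1 s) / norm (half_value \<tau>' 0 1 - half_value \<tau>' 1 s'))"
          unfolding psi_def norm_divide s s' norm_numeral by (rule ratio_9) (use j in simp)
        also have "\<dots> \<le> 9 * 3" using \<tau>1 \<tau>3 \<tau>' by (intro mult_left_mono ratio diff) auto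
        finally show ?thesis by simp
      next
        case False
        then have "even c" by simp
        have 1: "norm (half_diff ?A) = norm ?j ^ 2 * norm (half_diff \<tau>)"
          unfolding half_diff_transform_even[OF \<tau> det \<open>even c\<close>] by (simp add: norm_mult norm_power)
        have 3: "norm (half_diff (3 * ?A)) = norm (?j / 3) ^ 2 * norm (half_diff \<tau>')"
          using half_diff_transform_even[OF \<tau>'_pos det' \<open>even c\<close>] unfolding A' unfolding j'
          by (simp add: norm_mult norm_power)
        have "norm (psi ?A) = 9 * (norm (half_diff \<tau>) / norm (half_diff \<tau>'))"
          unfolding psi_def norm_divide 1 3 norm_numeral by (rule ratio_9) (use j in simp)
        \<comment> \<open>Both values are close to multiples of their nomes at half argument; Im
          \<tau>' = Im \<tau> / 3 makes the denominator decay more slowly.\<close>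
        also have "norm (half_diff \<tau>) / norm (half_diff \<tau>') \<le> 3"
        proof -
          have "norm (half_diff \<tau>) = 4 * norm (nome (\<tau> / 2)) * norm (Yc (nome \<tau>))"
            by (simp add: half_diff_eq[OF \<tau>] norm_mult)
          also have "\<dots> \<le> 4 * norm (nome (\<tau> / 2)) * (3 / 2)" using Y2 \<tau>2 by (intro mult_left_mono) auto
          also have "norm (nome (\<tau> / 2)) \<le> norm (nome (\<tau>' / 2))" using \<tau> \<tau>' by (simp add: norm_nome)
          finally have 4: "norm (half_diff \<tau>) \<le> 6 * norm (nome (\<tau>' / 2))" by simp
          have "norm (half_diff \<tau>') = 4 * norm (nome (\<tau>' / 2)) * norm (Yc (nome \<tau>'))"
            by (simp add: half_diff_eq[OF \<tau>'_pos] norm_mult)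
          moreover have "\<dots> \<ge> 4 * norm (nome (\<tau>' / 2)) * (1 / 2)"
            using Y2 \<tau>3 \<tau>' by (intro mult_left_mono) auto
          ultimately have "norm (half_diff \<tau>') \<ge> 2 * norm (nome (\<tau>' / 2))" by simp
          moreover have "norm (nome (\<tau>' / 2)) > 0" by simp
          ultimately show ?thesis using 4 by (subst divide_le_eq) auto
        qed
        finally show ?thesis by simp
      qed
    qed
  qed
  then show thesis using that Y0 by blast
qed

unbundle no fps_syntax
unbundle vec_syntax

definition complex_fls :: "int fls \<Rightarrow> complex fls" where
  "complex_fls F = Abs_fls (\<lambda>n. of_int (fls_nth F n))"

lemma complex_fls_nth [simp]: "fls_nth (complex_fls F) n = of_int (fls_nth F n)"
  unfolding complex_fls_def by (rule nth_Abs_fls_lower_bound[of "fls_subdegree F"]) simp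

lemma complex_fls_const: "complex_fls (fls_const c) = fls_const (of_int c)"
  by (rule fls_eqI) simp

lemma complex_fls_add: "complex_fls (F + G) = complex_fls F + complex_fls G"
  by (rule fls_eqI) simp

lemma complex_fls_mult: "complex_fls (F * G) = complex_fls F * complex_fls G"
proof (rule fls_eqI)
  fix n
  show "fls_nth (complex_fls (F * G)) n = fls_nth (complex_fls F * complex_fls G) n"
    by (subst fls_mult_nth_bounded[where N = "fls_subdegree F" and N' = "fls_subdegree G"])
       (auto simp: fls_times_nth(2))
qed

lemma psi_disc_expansion: "psi_disc has_laurent_expansion complex_fls Psi"
proof -
  have "(\<lambda>w::complex. w ^ 3) has_fps_expansion fps_X ^ 3"
    by (intro fps_expansion_intros)
  then have "(Yc \<circ> (\<lambda>w. w ^ 3)) has_fps_expansion (complex_fps Y oo fps_X ^ 3)"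
    by (intro has_fps_expansion_compose Yc_expansion) simp_all
  also have "complex_fps Y oo fps_X ^ 3 = complex_fps Y3"
    by (rule fps_ext) (simp add: fps_nth_compose_X_power Y3_nth)
  finally have "(\<lambda>w. Yc (w ^ 3)) has_fps_expansion complex_fps Y3" by (simp add: o_def)
  then have "(\<lambda>w. Yc w / Yc (w ^ 3)) has_fps_expansion complex_fps Y / complex_fps Y3"
    by (intro has_fps_expansion_divide' Yc_expansion) (simp_all add: Y3_0)
  also have "complex_fps Y / complex_fps Y3 = complex_fps T"
  proof -
    have "complex_fps Y3 * complex_fps T = complex_fps Y"
      by (simp add: Y3_mult_T flip: complex_fps_mult)
    moreover have "complex_fps Y3 \<noteq> 0" using Y3_0 by (metis complex_fps_nth fps_zero_nth of_int_1 zero_neq_one)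
    ultimately show ?thesis by (metis nonzero_mult_div_cancel_left)
  qed
  finally have "(\<lambda>w. inverse w * (Yc w / Yc (w ^ 3))) has_laurent_expansion fls_X_inv * fps_to_fls (complex_fps T)"
    by (intro has_laurent_expansion_mult has_laurent_expansion_fps has_laurent_expansion_fls_X_inv)
  also have "(\<lambda>w. inverse w * (Yc w / Yc (w ^ 3))) = psi_disc"
    by (auto simp: psi_disc_def fun_eq_iff field_simps)
  also have "fls_X_inv * fps_to_fls (complex_fps T) = complex_fls Psi"
    by (rule fls_eqI) (simp add: Psi_def fls_X_inv_times_conv_shift)
  finally show ?thesis .
qed

section \<open>Modular functions of level six\<close>

definition mat2 :: "int \<Rightarrow> int \<Rightarrow> int \<Rightarrow> int \<Rightarrow> int^2^2" where
  "mat2 a b c d = vector [vector [a, b], vector [c, d]]"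

lemma mat2_nth [simp]:
  "mat2 a b c d $ 1 $ 1 = a" "mat2 a b c d $ 1 $ 2 = b"
  "mat2 a b c d $ 2 $ 1 = c" "mat2 a b c d $ 2 $ 2 = d"
  by (simp_all add: mat2_def)

lemma SL2Z_iff: "A \<in> SL2Z \<longleftrightarrow> A $ 1 $ 1 * A $ 2 $ 2 - A $ 1 $ 2 * A $ 2 $ 1 = 1"
  by (simp add: SL2Z_def det_2)

lemma moebius_mat2: "moebius (mat2 a b c d) z = (of_int a * z + of_int b) / (of_int c * z + of_int d)"
  by (simp add: moebius_def)

lemma SL2Z_mult: "A \<in> SL2Z \<Longrightarrow> B \<in> SL2Z \<Longrightarrow> A ** B \<in> SL2Z"
  by (simp add: SL2Z_def det_mul)

lemma moebius_denominator_nonzero: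
  "A \<in> SL2Z \<Longrightarrow> Im z > 0 \<Longrightarrow> of_int (A $ 2 $ 1) * z + of_int (A $ 2 $ 2) \<noteq> 0"
  using wp_transform(1)[of z "A $ 1 $ 1" "A $ 2 $ 2" "A $ 1 $ 2" "A $ 2 $ 1"] by (simp add: SL2Z_iff)

lemma Im_moebius_pos: "A \<in> SL2Z \<Longrightarrow> Im z > 0 \<Longrightarrow> Im (moebius A z) > 0"
  using wp_transform(2)[of z "A $ 1 $ 1" "A $ 2 $ 2" "A $ 1 $ 2" "A $ 2 $ 1"]
  by (simp add: SL2Z_iff moebius_def)

lemma moebius_mult:
  assumes A: "A \<in> SL2Z" and B: "B \<in> SL2Z" and z: "Im z > 0"
  shows "moebius (A ** B) z = moebius A (moebius B z)"
proof -
  let ?j = "of_int (B $ 2 $ 1) * z + of_int (B $ 2 $ 2)"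
  have j: "?j \<noteq> 0" by (rule moebius_denominator_nonzero[OF B z])
  have "moebius A (moebius B z) =
      (of_int (A $ 1 $ 1) * moebius B z + of_int (A $ 1 $ 2)) * ?j / ((of_int (A $ 2 $ 1) * moebius B z + of_int (A $ 2 $ 2)) * ?j)"
    using j by (simp add: moebius_def[of A])
  moreover have "(of_int x * moebius B z + of_int y) * ?j =
      of_int (x * B $ 1 $ 1 + y * B $ 2 $ 1) * z + of_int (x * B $ 1 $ 2 + y * B $ 2 $ 2)" for x y
  proof -
    have "(of_int x * moebius B z + of_int y) * ?j = of_int x * (of_int (B $ 1 $ 1) * z + of_int (B $ 1 $ 2)) + of_int y * ?j"
      using j by (simp add: moebius_def distrib_right)
    then show ?thesis by (simp add: algebra_simps)
  qed
  moreover have "(A ** B) $ i $ k = A $ i $ 1 * B $ 1 $ k + A $ i $ 2 * B $ 2 $ k" for i k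
    by (simp add: matrix_matrix_mult_def sum_2)
  ultimately show ?thesis by (simp only: moebius_def[of "A ** B"])
qed

definition adj2 :: "int^2^2 \<Rightarrow> int^2^2" where
  "adj2 A = mat2 (A $ 2 $ 2) (- (A $ 1 $ 2)) (- (A $ 2 $ 1)) (A $ 1 $ 1)"

lemma adj2_SL2Z: "A \<in> SL2Z \<Longrightarrow> adj2 A \<in> SL2Z"
  by (simp add: SL2Z_iff adj2_def algebra_simps)

lemma adj2_mult: "A \<in> SL2Z \<Longrightarrow> adj2 A ** A = mat 1"
  by (auto simp: SL2Z_iff adj2_def vec_eq_iff forall_2 matrix_matrix_mult_def sum_2 mat_def algebra_simps)

lemma mult_adj2: "A \<in> SL2Z \<Longrightarrow> A ** adj2 A = mat 1"
  by (auto simp: SL2Z_iff adj2_def vec_eq_iff forall_2 matrix_matrix_mult_def sum_2 mat_def algebra_simps)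

lemma moebius_1: "moebius (mat 1) z = z"
  by (simp add: moebius_def mat_def)

lemma mat_1_SL2Z: "mat 1 \<in> SL2Z"
  by (simp add: SL2Z_def)

lemma moebius_adj2: "A \<in> SL2Z \<Longrightarrow> Im z > 0 \<Longrightarrow> moebius (adj2 A) (moebius A z) = z"
  using moebius_mult[of "adj2 A" A z] by (simp add: adj2_SL2Z adj2_mult moebius_1)

lemma moebius_adj2': "A \<in> SL2Z \<Longrightarrow> Im z > 0 \<Longrightarrow> moebius A (moebius (adj2 A) z) = z"
  using moebius_mult[of A "adj2 A" z] by (simp add: adj2_SL2Z mult_adj2 moebius_1)

lemma moebius_holomorphic: "A \<in> SL2Z \<Longrightarrow> moebius A holomorphic_on upper_half_plane"
  unfolding moebius_def[abs_def] by (intro holomorphic_intros) (use moebius_denominator_nonzero in auto)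

text \<open>Each step of the Euclidean algorithm at least doubles the imaginary part while it is below \<open>1/2\<close>.\<close>

lemma SL2Z_reduce:
  assumes "Im z > 0" obtains A where "A \<in> SL2Z" "Im (moebius A z) \<ge> 1 / 2"
proof -
  have "\<exists>A\<in>SL2Z. Im (moebius A z) \<ge> 1 / 2" if "Im z > 0" "Im z * 2 ^ N \<ge> 1 / 2" for z N
    using that
  proof (induction N arbitrary: z)
    case 0
    then show ?case by (intro bexI[of _ "mat 1"]) (auto simp: moebius_1 mat_1_SL2Z)
  next
    case (Suc N)
    show ?case
    proof (cases "Im z \<ge> 1 / 2")
      case True
      then show ?thesis by (intro bexI[of _ "mat 1"]) (auto simp: moebius_1 mat_1_SL2Z)
    next
      case False
      define n where "n = round (Re z)"
      define S where "S = mat2 0 (- 1) 1 (- n)"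
      have S: "S \<in> SL2Z" by (simp add: S_def SL2Z_iff)
      define w where "w = z - of_int n"
      \<comment> \<open>Rounding the real part and Im z < 1/2 bound the squared norm of w by 1/4 +
        1/4; inversion divides the imaginary part by it.\<close>
      have "\<bar>Re w\<bar> \<le> 1 / 2" using of_int_round_abs_le[of "Re z"] by (simp add: w_def n_def abs_minus_commute)
      then have "(Re w) ^ 2 \<le> (1 / 2) ^ 2" by (metis abs_le_square_iff abs_of_nonneg zero_le_divide_1_iff zero_le_numeral)
      moreover have "Im w = Im z" by (simp add: w_def)
      then have "(Im w) ^ 2 \<le> (1 / 2) ^ 2" using False Suc.prems(1) by (intro power_mono) auto
      ultimately have norm_w: "(Re w) ^ 2 + (Im w) ^ 2 \<le> 1 / 2" by (simp add: power2_eq_square)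
      have "moebius S z = - 1 / w" by (simp add: S_def moebius_mat2 w_def)
      then have "Im (moebius S z) = Im z / ((Re w) ^ 2 + (Im w) ^ 2)"
        using \<open>Im w = Im z\<close> by (simp add: Im_divide)
      also have "\<dots> \<ge> Im z / (1 / 2)"
        using norm_w Suc.prems(1) \<open>Im w = Im z\<close> by (intro divide_left_mono mult_pos_pos add_nonneg_pos) auto
      finally have "Im (moebius S z) \<ge> 2 * Im z" by simp
      then have "Im (moebius S z) * 2 ^ N \<ge> (2 * Im z) * 2 ^ N" by (intro mult_right_mono) auto
      moreover have "Im z * 2 ^ Suc N = (2 * Im z) * 2 ^ N" by simp
      ultimately have "Im (moebius S z) * 2 ^ N \<ge> 1 / 2" using Suc.prems(2) by linarith
      then obtain A where A: "A \<in> SL2Z" "Im (moebius A (moebius S z)) \<ge> 1 / 2"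
        using Suc.IH[OF Im_moebius_pos[OF S Suc.prems(1)]] by blast
      then show ?thesis
        using SL2Z_mult[OF A(1) S] moebius_mult[OF A(1) S Suc.prems(1)] by (intro bexI[of _ "A ** S"]) auto
    qed
  qed
  moreover obtain N where "Im z * 2 ^ N \<ge> 1 / 2"
  proof -
    obtain N where "1 / (2 * Im z) < 2 ^ N" using real_arch_pow[of 2 "1 / (2 * Im z)"] by auto
    then have "Im z * 2 ^ N \<ge> 1 / 2" using assms by (simp add: field_simps)
    then show thesis by (rule that)
  qed
  ultimately show thesis using assms that by blast
qed

section \<open>Uniqueness by the maximum principle\<close>

lemma has_q_expansion_diff:
  assumes "has_q_expansion h f c" "has_q_expansion h g d"
  shows "has_q_expansion h (\<lambda>z. f z - g z) (\<lambda>n. c n - d n)"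
  unfolding has_q_expansion_def
proof (intro conjI ballI)
  have "{n. n < 0 \<and> c n - d n \<noteq> 0} \<subseteq> {n. n < 0 \<and> c n \<noteq> 0} \<union> {n. n < 0 \<and> d n \<noteq> 0}" by auto
  then show "finite {n. n < 0 \<and> c n - d n \<noteq> 0}"
    by (rule finite_subset) (use assms in \<open>simp add: has_q_expansion_def\<close>)
  fix z assume "z \<in> upper_half_plane"
  then have "((\<lambda>n. c n * exp (2 * of_real pi * \<i> * of_int n * z / of_nat h)) has_sum f z) UNIV"
    "((\<lambda>n. d n * exp (2 * of_real pi * \<i> * of_int n * z / of_nat h)) has_sum g z) UNIV"
    using assms by (auto simp: has_q_expansion_def)
  from has_sum_add[OF this(1) has_sum_cmult_right[OF this(2), of "- 1"]]
  show "((\<lambda>n. (c n - d n) * exp (2 * of_real pi * \<i> * of_int n * z / of_nat h)) has_sum f z - g z) UNIV"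
    by (simp add: left_diff_distrib)
qed

lemma M0_sharp_diff:
  assumes f: "f \<in> M0_sharp N" and g: "g \<in> M0_sharp N"
  shows "(\<lambda>z. f z - g z) \<in> M0_sharp N"
  unfolding M0_sharp_def
proof (intro CollectI conjI ballI allI impI)
  show "(\<lambda>z. f z - g z) holomorphic_on upper_half_plane"
    using f g by (intro holomorphic_intros) (auto simp: M0_sharp_def)
  show "meromorphic_at_cusp N (\<lambda>z. f z - g z) A" if "A \<in> SL2Z" for A
  proof -
    have "meromorphic_at_cusp N f A" "meromorphic_at_cusp N g A" using f g that by (auto simp: M0_sharp_def)
    then obtain c d where "has_q_expansion N (f \<circ> moebius A) c" "has_q_expansion N (g \<circ> moebius A) d"
      unfolding meromorphic_at_cusp_def by blast
    from has_q_expansion_diff[OF this] show ?thesis unfolding meromorphic_at_cusp_def o_def by blast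
  qed
  show "holomorphic_at_cusp N (\<lambda>z. f z - g z) A" if "A \<in> SL2Z" "\<not> equiv_infinity N A" for A
  proof -
    have "holomorphic_at_cusp N f A" "holomorphic_at_cusp N g A" using f g that by (auto simp: M0_sharp_def)
    then obtain c d where cd: "has_q_expansion N (f \<circ> moebius A) c" "\<forall>n<0. c n = 0"
      "has_q_expansion N (g \<circ> moebius A) d" "\<forall>n<0. d n = 0"
      unfolding holomorphic_at_cusp_def by blast
    from has_q_expansion_diff[OF cd(1,3)] cd(2,4) show ?thesis
      unfolding holomorphic_at_cusp_def o_def by (intro exI[of _ "\<lambda>n. c n - d n"]) auto
  qed
qed (use f g in \<open>auto simp: M0_sharp_def\<close>)

lemma Gamma0_subset: "A \<in> Gamma0 N \<Longrightarrow> A \<in> SL2Z"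
  by (simp add: Gamma0_def)

text \<open>A function in \<open>M0_sharp 6\<close> that is also holomorphic at \<open>\<infinity>\<close> is bounded by its maximum over
  finitely many closed discs, one for each coset of \<open>\<Gamma>\<^sub>0(6)\<close>.\<close>

lemma M0_sharp_eq_0:
  assumes f: "f \<in> M0_sharp 6" and c: "has_q_expansion 1 f c" and c0: "\<And>n. n \<le> 0 \<Longrightarrow> c n = 0"
  shows "f = (\<lambda>z. 0)"
proof -
  have inv: "f (moebius A z) = f z" if "A \<in> Gamma0 6" "Im z > 0" for A z
    using f that by (simp add: M0_sharp_def)
  have "\<exists>g. g holomorphic_on ball 0 1 \<and> (\<forall>z. Im z > 0 \<longrightarrow> f (moebius A z) = g (nome (z / of_nat 6)))"
    if A: "A \<in> SL2Z" for A
  proof (cases "A \<in> Gamma0 6")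
    case True
    obtain g where g: "g holomorphic_on ball 0 1"
      "\<And>z. Im z > 0 \<Longrightarrow> f z * nome (z / of_nat 1) ^ 0 = g (nome (z / of_nat 1))"
      by (rule has_q_expansion_imp_power_series[OF _ c, of 0]) (use c0 in auto)
    have "g \<circ> (\<lambda>w. w ^ 6) holomorphic_on ball 0 1"
      by (rule holomorphic_on_compose_gen[OF _ g(1)])
         (auto intro!: holomorphic_intros simp: norm_power power_less_one_iff)
    moreover have "f (moebius A z) = (g \<circ> (\<lambda>w. w ^ 6)) (nome (z / of_nat 6))" if "Im z > 0" for z
      using inv[OF True that] g(2)[OF that] nome_of_nat_mult[of 6 "z / 6"] by simp
    ultimately show ?thesis by blast
  next
    case False
    then have "\<not> equiv_infinity 6 A" using equiv_infinity_iff[OF A] by simp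
    then obtain c' where c': "has_q_expansion 6 (f \<circ> moebius A) c'" "\<And>n. n < 0 \<Longrightarrow> c' n = 0"
      using f A unfolding M0_sharp_def holomorphic_at_cusp_def by blast
    obtain g where g: "g holomorphic_on ball 0 1"
      "\<And>z. Im z > 0 \<Longrightarrow> (f \<circ> moebius A) z * nome (z / of_nat 6) ^ 0 = g (nome (z / of_nat 6))"
      by (rule has_q_expansion_imp_power_series[OF _ c'(1), of 0]) (use c'(2) in auto)
    then show ?thesis by auto
  qed
  then obtain g where g: "\<And>A. A \<in> SL2Z \<Longrightarrow> g A holomorphic_on ball 0 1"
    "\<And>A z. A \<in> SL2Z \<Longrightarrow> Im z > 0 \<Longrightarrow> f (moebius A z) = g A (nome (z / of_nat 6))"
    by metis
  \<comment> \<open>The bottom row modulo 6 determines the coset: the lower left entry of A B^(-1)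
    is the cross product of the bottom rows of A and B.\<close>
  define key where "key = (\<lambda>A :: int^2^2. (A $ 2 $ 1 mod 6, A $ 2 $ 2 mod 6))"
  have key: "f (moebius A z) = f (moebius B z)"
    if A: "A \<in> SL2Z" and B: "B \<in> SL2Z" and "key A = key B" and z: "Im z > 0" for A B z
  proof -
    have "[A $ 2 $ 1 = B $ 2 $ 1] (mod 6)" "[A $ 2 $ 2 = B $ 2 $ 2] (mod 6)"
      using \<open>key A = key B\<close> by (simp_all add: key_def cong_def)
    then have "[A $ 2 $ 1 * B $ 2 $ 2 = B $ 2 $ 1 * A $ 2 $ 2] (mod 6)"
      by (intro cong_mult) (auto intro: cong_sym)
    then have "6 dvd A $ 2 $ 1 * B $ 2 $ 2 - B $ 2 $ 1 * A $ 2 $ 2" by (simp add: cong_iff_dvd_diff)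
    moreover have "(A ** adj2 B) $ 2 $ 1 = A $ 2 $ 1 * B $ 2 $ 2 - B $ 2 $ 1 * A $ 2 $ 2"
      by (simp add: matrix_matrix_mult_def sum_2 adj2_def)
    ultimately have G: "A ** adj2 B \<in> Gamma0 6"
      using SL2Z_mult[OF A adj2_SL2Z[OF B]] by (simp add: Gamma0_def)
    have "moebius (A ** adj2 B) (moebius B z) = moebius (A ** adj2 B ** B) z"
      by (rule moebius_mult[symmetric]) (use G B z in \<open>auto simp: Gamma0_def\<close>)
    also have "A ** adj2 B ** B = A"
      by (simp add: matrix_mul_assoc[symmetric] adj2_mult[OF B])
    finally show ?thesis using inv[OF G Im_moebius_pos[OF B z]] by simp
  qed
  have "key ` SL2Z \<subseteq> {0..5} \<times> {0..5}"
    by (auto simp: key_def intro!: iffD1[OF zle_diff1_eq] pos_mod_bound)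
  then have "finite (key ` SL2Z)" by (rule finite_subset) simp
  then obtain R where R: "R \<subseteq> SL2Z" "finite R" "key ` SL2Z = key ` R"
    using finite_subset_image[of "key ` SL2Z" key SL2Z] by auto
  then have "R \<noteq> {}" using mat_1_SL2Z by auto
  \<comment> \<open>This is the norm of \<open>nome (z / 6)\<close> at height Im z = 1/2, the height
    reached by \<open>SL2Z_reduce\<close>.\<close>
  define \<rho> where "\<rho> = exp (- (pi / 6))"
  have \<rho>: "0 < \<rho>" "\<rho> < 1" by (simp_all add: \<rho>_def)
  have "\<exists>w\<in>cball 0 \<rho>. \<forall>w'\<in>cball 0 \<rho>. norm (g A w') \<le> norm (g A w)" if "A \<in> R" for A
  proof (rule continuous_attains_sup)
    have "cball 0 \<rho> \<subseteq> (ball 0 1 :: complex set)" using \<rho> by auto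
    moreover have "g A holomorphic_on ball 0 1" using R(1) that by (intro g(1)) auto
    ultimately have "continuous_on (cball 0 \<rho>) (g A)"
      using continuous_on_subset holomorphic_on_imp_continuous_on by blast
    then show "continuous_on (cball 0 \<rho>) (\<lambda>w. norm (g A w))" by (rule continuous_on_norm)
  qed (use \<rho> in auto)
  then obtain w where w: "\<And>A. A \<in> R \<Longrightarrow> w A \<in> cball 0 \<rho>"
    "\<And>A w'. A \<in> R \<Longrightarrow> w' \<in> cball 0 \<rho> \<Longrightarrow> norm (g A w') \<le> norm (g A (w A))" by metis
  have "Max ((\<lambda>A. norm (g A (w A))) ` R) \<in> (\<lambda>A. norm (g A (w A))) ` R"
    using R \<open>R \<noteq> {}\<close> by (intro Max_in) auto
  then obtain A0 where A0: "A0 \<in> R" "Max ((\<lambda>A. norm (g A (w A))) ` R) = norm (g A0 (w A0))" by auto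
  have max: "norm (g A (w A)) \<le> norm (g A0 (w A0))" if "A \<in> R" for A
    using R that unfolding A0(2)[symmetric] by (intro Max_ge) auto
  have A0': "A0 \<in> SL2Z" using A0 R by auto
  have bound: "norm (f z) \<le> norm (g A0 (w A0))" if z: "Im z > 0" for z
  proof -
    obtain B where B: "B \<in> SL2Z" "Im (moebius B z) \<ge> 1 / 2" using SL2Z_reduce[OF z] by blast
    have pos: "Im (moebius B z) > 0" using B by linarith
    have "key (adj2 B) \<in> key ` R" using adj2_SL2Z[OF B(1)] R(3) by blast
    then obtain A where A: "A \<in> R" "key (adj2 B) = key A" by auto
    have "f z = f (moebius (adj2 B) (moebius B z))" by (simp add: moebius_adj2[OF B(1) z])
    also have "\<dots> = f (moebius A (moebius B z))"
      by (rule key) (use A B R pos adj2_SL2Z in auto)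
    also have "\<dots> = g A (nome (moebius B z / of_nat 6))" by (rule g(2)) (use A R pos in auto)
    finally have "f z = g A (nome (moebius B z / of_nat 6))" .
    moreover have "norm (nome (moebius B z / of_nat 6)) \<le> \<rho>"
      using B(2) by (simp add: norm_nome \<rho>_def)
    ultimately show ?thesis using w(2)[OF A(1)] max[OF A(1)] by (metis mem_cball_0 order_trans)
  qed
  \<comment> \<open>The largest of the finitely many maxima bounds f everywhere, hence
    \<open>g A0\<close> on the unit disc, and it is attained at an interior point.\<close>
  have "g A0 constant_on ball 0 1"
  proof (rule maximum_modulus_principle)
    show "g A0 holomorphic_on ball 0 1" by (rule g(1)[OF A0'])
    show "w A0 \<in> ball 0 1" using w(1)[OF A0(1)] \<rho> by auto
    fix u :: complex assume u: "u \<in> ball 0 1"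
    show "norm (g A0 u) \<le> norm (g A0 (w A0))"
    proof (cases "u = 0")
      case True
      then show ?thesis using w(2)[OF A0(1), of 0] \<rho> by simp
    next
      case False
      then obtain z where z: "Im z > 0" "nome z = u" by (rule nome_surj) (use u in auto)
      have "g A0 u = f (moebius A0 (6 * z))" using g(2)[OF A0', of "6 * z"] z by simp
      then show ?thesis using bound[OF Im_moebius_pos[OF A0']] z by simp
    qed
  qed auto
  then obtain k where k: "\<And>u. u \<in> ball 0 1 \<Longrightarrow> g A0 u = k" by (auto simp: constant_on_def)
  have fk: "f z = k" if z: "Im z > 0" for z
  proof -
    let ?y = "moebius (adj2 A0) z"
    have y: "Im ?y > 0" by (rule Im_moebius_pos[OF adj2_SL2Z[OF A0'] z])
    have "f z = f (moebius A0 ?y)" by (simp add: moebius_adj2'[OF A0' z])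
    also have "\<dots> = g A0 (nome (?y / of_nat 6))" by (rule g(2)[OF A0' y])
    also have "\<dots> = k" using norm_nome_less_1[of 6 ?y] y by (intro k) simp
    finally show ?thesis .
  qed
  have "has_q_expansion 1 f (\<lambda>n. fls_nth (fls_const k) n)"
    by (rule has_q_expansionI[where g = "\<lambda>_. k"]) (use fk in auto)
  from has_q_expansion_unique[OF _ c this] have "c 0 = k" by simp
  then have "k = 0" using c0 by simp
  moreover have "f z = 0" if "\<not> Im z > 0" for z using f that by (simp add: M0_sharp_def)
  ultimately show ?thesis using fk by (intro ext) (metis)
qed

section \<open>Polynomials in \<open>psi\<close> as elements of \<open>M0_sharp 6\<close>\<close>

definition from_disc :: "(complex \<Rightarrow> complex) \<Rightarrow> complex \<Rightarrow> complex" where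
  "from_disc g z = (if Im z > 0 then g (nome z) else 0)"

text \<open>The properties of \<open>psi_disc\<close> that are inherited by polynomials in it.\<close>

definition level6 :: "int fls \<Rightarrow> (complex \<Rightarrow> complex) \<Rightarrow> bool" where
  "level6 F g \<longleftrightarrow> g holomorphic_on ball 0 1 - {0} \<and> g has_laurent_expansion complex_fls F \<and>
     (\<forall>A\<in>Gamma0 6. \<forall>z. Im z > 0 \<longrightarrow> from_disc g (moebius A z) = from_disc g z) \<and>
     (\<forall>A\<in>SL2Z - Gamma0 6. \<exists>Y0>0. \<exists>B. \<forall>z. Im z > Y0 \<longrightarrow> norm (from_disc g (moebius A z)) \<le> B)"

lemma level6_const: "level6 (fls_const c) (\<lambda>_. of_int c)"
proof -
  have "\<exists>Y0>0. \<exists>B. \<forall>z. Im z > Y0 \<longrightarrow> norm (from_disc (\<lambda>_. of_int c) (moebius A z)) \<le> B" for A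
    by (intro exI[of _ 1] conjI exI[of _ "norm (of_int c :: complex)"]) (auto simp: from_disc_def)
  then show ?thesis
    by (auto simp: level6_def complex_fls_const from_disc_def Im_moebius_pos Gamma0_subset)
qed

lemma level6_common_bound:
  assumes "level6 F g" "level6 G h" "A \<in> SL2Z - Gamma0 6"
  obtains Y0 B where "Y0 > 0" "\<And>z. Im z > Y0 \<Longrightarrow> norm (from_disc g (moebius A z)) \<le> B"
    "\<And>z. Im z > Y0 \<Longrightarrow> norm (from_disc h (moebius A z)) \<le> B"
proof -
  obtain Y B where Y: "Y > 0" "\<And>z. Im z > Y \<Longrightarrow> norm (from_disc g (moebius A z)) \<le> B"
    using assms(1,3) unfolding level6_def by blast
  obtain Y' B' where Y': "Y' > 0" "\<And>z. Im z > Y' \<Longrightarrow> norm (from_disc h (moebius A z)) \<le> B'"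
    using assms(2,3) unfolding level6_def by blast
  show thesis
    by (rule that[of "max Y Y'" "max B B'"]) (use Y Y' in \<open>auto simp: le_max_iff_disj\<close>)
qed

lemma level6_add:
  assumes F: "level6 F g" and G: "level6 G h"
  shows "level6 (F + G) (\<lambda>w. g w + h w)"
  unfolding level6_def
proof (intro conjI ballI allI impI)
  have add: "from_disc (\<lambda>w. g w + h w) z = from_disc g z + from_disc h z" for z by (simp add: from_disc_def)
  show "(\<lambda>w. g w + h w) holomorphic_on ball 0 1 - {0}"
    using F G by (intro holomorphic_intros) (auto simp: level6_def)
  show "(\<lambda>w. g w + h w) has_laurent_expansion complex_fls (F + G)"
    using F G unfolding complex_fls_add by (intro has_laurent_expansion_add) (auto simp: level6_def)
  show "from_disc (\<lambda>w. g w + h w) (moebius A z) = from_disc (\<lambda>w. g w + h w) z" if "A \<in> Gamma0 6" "Im z > 0" for A z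
    using F G that unfolding add by (simp add: level6_def)
  fix A assume A: "A \<in> SL2Z - Gamma0 6"
  obtain Y0 B where Y0: "Y0 > 0" "\<And>z. Im z > Y0 \<Longrightarrow> norm (from_disc g (moebius A z)) \<le> B"
    "\<And>z. Im z > Y0 \<Longrightarrow> norm (from_disc h (moebius A z)) \<le> B" by (rule level6_common_bound[OF F G A]) blast
  then have "norm (from_disc (\<lambda>w. g w + h w) (moebius A z)) \<le> B + B" if "Im z > Y0" for z
    unfolding add using that by (intro norm_triangle_mono) auto
  with Y0(1) show "\<exists>Y0>0. \<exists>B. \<forall>z. Im z > Y0 \<longrightarrow> norm (from_disc (\<lambda>w. g w + h w) (moebius A z)) \<le> B"
    by blast
qed

lemma level6_mult:
  assumes F: "level6 F g" and G: "level6 G h"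
  shows "level6 (F * G) (\<lambda>w. g w * h w)"
  unfolding level6_def
proof (intro conjI ballI allI impI)
  have mult: "from_disc (\<lambda>w. g w * h w) z = from_disc g z * from_disc h z" for z by (simp add: from_disc_def)
  show "(\<lambda>w. g w * h w) holomorphic_on ball 0 1 - {0}"
    using F G by (intro holomorphic_intros) (auto simp: level6_def)
  show "(\<lambda>w. g w * h w) has_laurent_expansion complex_fls (F * G)"
    using F G unfolding complex_fls_mult by (intro has_laurent_expansion_mult) (auto simp: level6_def)
  show "from_disc (\<lambda>w. g w * h w) (moebius A z) = from_disc (\<lambda>w. g w * h w) z" if "A \<in> Gamma0 6" "Im z > 0" for A z
    using F G that unfolding mult by (simp add: level6_def)
  fix A assume A: "A \<in> SL2Z - Gamma0 6"
  obtain Y0 B where Y0: "Y0 > 0" "\<And>z. Im z > Y0 \<Longrightarrow> norm (from_disc g (moebius A z)) \<le> B"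
    "\<And>z. Im z > Y0 \<Longrightarrow> norm (from_disc h (moebius A z)) \<le> B" by (rule level6_common_bound[OF F G A]) blast
  have "norm (from_disc (\<lambda>w. g w * h w) (moebius A z)) \<le> B * B" if "Im z > Y0" for z
    unfolding mult norm_mult using Y0(2,3)[OF that] order_trans[OF norm_ge_zero Y0(2)[OF that]]
    by (intro mult_mono) auto
  with Y0(1) show "\<exists>Y0>0. \<exists>B. \<forall>z. Im z > Y0 \<longrightarrow> norm (from_disc (\<lambda>w. g w * h w) (moebius A z)) \<le> B"
    by blast
qed

lemma level6_Psi: "level6 Psi psi_disc"
  unfolding level6_def
proof (intro conjI ballI allI impI psi_disc_holomorphic psi_disc_expansion)
  have psi: "from_disc psi_disc z = psi z" if "Im z > 0" for z using that by (simp add: from_disc_def psi_eq)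
  fix A :: "int^2^2" and z assume A: "A \<in> Gamma0 6" and z: "Im z > 0"
  have "psi (moebius A z) = psi z"
    unfolding moebius_def using A z by (intro psi_invariant) (auto simp: Gamma0_def SL2Z_iff)
  then show "from_disc psi_disc (moebius A z) = from_disc psi_disc z"
    using psi Im_moebius_pos[OF Gamma0_subset[OF A] z] z by simp
next
  fix A :: "int^2^2" assume A: "A \<in> SL2Z - Gamma0 6"
  then have det: "A $ 1 $ 1 * A $ 2 $ 2 - A $ 1 $ 2 * A $ 2 $ 1 = 1" and c: "\<not> 6 dvd A $ 2 $ 1"
    by (auto simp: SL2Z_iff Gamma0_def)
  obtain Y0 B where Y0: "Y0 > 0" "\<And>z. Im z > Y0 \<Longrightarrow> norm (psi (moebius A z)) \<le> B"
    unfolding moebius_def using psi_bounded_at_cusp[OF det c] by blast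
  have "norm (from_disc psi_disc (moebius A z)) \<le> B" if "Im z > Y0" for z
    using Y0 that Im_moebius_pos[of A z] A by (simp add: from_disc_def psi_eq[symmetric])
  then show "\<exists>Y0>0. \<exists>B. \<forall>z. Im z > Y0 \<longrightarrow> norm (from_disc psi_disc (moebius A z)) \<le> B"
    using Y0(1) by blast
qed

lemma level6_exists: "F \<in> R \<Longrightarrow> \<exists>g. level6 F g"
  by (induction rule: R.induct) (blast intro: level6_const level6_add level6_mult level6_Psi)+

text \<open>Conjugating the translation by 6 with \<open>A\<close> gives lower left entry -6 c^2,
  where c is that of \<open>A\<close>; hence invariant functions have period 6 at every
  cusp.\<close>

lemma moebius_translate:
  assumes A: "A \<in> SL2Z" and z: "Im z > 0"
  obtains G where "G \<in> Gamma0 6" "moebius A (z + 6) = moebius G (moebius A z)"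
proof -
  define G where "G = A ** mat2 1 6 0 1 ** adj2 A"
  have T: "mat2 1 6 0 1 \<in> SL2Z" by (simp add: SL2Z_iff)
  have AT: "A ** mat2 1 6 0 1 \<in> SL2Z" by (rule SL2Z_mult[OF A T])
  have G: "G \<in> SL2Z" unfolding G_def by (rule SL2Z_mult[OF AT adj2_SL2Z[OF A]])
  have "G $ 2 $ 1 = - 6 * (A $ 2 $ 1) ^ 2"
    by (simp add: G_def adj2_def matrix_matrix_mult_def sum_2 power2_eq_square algebra_simps)
  then have "G \<in> Gamma0 6" using G by (simp add: Gamma0_def)
  moreover have "moebius A (z + 6) = moebius G (moebius A z)"
  proof -
    have "moebius G (moebius A z) = moebius (G ** A) z" by (rule moebius_mult[symmetric, OF G A z])
    also have "G ** A = A ** mat2 1 6 0 1"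
      by (simp add: G_def matrix_mul_assoc[symmetric] adj2_mult[OF A])
    also have "moebius \<dots> z = moebius A (moebius (mat2 1 6 0 1) z)" by (rule moebius_mult[OF A T z])
    also have "moebius (mat2 1 6 0 1) z = z + 6" by (simp add: moebius_mat2)
    finally show ?thesis by simp
  qed
  ultimately show thesis by (rule that)
qed

text \<open>For \<open>A\<close> in \<open>Gamma0 6\<close> invariance reduces the expansion at the
  cusp to the one at infinity, rewritten in sixth powers of \<open>nome (z / 6)\<close>. Elsewhere
  period 6 and boundedness give a power series.\<close>

lemma level6_M0_sharp:
  assumes F: "level6 F g"
  shows "from_disc g \<in> M0_sharp 6" and "has_q_expansion 1 (from_disc g) (\<lambda>n. of_int (fls_nth F n))"
proof -
  let ?f = "from_disc g"
  have g: "g holomorphic_on ball 0 1 - {0}" "g has_laurent_expansion complex_fls F"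
    using F by (auto simp: level6_def)
  have inv: "?f (moebius A z) = ?f z" if "A \<in> Gamma0 6" "Im z > 0" for A z
    using F that by (simp add: level6_def)
  have "has_q_expansion 1 ?f (\<lambda>n. fls_nth (complex_fls F) n)"
    by (rule has_q_expansionI[OF _ g]) (auto simp: from_disc_def)
  then show "has_q_expansion 1 ?f (\<lambda>n. of_int (fls_nth F n))" by simp
  have hol: "?f holomorphic_on upper_half_plane"
  proof -
    have "g \<circ> nome holomorphic_on upper_half_plane"
      by (rule holomorphic_on_compose_gen[OF _ g(1)])
         (auto intro!: holomorphic_intros simp: norm_nome)
    then show ?thesis by (rule holomorphic_transform) (simp add: from_disc_def)
  qed
  have at_infinity: "meromorphic_at_cusp 6 ?f A" if A: "A \<in> Gamma0 6" for A
  proof -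
    have "(\<lambda>w::complex. w ^ 6) has_fps_expansion fps_X ^ 6" by (intro fps_expansion_intros)
    then have exp6: "(g \<circ> (\<lambda>w. w ^ 6)) has_laurent_expansion fls_compose_fps (complex_fls F) (fps_X ^ 6)"
      by (intro has_laurent_expansion_compose[OF g(2)] has_laurent_expansion_fps) auto
    have hol6: "g \<circ> (\<lambda>w. w ^ 6) holomorphic_on ball 0 1 - {0}"
      by (rule holomorphic_on_compose_gen[OF _ g(1)])
         (auto intro!: holomorphic_intros simp: norm_power power_less_one_iff)
    have "has_q_expansion 6 (?f \<circ> moebius A) (\<lambda>n. fls_nth (fls_compose_fps (complex_fls F) (fps_X ^ 6)) n)"
    proof (rule has_q_expansionI[OF _ hol6 exp6])
      fix z :: complex assume z: "Im z > 0"
      show "(?f \<circ> moebius A) z = (g \<circ> (\<lambda>w. w ^ 6)) (nome (z / of_nat 6))"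
        using inv[OF A z] z nome_of_nat_mult[of 6 "z / 6"] by (simp add: from_disc_def)
    qed auto
    then show ?thesis unfolding meromorphic_at_cusp_def by blast
  qed
  have at_cusp: "holomorphic_at_cusp 6 ?f A" if A: "A \<in> SL2Z - Gamma0 6" for A
  proof -
    obtain Y0 B where Y0: "Y0 > 0" "\<And>z. Im z > Y0 \<Longrightarrow> norm (?f (moebius A z)) \<le> B"
      using F A unfolding level6_def by blast
    have "moebius A ` upper_half_plane \<subseteq> upper_half_plane" using Im_moebius_pos A by auto
    then have "?f \<circ> moebius A holomorphic_on upper_half_plane"
      using A hol by (intro holomorphic_on_compose_gen[OF moebius_holomorphic]) auto
    moreover have "(?f \<circ> moebius A) (z + of_nat 6) = (?f \<circ> moebius A) z" if z: "Im z > 0" for z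
    proof -
      obtain G where "G \<in> Gamma0 6" "moebius A (z + 6) = moebius G (moebius A z)"
        using moebius_translate[of A z] A z by auto
      then show ?thesis using inv Im_moebius_pos[of A z] A z by simp
    qed
    ultimately obtain k where k: "k holomorphic_on ball 0 1"
      "\<And>z. Im z > 0 \<Longrightarrow> (?f \<circ> moebius A) z = k (nome (z / of_nat 6))"
      using periodic_function_of_nome[of 6 "?f \<circ> moebius A" Y0 B] Y0 by (metis comp_apply zero_less_numeral)
    have exp_k: "k has_laurent_expansion fps_to_fls (fps_expansion k 0)"
      using k(1) by (intro has_laurent_expansion_fps analytic_at_imp_has_fps_expansion_0)
        (auto simp: analytic_at intro!: exI[of _ "ball 0 1"])
    have hol_k: "k holomorphic_on ball 0 1 - {0}" by (rule holomorphic_on_subset[OF k(1)]) auto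
    have "has_q_expansion 6 (?f \<circ> moebius A) (\<lambda>n. fls_nth (fps_to_fls (fps_expansion k 0)) n)"
      by (rule has_q_expansionI[OF _ hol_k exp_k k(2)]) simp
    then show ?thesis unfolding holomorphic_at_cusp_def
      by (intro exI[of _ "\<lambda>n. fls_nth (fps_to_fls (fps_expansion k 0)) n"]) auto
  qed
  show "?f \<in> M0_sharp 6"
    unfolding M0_sharp_def
  proof (intro CollectI conjI ballI allI impI hol)
    fix A assume A: "A \<in> SL2Z"
    show "meromorphic_at_cusp 6 ?f A"
    proof (cases "A \<in> Gamma0 6")
      case False
      then show ?thesis using at_cusp[of A] A unfolding holomorphic_at_cusp_def meromorphic_at_cusp_def by blast
    qed (rule at_infinity)
    show "\<not> equiv_infinity 6 A \<Longrightarrow> holomorphic_at_cusp 6 ?f A"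
      using at_cusp[of A] A equiv_infinity_iff[OF A] by simp
  qed (use inv in \<open>auto simp: from_disc_def\<close>)
qed

text \<open>This justifies the definite description in \<open>f0\<close>: existence comes from the
  Faber polynomial, and the difference of two candidates has no nonpositive exponents, so
  \<open>M0_sharp_eq_0\<close> applies.\<close>

lemma f0_expansion: "has_q_expansion 1 (f0 6 m) (\<lambda>n. of_int (fls_nth (faber m) n))"
proof -
  let ?P = "\<lambda>f. f \<in> M0_sharp 6 \<and> (\<exists>c. has_q_expansion 1 f c \<and> c (- int m) = 1 \<and> (\<forall>n\<le>0. n \<noteq> - int m \<longrightarrow> c n = 0))"
  obtain g where g: "level6 (faber m) g" using level6_exists[OF faber_in_R] by blast
  note f = level6_M0_sharp[OF g]
  have P: "?P (from_disc g)"
    using f by (intro conjI exI[of _ "\<lambda>n. of_int (fls_nth (faber m) n)"]) (auto simp: faber_nonpos)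
  have "f = from_disc g" if "?P f" for f
  proof -
    obtain c where c: "has_q_expansion 1 f c" "c (- int m) = 1" "\<And>n. n \<le> 0 \<Longrightarrow> n \<noteq> - int m \<Longrightarrow> c n = 0"
      using \<open>?P f\<close> by blast
    have "(\<lambda>z. f z - from_disc g z) = (\<lambda>z. 0)"
    proof (rule M0_sharp_eq_0)
      show "(\<lambda>z. f z - from_disc g z) \<in> M0_sharp 6" using \<open>?P f\<close> f by (intro M0_sharp_diff) auto
      show "has_q_expansion 1 (\<lambda>z. f z - from_disc g z) (\<lambda>n. c n - of_int (fls_nth (faber m) n))"
        by (rule has_q_expansion_diff[OF c(1) f(2)])
      show "c n - of_int (fls_nth (faber m) n) = 0" if "n \<le> 0" for n
        using c(2,3) that by (cases "n = - int m") (auto simp: faber_nonpos)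
    qed
    then show ?thesis by (metis eq_iff_diff_eq_0 ext)
  qed
  with P have "f0 6 m = from_disc g" unfolding f0_def by (rule the_equality)
  then show ?thesis using f by simp
qed

lemma a0_eq_faber: "a0 6 m n = of_int (fls_nth (faber m) n)"
  unfolding a0_def by (simp add: fourier_coeff_eqI[OF f0_expansion])

theorem theorem1p3:
  fixes a b :: nat
  shows
    "(\<forall>(r::nat) (s::int). r > 0 \<and> coprime r 2 \<and> coprime s 2 \<longrightarrow>
        (a > b \<longrightarrow> (\<exists>k::int. a0 6 (2 ^ a * r) (2 ^ b * s) = of_int (2 ^ (a - b + 2) * k))) \<and>
        (b > a \<longrightarrow> (\<exists>k::int. a0 6 (2 ^ a * r) (2 ^ b * s) = of_int (2 ^ 2 * k)))) \<and>
     (\<forall>(r::nat) (s::int). r > 0 \<and> coprime r 3 \<and> coprime s 3 \<longrightarrow>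
        (a > b \<longrightarrow> (\<exists>k::int. a0 6 (3 ^ a * r) (3 ^ b * s) = of_int (3 ^ (a - b + 1) * k))) \<and>
        (b > a \<longrightarrow> (\<exists>k::int. a0 6 (3 ^ a * r) (3 ^ b * s) = of_int (3 * k))))"
proof -
  have dvd: "\<exists>k::int. a0 6 m n = of_int (M * k)" if "M dvd fls_nth (faber m) n" for m n M
    using that unfolding a0_eq_faber by (metis dvdE)
  have "odd r" if "coprime r 2" for r :: nat using that by (simp add: coprime_commute)
  moreover have "\<not> 3 dvd r" if "coprime r 3" for r :: nat
    using that by (metis coprime_absorb_left coprime_commute nat_dvd_1_iff_1 numeral_eq_one_iff semiring_norm(86))
  ultimately show ?thesis
    using faber_lower_mod_2 faber_lower_mod_3 faber_upper_mod_4 faber_upper_mod_3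
    by (intro conjI allI impI dvd) auto
qed

end
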